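(* Let $\Gamma\subseteq\Delta\subseteq\mathcal{T}$ be discrete countable LCA groups such that $\mathcal{T}/\Gamma$ is finite. Let $(\mathcal{X},\mu)$ be a $\sigma$-finite measure space with $L^2(\mathcal{X})$ separable, and let $\sigma$ be a quasi-$\mathcal{T}$-invariant action of $\mathcal{T}$ on $\mathcal{X}$ with the tiling property, with tiling set $C_{\mathcal{T}}$; the groups $\Gamma$ and $\Delta$ act on $\mathcal{X}$ by restriction of $\sigma$. Let $V\subseteq L^2(\mathcal{X})$ be a $(\Gamma,\sigma)$-invariant space. With $s+1=\#\Gamma^*$ and $\Omega$, $\mathcal{N}$, $Z$, $\{\mathcal{H}_\xi\}_{\xi\in\mathcal{N}}$ as defined in the context, the following are equivalent: (i) $V$ is $(\Delta,\sigma)$-invariant; (ii) $Z[V]\subseteq L^2\big(\Omega,(L^2(C_{\mathcal{T}}))^{s+1}\big)$ is a decomposable MI-space with respect to $\{\mathcal{H}_\xi\}_{\xi\in\mathcal{N}}$.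
   Context: Groups are written additively; $\widehat{G}$ is the Pontryagin dual of an LCA group $G$, $m_{\widehat G}$ its Haar measure, and $(x,\xi)$ denotes the character $\xi\in\widehat G$ evaluated at $x\in G$. For a subgroup $H\subseteq\mathcal{T}$, $H^*=\{\xi\in\widehat{\mathcal{T}}:(h,\xi)=1\ \forall h\in H\}$ is its annihilator; so $\Delta^*\subseteq\Gamma^*\subseteq\widehat{\mathcal{T}}$, and $\#\Gamma^*=\#(\mathcal{T}/\Gamma)$ is finite. Write $\Gamma^*=\{\gamma_0^*,\dots,\gamma_s^*\}$. A section of a quotient is a set containing exactly one representative of each coset. $\Omega\subseteq\widehat{\mathcal{T}}$ is a measurable section of $\widehat{\mathcal{T}}/\Gamma^*$, equipped with the restriction of $m_{\widehat{\mathcal{T}}}$, and $\mathcal{N}\subseteq\Gamma^*$ is a section of $\Gamma^*/\Delta^*$. Actions. Let $G$ be a discrete countable LCA group. A measurable action $\sigma:G\times\mathcal{X}\to\mathcal{X}$, $\sigma_g(x)=\sigma(g,x)$, satisfies: each $\sigma_g$ is $\mu$-measurable, $\sigma_g\circ\sigma_{g'}=\sigma_{g+g'}$, and $\sigma_e=\mathrm{id}$. It is quasi-$G$-invariant if there is a measurable function $J_\sigma:G\times\mathcal{X}\to\mathbb{R}^+$ (the Jacobian) with $d\mu(\sigma_g(x))=J_\sigma(g,x)\,d\mu(x)$. It induces the unitary representation $\Pi$ of $G$ on $L^2(\mathcal{X})$, $\Pi_g f(x)=J_\sigma(-g,x)^{1/2}f(\sigma_{-g}(x))$. It has the tiling property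 if there is a measurable set $C_G\subseteq\mathcal{X}$ (a tiling set) with $\mu(\mathcal{X}\setminus\bigcup_{g\in G}\sigma_g(C_G))=0$ and $\mu(\sigma_g(C_G)\cap\sigma_{g'}(C_G))=0$ for $g\ne g'$. For a subgroup $H\subseteq\mathcal{T}$, a closed subspace $V\subseteq L^2(\mathcal{X})$ is $(H,\sigma)$-invariant if $\Pi_h f\in V$ for all $f\in V$, $h\in H$. Zak transforms. $Z_{\mathcal{T}}:L^2(\mathcal{X})\to L^2(\widehat{\mathcal{T}},L^2(C_{\mathcal{T}}))$ is the isometric isomorphism (Haar measure on $\widehat{\mathcal{T}}$ suitably normalized) given by $Z_{\mathcal{T}}[f](\hat\tau)(x)=\sum_{\tau\in\mathcal{T}}\Pi_\tau f(x)\,(-\tau,\hat\tau)$. The map $Z:L^2(\mathcal{X})\to L^2\big(\Omega,(L^2(C_{\mathcal{T}}))^{s+1}\big)$ is the isomorphism $$Z[f](\omega)(x):=\big(Z_{\mathcal{T}}[f](\omega+\gamma_0^* )(x),\dots,Z_{\mathcal{T}}[f](\omega+\gamma_s^* )(x)\big),\qquad \omega\in\Omega,\ x\in C_{\mathcal{T}}.$$ MI-spaces. Let $\mathcal{H}$ be a separable Hilbert space and $(\mathcal{Y},\nu)$ a measure space. A set $D\subseteq L^\infty(\mathcal{Y})$ is a determining set for $L^1(\mathcal{Y})$ if $f\in L^1(\mathcal{Y})$ and $\int_{\mathcal{Y}}fg\,d\nu=0$ for all $g\in D$ imply $f=0$. A multiplicatively invariant space (MI-space) with respect to $D$ is a closed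 subspace $M\subseteq L^2(\mathcal{Y},\mathcal{H})$ such that $g\Phi\in M$ for all $\Phi\in M$, $g\in D$. Given an orthogonal decomposition $\mathcal{H}=\bigoplus_j\mathcal{H}_j$, let $\mathcal{P}_j(\Phi)(y)=P_{\mathcal{H}_j}(\Phi(y))$, where $P_{\mathcal{H}_j}$ is the orthogonal projection of $\mathcal{H}$ onto $\mathcal{H}_j$, and let $M_j=\{\mathcal{P}_j(\Phi):\Phi\in M\}$. An MI-space $M$ is decomposable with respect to $\{\mathcal{H}_j\}$ if $M_j\subseteq M$ for all $j$. In the theorem, $\mathcal{Y}=\Omega$, $\mathcal{H}=(L^2(C_{\mathcal{T}}))^{s+1}$, and $D=\{e_\gamma\}_{\gamma\in\Gamma}$ with $e_\gamma(\omega)=(\gamma,\omega)$. The decomposition $\mathcal{H}=\bigoplus_{\xi\in\mathcal{N}}\mathcal{H}_\xi$ is given by $$\mathcal{H}_\xi=\{F=(F_0,\dots,F_s)\in(L^2(C_{\mathcal{T}}))^{s+1}:\ F_i=0\text{ for all } i \text{ such that }\gamma_i^*\notin\xi+\Delta^*\}.$$ *)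

theory Defs
  imports "HOL-Analysis.Analysis"
begin

section \<open>Subgroups, cosets, sections\<close>

definition is_subgroup :: "'a::ab_group_add set \<Rightarrow> bool" where
  "is_subgroup H \<longleftrightarrow> 0 \<in> H \<and> (\<forall>x\<in>H. \<forall>y\<in>H. x + y \<in> H) \<and> (\<forall>x\<in>H. - x \<in> H)"

definition coset :: "'a::ab_group_add \<Rightarrow> 'a set \<Rightarrow> 'a set" where
  "coset x H = (+) x ` H"

definition cosets :: "'a::ab_group_add set \<Rightarrow> 'a set \<Rightarrow> 'a set set" where
  "cosets G H = (\<lambda>x. coset x H) ` G"

definition is_section :: "'a::ab_group_add set \<Rightarrow> 'a set \<Rightarrow> 'a set \<Rightarrow> bool" where
  "is_section S G H \<longleftrightarrow> S \<subseteq> G \<and> (\<forall>K\<in>cosets G H. \<exists>!x. x \<in> S \<and> x \<in> K)"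


section \<open>The Pontryagin dual of a discrete abelian group\<close>

text \<open>
  A discrete group is a type of class \<^class>\<open>ab_group_add\<close>; every homomorphism into the
  circle is continuous.  The dual is written additively, and \<open>char_of \<xi> x\<close> is the value
  $(x,\xi)$ of the character \<open>\<xi>\<close> at \<open>x\<close>.
\<close>

typedef (overloaded) 'g dual =
  "{\<eta>. (\<forall>x y. \<eta> (x + y) = \<eta> x * \<eta> y) \<and> (\<forall>x::'g::ab_group_add. cmod (\<eta> x) = 1)}"
  morphisms char_of Char
  by (rule exI[of _ "\<lambda>_. 1"]) auto

setup_lifting type_definition_dual

instantiation dual :: (ab_group_add) ab_group_add
begin

lift_definition zero_dual :: "'a dual" is "\<lambda>_. 1" by simp

lift_definition plus_dual :: "'a dual \<Rightarrow> 'a dual \<Rightarrow> 'a dual" is "\<lambda>\<eta> \<psi> x. \<eta> x * \<psi> x"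
  by (auto simp: norm_mult)

lift_definition uminus_dual :: "'a dual \<Rightarrow> 'a dual" is "\<lambda>\<eta> x. inverse (\<eta> x)"
  by (auto simp: norm_inverse)

lift_definition minus_dual :: "'a dual \<Rightarrow> 'a dual \<Rightarrow> 'a dual" is "\<lambda>\<eta> \<psi> x. \<eta> x * inverse (\<psi> x)"
  by (auto simp: norm_mult norm_inverse)

instance
proof
  fix a b c :: "'a dual"
  show "a + b + c = a + (b + c)" by transfer (simp add: mult.assoc)
  show "a + b = b + a" by transfer (simp add: mult.commute)
  show "0 + a = a" by transfer simp
  show "- a + a = 0"
  proof (transfer, rule ext)
    fix \<eta> :: "'a \<Rightarrow> complex" and x
    assume "(\<forall>x y. \<eta> (x + y) = \<eta> x * \<eta> y) \<and> (\<forall>x. cmod (\<eta> x) = 1)"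
    then have "cmod (\<eta> x) = 1" by blast
    then have "\<eta> x \<noteq> 0" by auto
    then show "inverse (\<eta> x) * \<eta> x = 1" by simp
  qed
  show "a - b = a + - b" by transfer simp
qed

end

text \<open>The compact-open topology of the dual of a discrete group is that of pointwise convergence.\<close>

instantiation dual :: (ab_group_add) topological_space
begin

definition open_dual :: "'a dual set \<Rightarrow> bool" where
  "open_dual U \<longleftrightarrow> (\<exists>W. open W \<and> U = char_of -` W)"

instance
proof
  show "open (UNIV :: 'a dual set)"
    unfolding open_dual_def by (rule exI[of _ UNIV]) simp
  fix S T :: "'a dual set"
  assume "open S" "open T"
  then obtain A B where "open A" "S = char_of -` A" "open B" "T = char_of -` B"
    unfolding open_dual_def by blast
  then show "open (S \<inter> T)"
    unfolding open_dual_def by (intro exI[of _ "A \<inter> B"]) auto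
next
  fix \<K> :: "'a dual set set"
  assume "\<forall>S\<in>\<K>. open S"
  then have "\<forall>S\<in>\<K>. \<exists>W. open W \<and> S = char_of -` W"
    unfolding open_dual_def .
  then obtain W where W: "\<forall>S\<in>\<K>. open (W S) \<and> S = char_of -` W S"
    by (rule bchoice[THEN exE])
  have "\<Union>\<K> = (\<Union>S\<in>\<K>. char_of -` W S)"
    using W by (intro arg_cong[where f = Union]) force
  also have "\<dots> = char_of -` (\<Union>S\<in>\<K>. W S)" by (simp add: vimage_UN)
  finally show "open (\<Union>\<K>)"
    unfolding open_dual_def using W by (intro exI[of _ "\<Union>S\<in>\<K>. W S"]) (auto intro: open_UN)
qed

end

definition annihilator :: "'g::ab_group_add set \<Rightarrow> 'g dual set" where
  "annihilator H = {\<xi>. \<forall>h\<in>H. char_of \<xi> h = 1}"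

text \<open>
  Haar measure on the compact dual group, with the normalization (total mass 1) that makes the
  Zak transform below isometric.  For a countable group the dual is compact and metrizable, so
  regularity is automatic for a finite Borel measure.
\<close>

definition is_haar :: "'g::ab_group_add dual measure \<Rightarrow> bool" where
  "is_haar m \<longleftrightarrow> sets m = sets borel \<and> emeasure m UNIV = 1 \<and>
     (\<forall>\<xi>. \<forall>A\<in>sets m. emeasure m ((+) \<xi> ` A) = emeasure m A)"


section \<open>Hilbert spaces presented by representatives\<close>

text \<open>
  Spaces such as $L^2(\mathcal{Y},\mathcal{H})$ depend on a measure and hence are not types.
  A Hilbert space is presented by a carrier of representatives with linear structure and inner
  product (linear in the first argument); two representatives \<open>x\<close>, \<open>y\<close> denote the same vector
  iff \<open>hnorm H (hdiff H x y) = 0\<close>.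
\<close>

record 'h hilb =
  carr :: "'h set"
  hadd :: "'h \<Rightarrow> 'h \<Rightarrow> 'h"
  hscale :: "complex \<Rightarrow> 'h \<Rightarrow> 'h"
  hinner :: "'h \<Rightarrow> 'h \<Rightarrow> complex"

definition hdiff :: "'h hilb \<Rightarrow> 'h \<Rightarrow> 'h \<Rightarrow> 'h" where
  "hdiff H x y = hadd H x (hscale H (-1) y)"

definition hnorm :: "'h hilb \<Rightarrow> 'h \<Rightarrow> real" where
  "hnorm H x = sqrt (Re (hinner H x x))"

definition hseparable :: "'h hilb \<Rightarrow> bool" where
  "hseparable H \<longleftrightarrow> (\<exists>D. countable D \<and> D \<subseteq> carr H \<and>
     (\<forall>x\<in>carr H. \<forall>e>0. \<exists>d\<in>D. hnorm H (hdiff H x d) < e))"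

text \<open>
  Constant sequences in the last clause show that a closed subspace contains, with a vector, all
  of its representatives; so these sets correspond exactly to closed subspaces of the quotient.
\<close>

definition closed_subspace :: "'h hilb \<Rightarrow> 'h set \<Rightarrow> bool" where
  "closed_subspace H V \<longleftrightarrow> V \<subseteq> carr H \<and> V \<noteq> {} \<and>
     (\<forall>u\<in>V. \<forall>v\<in>V. hadd H u v \<in> V) \<and>
     (\<forall>c. \<forall>v\<in>V. hscale H c v \<in> V) \<and>
     (\<forall>u. \<forall>x\<in>carr H. (\<forall>n. u n \<in> V) \<and> (\<lambda>n::nat. hnorm H (hdiff H (u n) x)) \<longlonglongrightarrow> 0 \<longrightarrow> x \<in> V)"

definition is_oproj :: "'h hilb \<Rightarrow> 'h set \<Rightarrow> 'h \<Rightarrow> 'h \<Rightarrow> bool" where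
  "is_oproj H S x p \<longleftrightarrow> p \<in> S \<and> (\<forall>v\<in>S. hinner H (hdiff H x p) v = 0)"

text \<open>The last clause says that the closed linear span of the summands is the whole space.\<close>

definition orthogonal_decomposition :: "'h hilb \<Rightarrow> 'j set \<Rightarrow> ('j \<Rightarrow> 'h set) \<Rightarrow> bool" where
  "orthogonal_decomposition H J Hs \<longleftrightarrow>
     (\<forall>j\<in>J. closed_subspace H (Hs j)) \<and>
     (\<forall>i\<in>J. \<forall>j\<in>J. i \<noteq> j \<longrightarrow> (\<forall>u\<in>Hs i. \<forall>v\<in>Hs j. hinner H u v = 0)) \<and>
     (\<forall>M. closed_subspace H M \<and> (\<forall>j\<in>J. Hs j \<subseteq> M) \<longrightarrow> M = carr H)"

definition scalars :: "complex hilb" where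
  "scalars = \<lparr>carr = UNIV, hadd = (+), hscale = (*), hinner = (\<lambda>z w. z * cnj w)\<rparr>"

text \<open>The $n$-fold direct sum; only the entries with index below \<open>n\<close> of \<open>F\<close> matter.\<close>

definition hpower :: "nat \<Rightarrow> 'h hilb \<Rightarrow> (nat \<Rightarrow> 'h) hilb" where
  "hpower n H = \<lparr>carr = {F. \<forall>i<n. F i \<in> carr H},
     hadd = (\<lambda>F G i. hadd H (F i) (G i)),
     hscale = (\<lambda>c F i. hscale H c (F i)),
     hinner = (\<lambda>F G. \<Sum>i<n. hinner H (F i) (G i))\<rparr>"

text \<open>
  $L^2(N,H)$ for a separable Hilbert space \<open>H\<close>: by Pettis' theorem, measurability of an
  \<open>H\<close>-valued function amounts to measurability of its inner products with the vectors of \<open>H\<close>.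
\<close>

definition L2 :: "'y measure \<Rightarrow> 'h hilb \<Rightarrow> ('y \<Rightarrow> 'h) hilb" where
  "L2 N H = \<lparr>carr = {\<Phi>. (\<forall>y\<in>space N. \<Phi> y \<in> carr H) \<and>
       (\<forall>h\<in>carr H. (\<lambda>y. hinner H (\<Phi> y) h) \<in> borel_measurable N) \<and>
       integrable N (\<lambda>y. (hnorm H (\<Phi> y))\<^sup>2)},
     hadd = (\<lambda>\<Phi> \<Psi> y. hadd H (\<Phi> y) (\<Psi> y)),
     hscale = (\<lambda>c \<Phi> y. hscale H c (\<Phi> y)),
     hinner = (\<lambda>\<Phi> \<Psi>. \<integral>y. hinner H (\<Phi> y) (\<Psi> y) \<partial>N)\<rparr>"

lemma carr_L2_scalars:
  "carr (L2 N scalars) = {f \<in> borel_measurable N. integrable N (\<lambda>x. (cmod (f x))\<^sup>2)}"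
proof -
  have n: "(hnorm scalars z)\<^sup>2 = (cmod z)\<^sup>2" for z
    by (simp add: hnorm_def scalars_def complex_mult_cnj cmod_power2)
  have "(\<forall>h. (\<lambda>y. f y * cnj h) \<in> borel_measurable N) \<longleftrightarrow> f \<in> borel_measurable N"
    for f :: "'a \<Rightarrow> complex"
  proof
    assume "\<forall>h. (\<lambda>y. f y * cnj h) \<in> borel_measurable N"
    from this[rule_format, of 1] show "f \<in> borel_measurable N" by simp
  qed simp
  then show ?thesis
    unfolding L2_def by (simp add: n) (simp add: scalars_def)
qed


section \<open>Multiplicatively invariant spaces\<close>

definition Linf :: "'y measure \<Rightarrow> ('y \<Rightarrow> complex) set" where
  "Linf N = {g \<in> borel_measurable N. \<exists>K. AE y in N. cmod (g y) \<le> K}"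

definition determining_set :: "'y measure \<Rightarrow> ('y \<Rightarrow> complex) set \<Rightarrow> bool" where
  "determining_set N D \<longleftrightarrow> D \<subseteq> Linf N \<and>
     (\<forall>f::'y \<Rightarrow> complex. integrable N f \<and> (\<forall>g\<in>D. (\<integral>y. f y * g y \<partial>N) = 0)
        \<longrightarrow> (AE y in N. f y = 0))"

definition MI_space ::
  "'y measure \<Rightarrow> 'h hilb \<Rightarrow> ('y \<Rightarrow> complex) set \<Rightarrow> ('y \<Rightarrow> 'h) set \<Rightarrow> bool" where
  "MI_space N H D M \<longleftrightarrow> determining_set N D \<and> closed_subspace (L2 N H) M \<and>
     (\<forall>\<Phi>\<in>M. \<forall>g\<in>D. (\<lambda>y. hscale H (g y) (\<Phi> y)) \<in> M)"

text \<open>$\{\mathcal{P}_S\Phi : \Phi\in M\}$, where $\mathcal{P}_S$ projects onto \<open>S\<close> fibrewise.\<close>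

definition proj_image ::
  "'y measure \<Rightarrow> 'h hilb \<Rightarrow> 'h set \<Rightarrow> ('y \<Rightarrow> 'h) set \<Rightarrow> ('y \<Rightarrow> 'h) set" where
  "proj_image N H S M =
     {\<Psi> \<in> carr (L2 N H). \<exists>\<Phi>\<in>M. AE y in N. is_oproj H S (\<Phi> y) (\<Psi> y)}"

definition decomposable_MI_space ::
  "'y measure \<Rightarrow> 'h hilb \<Rightarrow> ('y \<Rightarrow> complex) set \<Rightarrow> 'j set \<Rightarrow> ('j \<Rightarrow> 'h set) \<Rightarrow> ('y \<Rightarrow> 'h) set \<Rightarrow> bool"
  where
  "decomposable_MI_space N H D J Hs M \<longleftrightarrow> MI_space N H D M \<and>
     orthogonal_decomposition H J Hs \<and> (\<forall>j\<in>J. proj_image N H (Hs j) M \<subseteq> M)"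


section \<open>Quasi-invariant actions\<close>

definition measurable_action :: "('g::ab_group_add \<Rightarrow> 'x \<Rightarrow> 'x) \<Rightarrow> 'x measure \<Rightarrow> bool" where
  "measurable_action \<sigma> \<mu> \<longleftrightarrow> (\<forall>g. \<sigma> g \<in> measurable \<mu> \<mu>) \<and>
     (\<forall>g h. \<forall>x\<in>space \<mu>. \<sigma> g (\<sigma> h x) = \<sigma> (g + h) x) \<and> (\<forall>x\<in>space \<mu>. \<sigma> 0 x = x)"

text \<open>
  \<open>J\<close> is the Jacobian; the last clause is $d\mu(\sigma_g(x)) = J(g,x)\,d\mu(x)$ integrated
  over \<open>A\<close>.
\<close>

definition quasi_invariant ::
  "('g::ab_group_add \<Rightarrow> 'x \<Rightarrow> 'x) \<Rightarrow> ('g \<Rightarrow> 'x \<Rightarrow> real) \<Rightarrow> 'x measure \<Rightarrow> bool" where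
  "quasi_invariant \<sigma> J \<mu> \<longleftrightarrow> measurable_action \<sigma> \<mu> \<and>
     (\<lambda>(g, x). J g x) \<in> borel_measurable (count_space UNIV \<Otimes>\<^sub>M \<mu>) \<and>
     (\<forall>g. \<forall>x\<in>space \<mu>. J g x > 0) \<and>
     (\<forall>g. \<forall>A\<in>sets \<mu>. emeasure \<mu> (\<sigma> g ` A) = (\<integral>\<^sup>+x\<in>A. ennreal (J g x) \<partial>\<mu>))"

definition tiling_set :: "('g::ab_group_add \<Rightarrow> 'x \<Rightarrow> 'x) \<Rightarrow> 'x measure \<Rightarrow> 'x set \<Rightarrow> bool" where
  "tiling_set \<sigma> \<mu> C \<longleftrightarrow> C \<in> sets \<mu> \<and> emeasure \<mu> (space \<mu> - (\<Union>g. \<sigma> g ` C)) = 0 \<and>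
     (\<forall>g h. g \<noteq> h \<longrightarrow> emeasure \<mu> (\<sigma> g ` C \<inter> \<sigma> h ` C) = 0)"

definition rep ::
  "('g::ab_group_add \<Rightarrow> 'x \<Rightarrow> 'x) \<Rightarrow> ('g \<Rightarrow> 'x \<Rightarrow> real) \<Rightarrow> 'g \<Rightarrow> ('x \<Rightarrow> complex) \<Rightarrow> 'x \<Rightarrow> complex" where
  "rep \<sigma> J g f = (\<lambda>x. complex_of_real (sqrt (J (- g) x)) * f (\<sigma> (- g) x))"

definition invariant_space ::
  "('g::ab_group_add \<Rightarrow> 'x \<Rightarrow> 'x) \<Rightarrow> ('g \<Rightarrow> 'x \<Rightarrow> real) \<Rightarrow> 'x measure \<Rightarrow> 'g set \<Rightarrow> ('x \<Rightarrow> complex) set \<Rightarrow> bool"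
  where
  "invariant_space \<sigma> J \<mu> H V \<longleftrightarrow> closed_subspace (L2 \<mu> scalars) V \<and>
     (\<forall>f\<in>V. \<forall>h\<in>H. rep \<sigma> J h f \<in> V)"


section \<open>Zak transforms\<close>

abbreviation L2_tile :: "'x measure \<Rightarrow> 'x set \<Rightarrow> ('x \<Rightarrow> complex) hilb" where
  "L2_tile \<mu> C \<equiv> L2 (restrict_space \<mu> C) scalars"

text \<open>
  The series $\sum_{\tau}\Pi_\tau f(x)\,(-\tau,\hat\tau)$ converges unconditionally in
  $L^2(\widehat{\mathcal{T}},L^2(C))$, in general not for every $\hat\tau$; \<open>zakT \<dots> f\<close> is a
  representative of its sum.
\<close>

definition is_zakT ::
  "('g::ab_group_add \<Rightarrow> 'x \<Rightarrow> 'x) \<Rightarrow> ('g \<Rightarrow> 'x \<Rightarrow> real) \<Rightarrow> 'x measure \<Rightarrow> 'x set \<Rightarrow> 'g dual measure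
    \<Rightarrow> ('x \<Rightarrow> complex) \<Rightarrow> ('g dual \<Rightarrow> 'x \<Rightarrow> complex) \<Rightarrow> bool" where
  "is_zakT \<sigma> J \<mu> C m f \<Phi> \<longleftrightarrow>
     \<Phi> \<in> carr (L2 m (L2_tile \<mu> C)) \<and>
     ((\<lambda>F. hnorm (L2 m (L2_tile \<mu> C))
             (hdiff (L2 m (L2_tile \<mu> C))
               (\<lambda>\<eta> x. \<Sum>\<tau>\<in>F. rep \<sigma> J \<tau> f x * char_of \<eta> (- \<tau>)) \<Phi>))
        \<longlongrightarrow> 0) (finite_subsets_at_top UNIV)"

definition zakT ::
  "('g::ab_group_add \<Rightarrow> 'x \<Rightarrow> 'x) \<Rightarrow> ('g \<Rightarrow> 'x \<Rightarrow> real) \<Rightarrow> 'x measure \<Rightarrow> 'x set \<Rightarrow> 'g dual measure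
    \<Rightarrow> ('x \<Rightarrow> complex) \<Rightarrow> 'g dual \<Rightarrow> 'x \<Rightarrow> complex" where
  "zakT \<sigma> J \<mu> C m f = (SOME \<Phi>. is_zakT \<sigma> J \<mu> C m f \<Phi>)"

text \<open>\<open>\<gamma>s 0, \<dots>, \<gamma>s s\<close> enumerate $\Gamma^*$; the value at \<open>\<omega>\<close> is the tuple indexed by \<open>i \<le> s\<close>.\<close>

definition zak ::
  "('g::ab_group_add \<Rightarrow> 'x \<Rightarrow> 'x) \<Rightarrow> ('g \<Rightarrow> 'x \<Rightarrow> real) \<Rightarrow> 'x measure \<Rightarrow> 'x set \<Rightarrow> 'g dual measure
    \<Rightarrow> (nat \<Rightarrow> 'g dual) \<Rightarrow> ('x \<Rightarrow> complex) \<Rightarrow> 'g dual \<Rightarrow> nat \<Rightarrow> 'x \<Rightarrow> complex" where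
  "zak \<sigma> J \<mu> C m \<gamma>s f = (\<lambda>\<omega> i. zakT \<sigma> J \<mu> C m f (\<omega> + \<gamma>s i))"

text \<open>$Z[V]\subseteq L^2(\Omega,(L^2(C))^{s+1})$, as the set of all representatives of its elements.\<close>

definition zak_image ::
  "('g::ab_group_add \<Rightarrow> 'x \<Rightarrow> 'x) \<Rightarrow> ('g \<Rightarrow> 'x \<Rightarrow> real) \<Rightarrow> 'x measure \<Rightarrow> 'x set \<Rightarrow> 'g dual measure
    \<Rightarrow> (nat \<Rightarrow> 'g dual) \<Rightarrow> nat \<Rightarrow> 'g dual set \<Rightarrow> ('x \<Rightarrow> complex) set
    \<Rightarrow> ('g dual \<Rightarrow> nat \<Rightarrow> 'x \<Rightarrow> complex) set" where
  "zak_image \<sigma> J \<mu> C m \<gamma>s s \<Omega> V =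
     (let K = L2 (restrict_space m \<Omega>) (hpower (Suc s) (L2_tile \<mu> C))
      in {\<Psi> \<in> carr K. \<exists>f\<in>V. hnorm K (hdiff K \<Psi> (zak \<sigma> J \<mu> C m \<gamma>s f)) = 0})"

definition exponentials :: "'g::ab_group_add set \<Rightarrow> ('g dual \<Rightarrow> complex) set" where
  "exponentials \<Gamma> = (\<lambda>\<gamma> \<omega>. char_of \<omega> \<gamma>) ` \<Gamma>"

text \<open>$\mathcal{H}_\xi$; here $F_i = 0$ means that \<open>F i\<close> represents the zero vector of $L^2(C)$.\<close>

definition H_part ::
  "'x measure \<Rightarrow> 'x set \<Rightarrow> (nat \<Rightarrow> 'g::ab_group_add dual) \<Rightarrow> nat \<Rightarrow> 'g set \<Rightarrow> 'g dual
    \<Rightarrow> (nat \<Rightarrow> 'x \<Rightarrow> complex) set" where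
  "H_part \<mu> C \<gamma>s s \<Delta> \<xi> =
     {F \<in> carr (hpower (Suc s) (L2_tile \<mu> C)).
        \<forall>i\<le>s. \<gamma>s i \<notin> coset \<xi> (annihilator \<Delta>) \<longrightarrow> hnorm (L2_tile \<mu> C) (F i) = 0}"

end

(*
The Zak transform of the T-action turns Pi_tau into multiplication by the character (tau, .), so
the tuple-valued transform Z turns Pi_delta, for delta in Delta, into multiplication by
(delta, omega) in the base variable and by (delta, gamma_i) in the i-th coordinate.

Multiplication by the exponentials of Gamma generates multiplication by every bounded Borel
function on Omega.  Hence the factor (delta, omega) can be removed or inserted freely, and V is
Delta-invariant iff Z[V] is stable under the coordinate multipliers i -> (delta, gamma_i), delta in
Delta.  As functions on Gamma^* / Delta^* these generate the algebra of all functions, which is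
also spanned by the indicators of the cosets xi + Delta^*, that is, by the projections onto the
H_xi.
*)

theory Submission
  imports Defs
begin

section \<open>Extension of characters\<close>

text \<open>That the exponentials of \<Gamma> generate every bounded Borel multiplier rests on
  periodization over \<Gamma>*: summing the translates of evaluation at \<tau> gives
  \<open>s + 1\<close> times it if \<tau> lies in \<Gamma> and 0 otherwise, while on \<Omega> every
  function is the periodization of its extension by zero. A density statement on the whole dual thus
  descends to \<Omega>. The vanishing needs enough characters in \<Gamma>*; they come from extending
  partial characters by Zorn's lemma.

  The obstacle is that vectors are representatives. The Zak series converges only in norm, the
  representation is a homomorphism only almost everywhere, and \<open>zakT\<close> selects one
  limit, so linearity and equivariance of Z are not literal equalities. They say that two vectors
  have distance 0, and closed subspaces, which contain all representatives of their elements, absorb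
  the difference. Separability makes inner products of vector-valued functions measurable;
  completeness of the vector-valued L2 space gives the Zak transform its existence. Z[V] is closed
  because Z is isometric and L2 of the base space is complete.\<close>

lemma char_of_add [simp]: "char_of \<xi> (x + y) = char_of \<xi> x * char_of \<xi> y"
  and norm_char_of [simp]: "cmod (char_of \<xi> x) = 1"
  using char_of[of \<xi>] by auto

lemma char_of_nonzero [simp]: "char_of \<xi> x \<noteq> 0"
  using norm_char_of[of \<xi> x] by (metis norm_zero zero_neq_one)

lemma char_of_0 [simp]: "char_of \<xi> 0 = 1"
  using char_of_add[of \<xi> 0 0] by simp

lemma inverse_eq_cnj: "cmod z = 1 \<Longrightarrow> inverse z = cnj z"
  by (rule inverse_unique) (simp flip: complex_norm_square)

lemma char_of_minus [simp]: "char_of \<xi> (- x) = cnj (char_of \<xi> x)"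
proof -
  have "char_of \<xi> x * char_of \<xi> (- x) = 1"
    using char_of_add[of \<xi> x "- x"] by simp
  then have "inverse (char_of \<xi> x) = char_of \<xi> (- x)"
    by (rule inverse_unique)
  then show ?thesis
    by (simp add: inverse_eq_cnj)
qed

lemma char_of_dual_plus [simp]: "char_of (\<xi> + \<eta>) x = char_of \<xi> x * char_of \<eta> x"
  by (simp add: plus_dual.rep_eq)

lemma char_of_dual_zero [simp]: "char_of 0 x = 1"
  by (simp add: zero_dual.rep_eq)

lemma char_of_dual_minus [simp]: "char_of (- \<xi>) x = cnj (char_of \<xi> x)"
  by (simp add: uminus_dual.rep_eq inverse_eq_cnj)

lemma char_of_dual_diff [simp]: "char_of (\<xi> - \<eta>) x = char_of \<xi> x * cnj (char_of \<eta> x)"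
  using char_of_dual_plus[of \<xi> "- \<eta>" x] by simp

lemma char_of_cnj_mult [simp]: "char_of \<xi> x * cnj (char_of \<xi> x) = 1"
  by (simp add: complex_norm_square[symmetric])

text \<open>A homomorphism from a subgroup to the circle, given by its graph: extension is then
  inclusion, and chains are joined by unions. Single-valuedness is encoded by the last clause, that
  0 has no value but 1, from which \<open>partial_char_unique\<close> recovers it.\<close>

definition partial_char :: "('g::ab_group_add \<times> complex) set \<Rightarrow> bool" where
  "partial_char R \<longleftrightarrow> (0, 1) \<in> R \<and>
     (\<forall>x z y w. (x, z) \<in> R \<longrightarrow> (y, w) \<in> R \<longrightarrow> (x + y, z * w) \<in> R) \<and>
     (\<forall>x z. (x, z) \<in> R \<longrightarrow> (- x, inverse z) \<in> R) \<and>
     (\<forall>x z. (x, z) \<in> R \<longrightarrow> cmod z = 1) \<and> (\<forall>z. (0, z) \<in> R \<longrightarrow> z = 1)"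

lemma partial_charD:
  assumes "partial_char R"
  shows "(0, 1) \<in> R" "(x, z) \<in> R \<Longrightarrow> (y, w) \<in> R \<Longrightarrow> (x + y, z * w) \<in> R"
    "(x, z) \<in> R \<Longrightarrow> (- x, inverse z) \<in> R" "(x, z) \<in> R \<Longrightarrow> cmod z = 1" "(0, z) \<in> R \<Longrightarrow> z = 1"
  using assms unfolding partial_char_def by blast+

lemma partial_char_unique:
  assumes R: "partial_char R" and "(x, z) \<in> R" "(x, w) \<in> R"
  shows "z = w"
proof -
  have "(x + - x, z * inverse w) \<in> R"
    using partial_charD(2,3)[OF R] assms by blast
  then have "z * inverse w = 1" using partial_charD(5)[OF R] by simp
  moreover have "w \<noteq> 0" using partial_charD(4)[OF R assms(3)] by auto
  ultimately show ?thesis by (simp add: field_simps)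
qed

text \<open>The sum over \<open>i < n\<close> of the constant \<open>x\<close> stands for the multiple $nx$.\<close>

lemma const_sum_add:
  "(\<Sum>i<m + n::nat. x) = (\<Sum>i<m. x) + (\<Sum>i<n. (x::'g::ab_group_add))"
  by (induction n) (simp_all add: add.assoc)

text \<open>A root of \<open>c \<noteq> 1\<close> cannot be 1; for \<open>c = 1\<close> a primitive
  root is taken, and this is where \<open>n \<ge> 2\<close> enters. The clause
  \<open>z \<noteq> 1\<close> is what later separates a point from a subgroup.\<close>

lemma unit_root_exists:
  assumes "cmod c = 1" "n \<ge> 2"
  shows "\<exists>z. cmod z = 1 \<and> z ^ n = c \<and> z \<noteq> 1"
proof (cases "c = 1")
  case True
  have "cis (2 * pi / n) \<noteq> 1"
  proof
    assume "cis (2 * pi / n) = 1"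
    then have "cos (2 * pi / n) = 1" by (simp add: complex_eq_iff)
    moreover have "cos (2 * pi / n) < cos 0"
      using assms(2) by (intro cos_monotone_0_pi) (auto simp: field_simps)
    ultimately show False by simp
  qed
  moreover have "cis (2 * pi / n) ^ n = c"
  proof -
    have "real n * (2 * pi / n) = 2 * pi" using assms(2) by simp
    then show ?thesis using True unfolding Complex.DeMoivre by (simp only: cis_2pi)
  qed
  ultimately show ?thesis by (intro exI[of _ "cis (2 * pi / n)"]) simp
next
  case False
  have "real n * (Arg c / n) = Arg c" using assms(2) by simp
  moreover have "cis (Arg c) = c" using assms(1) cis_Arg[of c] by (cases "c = 0") (auto simp: sgn_eq)
  ultimately have "cis (Arg c / n) ^ n = c" unfolding Complex.DeMoivre by (simp only:)
  then show ?thesis using False by (intro exI[of _ "cis (Arg c / n)"]) auto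
qed

text \<open>Adjoining \<open>x\<close> is possible as soon as its value \<open>z\<close> satisfies
  \<open>z ^ n = v\<close> whenever the multiple \<open>nx n\<close> already has the value
  \<open>v\<close>. These \<open>n\<close> are the multiples of the least positive one, so one root
  extraction in the circle suffices; the freedom in choosing the root yields
  \<open>z \<noteq> 1\<close> for a new \<open>x\<close>.\<close>

lemma partial_char_extend:
  assumes R: "partial_char R"
  shows "\<exists>z R'. R \<subseteq> R' \<and> partial_char R' \<and> (x, z) \<in> R' \<and> (x \<notin> Domain R \<longrightarrow> z \<noteq> 1)"
proof -
  define nx where "nx n = (\<Sum>i<n::nat. x)" for n
  have nx_add: "nx (m + n) = nx m + nx n" for m n by (simp add: nx_def const_sum_add)
  have nx0 [simp]: "nx 0 = 0" by (simp add: nx_def)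
  have nx1: "nx (Suc 0) = x" by (simp add: nx_def)
  have "\<exists>z. cmod z = 1 \<and> (\<forall>n v. (nx n, v) \<in> R \<longrightarrow> v = z ^ n) \<and> (x \<notin> Domain R \<longrightarrow> z \<noteq> 1)"
  proof (cases "\<exists>n>0. nx n \<in> Domain R")
    case False
    \<comment> \<open>No positive multiple of \<open>x\<close> is in the domain, so any unimodular
      value is compatible; -1 is one that differs from 1.\<close>
    have "v = (-1) ^ n" if v: "(nx n, v) \<in> R" for n v
    proof (cases "n = 0")
      case True
      then show ?thesis using v partial_charD(5)[OF R] by simp
    next
      case False
      then show ?thesis using \<open>\<not> (\<exists>n>0. nx n \<in> Domain R)\<close> DomainI[OF v] by blast
    qed
    then show ?thesis by (intro exI[of _ "-1"]) auto
  next
    case True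
    define n0 where "n0 = (LEAST n. n > 0 \<and> nx n \<in> Domain R)"
    have n0: "n0 > 0" "nx n0 \<in> Domain R"
      unfolding n0_def using LeastI_ex[OF True] by auto
    have least: "n0 \<le> n" if "n > 0" "nx n \<in> Domain R" for n
      unfolding n0_def using that by (intro Least_le) auto
    obtain v0 where v0: "(nx n0, v0) \<in> R" using n0(2) by auto
    have v1: "cmod v0 = 1" using partial_charD(4)[OF R v0] .
    have "\<exists>z. cmod z = 1 \<and> z ^ n0 = v0 \<and> (x \<notin> Domain R \<longrightarrow> z \<noteq> 1)"
    \<comment> \<open>If \<open>n0 = 1\<close> then \<open>x\<close> is already in the domain and
      its value is forced; otherwise a root of order at least 2 leaves room to avoid 1.\<close>
    proof (cases "n0 = 1")
      case True
      then show ?thesis using v1 v0 by (intro exI[of _ v0]) (auto simp: nx1)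
    next
      case False
      then show ?thesis using unit_root_exists[OF v1, of n0] n0(1) by force
    qed
    then obtain z where z: "cmod z = 1" "z ^ n0 = v0" "x \<notin> Domain R \<longrightarrow> z \<noteq> 1" by blast
    \<comment> \<open>Division with remainder by \<open>n0\<close>: subtracting \<open>n0\<close>
      repeatedly leaves a remainder below \<open>n0\<close>, which must be 0 by minimality.\<close>
    have "v = z ^ n" if "(nx n, v) \<in> R" for n v
      using that
    proof (induction n arbitrary: v rule: less_induct)
      case (less n)
      show ?case
      proof (cases "n < n0")
        case True
        then have "n = 0" using least[of n] less.prems by (cases "n = 0") auto
        then show ?thesis using partial_charD(5)[OF R] less.prems by simp
      next
        case False
        then have n: "n = (n - n0) + n0" by simp
        then have "nx n + - nx n0 = nx (n - n0)"
          using nx_add[of "n - n0" n0] by simp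
        then have "(nx (n - n0), v * inverse v0) \<in> R"
          using partial_charD(2)[OF R less.prems partial_charD(3)[OF R v0]] by simp
        then have "v * inverse v0 = z ^ (n - n0)"
          using less.IH[of "n - n0"] n0(1) False by simp
        moreover have "v0 \<noteq> 0" using v1 by auto
        ultimately have "v = z ^ (n - n0) * z ^ n0" using z(2) by (simp add: field_simps)
        then show ?thesis using n by (simp flip: power_add)
      qed
    qed
    then show ?thesis using z by blast
  qed
  then obtain z where z: "cmod z = 1" "\<And>n v. (nx n, v) \<in> R \<Longrightarrow> v = z ^ n"
    "x \<notin> Domain R \<longrightarrow> z \<noteq> 1" by blast
  have z0: "z \<noteq> 0" using z(1) by auto
  \<comment> \<open>The graph over the subgroup generated by the domain and \<open>x\<close>.
    Integer multiples of \<open>x\<close> are written as differences of natural ones, so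
    well-definedness becomes the clause about the value at 0.\<close>
  define R' where "R' = {(y + nx n - nx k, w * z ^ n / z ^ k) | y w n k. (y, w) \<in> R}"
  have R'I: "(a, b) \<in> R'" if "(y, w) \<in> R" "a = y + nx n - nx k" "b = w * z ^ n / z ^ k" for a b y w n k
    using that unfolding R'_def by blast
  have R'E: "\<exists>y w n k. (y, w) \<in> R \<and> a = y + nx n - nx k \<and> b = w * z ^ n / z ^ k" if "(a, b) \<in> R'" for a b
    using that unfolding R'_def by blast
  have "partial_char R'"
    unfolding partial_char_def
  proof (intro conjI allI impI)
    show "(0, 1) \<in> R'"
      by (rule R'I[OF partial_charD(1)[OF R], of _ 0 0]) auto
  next
    fix a b c d assume "(a, b) \<in> R'" "(c, d) \<in> R'"
    then obtain y w n k y' w' n' k' where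
      *: "(y, w) \<in> R" "a = y + nx n - nx k" "b = w * z ^ n / z ^ k"
       "(y', w') \<in> R" "c = y' + nx n' - nx k'" "d = w' * z ^ n' / z ^ k'"
      using R'E by meson
    show "(a + c, b * d) \<in> R'"
      by (rule R'I[OF partial_charD(2)[OF R *(1,4)], of _ "n + n'" "k + k'"])
         (auto simp: * nx_add power_add)
  next
    fix a b assume "(a, b) \<in> R'"
    then obtain y w n k where *: "(y, w) \<in> R" "a = y + nx n - nx k" "b = w * z ^ n / z ^ k"
      using R'E by meson
    show "(- a, inverse b) \<in> R'"
      by (rule R'I[OF partial_charD(3)[OF R *(1)], of _ k n])
         (auto simp: * field_simps)
    show "cmod b = 1"
      using partial_charD(4)[OF R *(1)] z(1) by (simp add: * norm_mult norm_divide norm_power)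
  next
    fix b assume "(0, b) \<in> R'"
    then obtain y w n k where *: "(y, w) \<in> R" "y + nx n - nx k = 0" "b = w * z ^ n / z ^ k"
      using R'E by metis
    have w0: "w \<noteq> 0" using partial_charD(4)[OF R *(1)] by auto
    \<comment> \<open>The compatibility of \<open>z\<close> is known for natural multiples only.
      Hence the split on the sign of \<open>n - k\<close>: for \<open>k \<le> n\<close> the multiple
      equals \<open>- y\<close>, and the inverse of \<open>w\<close> is compared with a power of
      \<open>z\<close>.\<close>
    show "b = 1"
    proof (cases "k \<le> n")
      case True
      then obtain j where j: "n = k + j" using le_Suc_ex by blast
      then have "y + nx j = 0" using *(2) by (simp add: nx_add)
      then have "nx j = - y" by (simp add: eq_neg_iff_add_eq_0 add.commute)
      then have "inverse w = z ^ j"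
        using z(2)[of j "inverse w"] partial_charD(3)[OF R *(1)] by simp
      then have "w * z ^ j = 1" using w0 by (simp add: field_simps)
      then show ?thesis using z0 by (simp add: *(3) j power_add field_simps)
    next
      case False
      then obtain j where j: "k = n + j" using le_Suc_ex[of n k] by auto
      then have "nx j = y" using *(2) nx_add[of n j] by (simp add: algebra_simps)
      then have "w = z ^ j" using z(2)[of j w] *(1) by simp
      then show ?thesis using z0 by (simp add: *(3) j power_add)
    qed
  qed
  moreover have "R \<subseteq> R'"
    using R'I[of _ _ _ 0 0] by auto
  moreover have "(x, z) \<in> R'"
    by (rule R'I[OF partial_charD(1)[OF R], of _ 1 0]) (simp_all add: nx1)
  ultimately show ?thesis using z(3) by blast
qed

lemma partial_char_Union:
  assumes "\<C> \<noteq> {}" "subset.chain A \<C>" "\<And>R. R \<in> \<C> \<Longrightarrow> partial_char R"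
  shows "partial_char (\<Union>\<C>)"
proof -
  have two: "\<exists>R\<in>\<C>. a \<in> R \<and> b \<in> R" if "a \<in> \<Union>\<C>" "b \<in> \<Union>\<C>" for a b
    using that assms(2) unfolding subset_chain_def by blast
  show ?thesis
    unfolding partial_char_def
  proof (intro conjI allI impI)
    show "(0, 1) \<in> \<Union>\<C>" using assms(1,3) partial_charD(1) by blast
    show "(x + y, z * w) \<in> \<Union>\<C>" if "(x, z) \<in> \<Union>\<C>" "(y, w) \<in> \<Union>\<C>" for x z y w
      using two[OF that] assms(3) partial_charD(2) by blast
    show "(- x, inverse z) \<in> \<Union>\<C>" if "(x, z) \<in> \<Union>\<C>" for x z
      using that assms(3) partial_charD(3) by blast
    show "cmod z = 1" if "(x, z) \<in> \<Union>\<C>" for x z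
      using that assms(3) partial_charD(4) by blast
    show "z = 1" if "(0, z) \<in> \<Union>\<C>" for z
      using that assms(3) partial_charD(5) by blast
  qed
qed

text \<open>A partial character that is maximal under inclusion is defined everywhere, as otherwise
  \<open>partial_char_extend\<close> would enlarge it; being single-valued, it is the graph of a
  character.\<close>

lemma partial_char_extends_to_char:
  assumes R: "partial_char R"
  shows "\<exists>\<xi>. \<forall>(x, z)\<in>R. char_of \<xi> x = z"
proof -
  define A where "A = {R'. R \<subseteq> R' \<and> partial_char R'}"
  have "\<exists>M\<in>A. \<forall>X\<in>A. M \<subseteq> X \<longrightarrow> X = M"
  proof (rule subset_Zorn_nonempty)
    show "A \<noteq> {}" using R by (auto simp: A_def)
    show "\<Union>\<C> \<in> A" if "\<C> \<noteq> {}" "subset.chain A \<C>" for \<C>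
    proof -
      have "\<C> \<subseteq> A" using that(2) by (simp add: subset_chain_def)
      then show ?thesis
        using that partial_char_Union[OF that] unfolding A_def by blast
    qed
  qed
  then obtain M where MA: "M \<in> A" and max: "\<forall>X\<in>A. M \<subseteq> X \<longrightarrow> X = M" by (elim bexE)
  have M: "R \<subseteq> M" "partial_char M" using MA by (auto simp: A_def)
  have "\<exists>z. (x, z) \<in> M" for x
  proof -
    obtain z R' where R': "M \<subseteq> R'" "partial_char R'" "(x, z) \<in> R'"
      using partial_char_extend[OF M(2), of x] by (elim exE conjE)
    then have "R' \<in> A" using M(1) by (simp add: A_def)
    then have "R' = M" using max R'(1) by simp
    then show ?thesis using R'(3) by auto
  qed
  then obtain \<eta> where \<eta>: "\<And>x. (x, \<eta> x) \<in> M" by metis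
  have "\<eta> (x + y) = \<eta> x * \<eta> y" for x y
    using partial_char_unique[OF M(2) \<eta> partial_charD(2)[OF M(2) \<eta> \<eta>]] .
  moreover have "cmod (\<eta> x) = 1" for x
    using partial_charD(4)[OF M(2) \<eta>] .
  ultimately have "char_of (Char \<eta>) = \<eta>"
    by (intro Char_inverse) auto
  moreover have "\<eta> x = z" if "(x, z) \<in> R" for x z
    using partial_char_unique[OF M(2) \<eta>, of x z] M(1) that by auto
  ultimately have "\<forall>(x, z)\<in>R. char_of (Char \<eta>) x = z" by auto
  then show ?thesis ..
qed

text \<open>The constant 1 on \<open>H\<close> is a partial character, and adjoining
  \<open>x\<close> can be done with a value other than 1. With \<open>H = {0}\<close> this gives
  orthogonality of characters, with \<open>H = \<Gamma>\<close> the vanishing of character sums over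
  the annihilator.\<close>

theorem annihilator_separates:
  assumes H: "is_subgroup H" and x: "x \<notin> H"
  shows "\<exists>\<xi>\<in>annihilator H. char_of \<xi> x \<noteq> 1"
proof -
  have "partial_char (H \<times> {1})"
    using H by (auto simp: partial_char_def is_subgroup_def)
  then obtain z R where
    R: "H \<times> {1} \<subseteq> R" "partial_char R" "(x, z) \<in> R" "z \<noteq> 1"
    using partial_char_extend[of "H \<times> {1}" x] x by blast
  obtain \<xi> where "\<forall>(x, z)\<in>R. char_of \<xi> x = z"
    using partial_char_extends_to_char[OF R(2)] by blast
  then have \<xi>: "char_of \<xi> y = w" if "(y, w) \<in> R" for y w using that by auto
  have "char_of \<xi> h = 1" if "h \<in> H" for h
    by (rule \<xi>) (use R(1) that in blast)
  then have "\<xi> \<in> annihilator H" by (simp add: annihilator_def)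
  moreover have "char_of \<xi> x \<noteq> 1" using \<xi>[OF R(3)] R(4) by simp
  ultimately show ?thesis by blast
qed

section \<open>The Borel structure of the dual group\<close>

lemma continuous_char_of: "continuous_on UNIV (char_of :: 'g::ab_group_add dual \<Rightarrow> 'g \<Rightarrow> complex)"
  unfolding continuous_on_open_vimage[OF open_UNIV] by (auto simp: open_dual_def)

lemma measurable_char_of [measurable]: "char_of \<in> borel_measurable borel"
  by (rule borel_measurable_continuous_onI[OF continuous_char_of])

lemma continuous_char_of_apply: "continuous_on UNIV (\<lambda>\<eta>. char_of \<eta> x)"
  using continuous_on_product_then_coordinatewise[OF continuous_char_of] .

lemma measurable_char_of_apply [measurable]: "(\<lambda>\<eta>. char_of \<eta> x) \<in> borel_measurable borel"
  by (rule borel_measurable_continuous_onI[OF continuous_char_of_apply])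

lemma continuous_on_dualI:
  assumes "continuous_on S (\<lambda>x. char_of (f x))" "open S"
  shows "continuous_on S f"
  unfolding continuous_on_open_vimage[OF assms(2)]
proof (intro allI impI)
  fix B :: "'b dual set" assume "open B"
  then obtain W where W: "open W" "B = char_of -` W" unfolding open_dual_def by blast
  have "open ((\<lambda>x. char_of (f x)) -` W \<inter> S)"
    using assms W(1) unfolding continuous_on_open_vimage[OF assms(2)] by blast
  then show "open (f -` B \<inter> S)" by (simp add: W(2) vimage_def)
qed

lemma continuous_translate: "continuous_on UNIV (\<lambda>\<eta>::'g::ab_group_add dual. \<xi> + \<eta>)"
  by (intro continuous_on_dualI continuous_on_coordinatewise_then_product open_UNIV)
     (auto intro!: continuous_intros continuous_char_of_apply)

lemma measurable_translate [measurable]: "(\<lambda>\<eta>::'g::ab_group_add dual. \<xi> + \<eta>) \<in> borel \<rightarrow>\<^sub>M borel"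
  by (rule borel_measurable_continuous_onI[OF continuous_translate])

text \<open>Tychonoff's theorem: the homomorphisms are cut out of a product of circles by closed
  conditions. The statement concerns the image in the function space because the Stone--Weierstrass
  theorem is applied to functions there.\<close>

lemma compact_range_char_of: "compact (range (char_of :: 'g::ab_group_add dual \<Rightarrow> _))"
proof -
  let ?P = "PiE UNIV (\<lambda>_::'g. sphere (0::complex) 1)"
  have "compactin (product_topology (\<lambda>_::'g. euclidean) UNIV) ?P"
    unfolding compactin_PiE by simp
  then have P: "compact ?P" by (simp add: euclidean_product_topology)
  have "closed {f :: 'g \<Rightarrow> complex. \<forall>x y. f (x + y) = f x * f y}"
    by (intro closed_Collect_all closed_Collect_eq continuous_intros) auto
  then have "compact (?P \<inter> {f. \<forall>x y. f (x + y) = f x * f y})"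
    by (rule compact_Int_closed[OF P])
  also have "?P \<inter> {f. \<forall>x y. f (x + y) = f x * f y} = range char_of"
    unfolding type_definition.Rep_range[OF type_definition_dual] by auto
  finally show ?thesis .
qed

section \<open>Trigonometric polynomials and a monotone class theorem on the dual\<close>

inductive_set trig_poly :: "('g::ab_group_add dual \<Rightarrow> complex) set" where
  trig_char: "(\<lambda>\<eta>. char_of \<eta> \<tau>) \<in> trig_poly"
| trig_add: "f \<in> trig_poly \<Longrightarrow> g \<in> trig_poly \<Longrightarrow> (\<lambda>\<eta>. f \<eta> + g \<eta>) \<in> trig_poly"
| trig_scale: "f \<in> trig_poly \<Longrightarrow> (\<lambda>\<eta>. c * f \<eta>) \<in> trig_poly"

lemma trig_const: "(\<lambda>_. c) \<in> trig_poly"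
  using trig_scale[OF trig_char[of 0], of c] by simp

lemma trig_mult:
  assumes "f \<in> trig_poly" "g \<in> trig_poly"
  shows "(\<lambda>\<eta>. f \<eta> * g \<eta>) \<in> trig_poly"
  using assms
proof (induction f rule: trig_poly.induct)
  case (trig_char \<tau>)
  then show ?case
  proof (induction g rule: trig_poly.induct)
    case (trig_char \<tau>')
    then show ?case using trig_poly.trig_char[of "\<tau> + \<tau>'"] by simp
  next
    case (trig_add f g)
    then show ?case using trig_poly.trig_add by (simp add: distrib_left)
  next
    case (trig_scale f c)
    then show ?case using trig_poly.trig_scale[of _ c] by (simp add: mult.left_commute)
  qed
next
  case (trig_add f g)
  then show ?case using trig_poly.trig_add by (simp add: distrib_right)
next
  case (trig_scale f c)
  then show ?case using trig_poly.trig_scale[of _ c] by (simp add: mult.assoc)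
qed

text \<open>Conjugating a character is evaluating it at \<open>- \<tau>\<close>, so trigonometric
  polynomials are closed under conjugation on the generators. This supplies the real-valued
  functions that separate points.\<close>

lemma trig_Re_Im:
  "(\<lambda>\<eta>. complex_of_real (Re (char_of \<eta> \<tau>))) \<in> trig_poly"
  "(\<lambda>\<eta>. complex_of_real (Im (char_of \<eta> \<tau>))) \<in> trig_poly"
proof -
  have "complex_of_real (Re z) = 1/2 * z + 1/2 * cnj z"
       "complex_of_real (Im z) = - \<i>/2 * z + \<i>/2 * cnj z" for z
    by (simp_all add: complex_eq_iff)
  then have
    "(\<lambda>\<eta>. complex_of_real (Re (char_of \<eta> \<tau>))) = (\<lambda>\<eta>. 1/2 * char_of \<eta> \<tau> + 1/2 * char_of \<eta> (-\<tau>))"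
    "(\<lambda>\<eta>. complex_of_real (Im (char_of \<eta> \<tau>))) = (\<lambda>\<eta>. - \<i>/2 * char_of \<eta> \<tau> + \<i>/2 * char_of \<eta> (-\<tau>))"
    by (simp_all only: char_of_minus)
  then show "(\<lambda>\<eta>. complex_of_real (Re (char_of \<eta> \<tau>))) \<in> trig_poly"
    "(\<lambda>\<eta>. complex_of_real (Im (char_of \<eta> \<tau>))) \<in> trig_poly"
    by (simp_all only: trig_add trig_scale trig_char)
qed

text \<open>The real Stone--Weierstrass theorem for the ring of continuous functions on the compact
  image whose composition with \<open>char_of\<close> is a trigonometric polynomial; distinct
  characters differ in a real or imaginary part at some \<tau>.\<close>

lemma trig_approx:
  fixes h :: "('g::{ab_group_add,countable} \<Rightarrow> complex) \<Rightarrow> real"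
  assumes h: "continuous_on (range char_of) h" and e: "e > 0"
  shows "\<exists>g. (\<lambda>\<eta>. complex_of_real (g (char_of \<eta>))) \<in> trig_poly \<and> (\<forall>\<eta>. \<bar>h (char_of \<eta>) - g (char_of \<eta>)\<bar> < e)"
proof -
  define R where "R = {g. continuous_on (range char_of) g \<and>
      (\<lambda>\<eta>::'g dual. complex_of_real (g (char_of \<eta>))) \<in> trig_poly}"
  interpret function_ring_on R "range char_of"
  proof
    show "compact (range (char_of :: 'g dual \<Rightarrow> _))" by (rule compact_range_char_of)
    fix f g assume fg: "f \<in> R" "g \<in> R"
    show "continuous_on (range char_of) f" using fg by (simp add: R_def)
    show "(\<lambda>x. f x + g x) \<in> R"
      using fg trig_add by (auto simp: R_def intro!: continuous_intros)
    show "(\<lambda>x. f x * g x) \<in> R"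
      using fg trig_mult by (auto simp: R_def intro!: continuous_intros)
  next
    show "(\<lambda>_. c) \<in> R" for c by (simp add: R_def trig_const)
  next
    fix x y :: "'g \<Rightarrow> complex" assume "x \<in> range char_of" "y \<in> range char_of" "x \<noteq> y"
    then obtain \<tau> where "Re (x \<tau>) \<noteq> Re (y \<tau>) \<or> Im (x \<tau>) \<noteq> Im (y \<tau>)"
      by (auto simp: fun_eq_iff complex_eq_iff)
    moreover have "continuous_on (range char_of) (\<lambda>f. f \<tau>)"
      by (rule continuous_on_subset[OF continuous_on_product_coordinates]) simp
    then have "(\<lambda>f. Re (f \<tau>)) \<in> R" "(\<lambda>f. Im (f \<tau>)) \<in> R"
      using trig_Re_Im[of \<tau>] by (auto simp: R_def intro!: continuous_on_Re continuous_on_Im)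
    ultimately show "\<exists>f\<in>R. f x \<noteq> f y"
      by (elim disjE) (rule bexI[of _ "\<lambda>f. Re (f \<tau>)"] bexI[of _ "\<lambda>f. Im (f \<tau>)"]; assumption)+
  qed
  show ?thesis using Stone_Weierstrass_basic[OF h e] by (auto simp: R_def)
qed

text \<open>A multiplicative system theorem: the Stone--Weierstrass theorem provides the continuous
  functions, bounded limits the indicators of open sets, and a Dynkin argument the Borel sets.\<close>

theorem dual_monotone_class [consumes 2, case_names char add scale limit]:
  fixes P :: "('g::{ab_group_add,countable} dual \<Rightarrow> complex) \<Rightarrow> bool"
  assumes f: "f \<in> borel_measurable borel" "\<And>\<eta>. cmod (f \<eta>) \<le> B"
    and P_char: "\<And>\<tau>. P (\<lambda>\<eta>. char_of \<eta> \<tau>)"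
    and P_add: "\<And>f g. f \<in> borel_measurable borel \<Longrightarrow> g \<in> borel_measurable borel \<Longrightarrow>
       P f \<Longrightarrow> P g \<Longrightarrow> P (\<lambda>\<eta>. f \<eta> + g \<eta>)"
    and P_scale: "\<And>c f. f \<in> borel_measurable borel \<Longrightarrow> P f \<Longrightarrow> P (\<lambda>\<eta>. c * f \<eta>)"
    and P_lim: "\<And>u f B. (\<And>n. u n \<in> borel_measurable borel) \<Longrightarrow> f \<in> borel_measurable borel \<Longrightarrow>
       (\<And>n. P (u n)) \<Longrightarrow> (\<And>n \<eta>. cmod (u n \<eta>) \<le> B) \<Longrightarrow> (\<And>\<eta>. (\<lambda>n::nat. u n \<eta>) \<longlonglongrightarrow> f \<eta>) \<Longrightarrow> P f"
  shows "P f"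
proof -
  have trig: "f \<in> borel_measurable borel \<and> P f" if "f \<in> trig_poly" for f
    using that by (induction rule: trig_poly.induct) (auto intro: P_char P_add P_scale)
  have cont: "P (\<lambda>\<eta>. complex_of_real (h (char_of \<eta>)))"
    if h: "continuous_on UNIV h" for h :: "('g \<Rightarrow> complex) \<Rightarrow> real"
  proof -
    have h': "continuous_on (range char_of) h"
      using h continuous_on_subset by blast
    obtain B where B: "\<And>\<eta>. \<bar>h (char_of \<eta>)\<bar> \<le> B"
      using compact_imp_bounded[OF compact_continuous_image[OF h' compact_range_char_of]]
      by (auto simp: bounded_iff)
    have "\<forall>n. \<exists>g. (\<lambda>\<eta>. complex_of_real (g (char_of \<eta>))) \<in> trig_poly \<and>
        (\<forall>\<eta>. \<bar>h (char_of \<eta>) - g (char_of \<eta>)\<bar> < 1 / real (Suc n))"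
      by (intro allI trig_approx[OF h']) simp
    then obtain g where g: "\<And>n. (\<lambda>\<eta>. complex_of_real (g n (char_of \<eta>))) \<in> trig_poly"
      "\<And>n \<eta>. \<bar>h (char_of \<eta>) - g n (char_of \<eta>)\<bar> < 1 / real (Suc n)"
      by metis
    show ?thesis
    proof (rule P_lim)
      show "(\<lambda>\<eta>. complex_of_real (g n (char_of \<eta>))) \<in> borel_measurable borel"
        "P (\<lambda>\<eta>. complex_of_real (g n (char_of \<eta>)))" for n
        using trig[OF g(1)] by auto
      have "h \<in> borel_measurable borel" by (rule borel_measurable_continuous_onI[OF h])
      then show "(\<lambda>\<eta>. complex_of_real (h (char_of \<eta>))) \<in> borel_measurable borel"
        by measurable
      fix \<eta> :: "'g dual"
      \<comment> \<open>The approximants differ from a function bounded by \<open>B\<close> by less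
        than \<open>1 / real (Suc n) \<le> 1\<close>, which provides the uniform bound required for
        bounded limits.\<close>
      show "cmod (complex_of_real (g n (char_of \<eta>))) \<le> B + 1" for n
      proof -
        have "1 / real (Suc n) \<le> 1" by simp
        then show ?thesis
          using g(2)[of \<eta> n] B[of \<eta>] unfolding norm_of_real by linarith
      qed
      have "(\<lambda>n. g n (char_of \<eta>)) \<longlonglongrightarrow> h (char_of \<eta>)"
      proof (rule LIM_zero_cancel, rule Lim_null_comparison[OF _ LIMSEQ_Suc[OF lim_1_over_n]])
        show "\<forall>\<^sub>F n in sequentially. norm (g n (char_of \<eta>) - h (char_of \<eta>)) \<le> 1 / real (Suc n)"
          using g(2)[of \<eta>] by (intro always_eventually allI) (simp add: abs_minus_commute less_imp_le)
      qed
      then show "(\<lambda>n. complex_of_real (g n (char_of \<eta>))) \<longlonglongrightarrow> complex_of_real (h (char_of \<eta>))"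
        by (rule tendsto_of_real)
    qed
  qed
  have P0: "P (\<lambda>_. 0)" using P_scale[OF _ P_char[of 0], of 0] by simp
  have P1: "P (\<lambda>_. 1)" using P_char[of 0] by simp
  have P_sum: "P (\<lambda>\<eta>. \<Sum>i<n. u i \<eta>)"
    if "\<And>i. u i \<in> borel_measurable borel" "\<And>i. P (u i)" for u and n :: nat
    by (induction n) (auto intro!: P0 P_add borel_measurable_sum that)
  have op: "P (\<lambda>\<eta>. indicator A \<eta>)" if "open A" for A
  proof -
    obtain W where W: "open W" "A = char_of -` W" using \<open>open A\<close> unfolding open_dual_def by blast
    show ?thesis
    \<comment> \<open>The distance to the empty set is 0 by convention, so the construction below
      would yield 0 instead of 1 for the whole space.\<close>
    proof (cases "W = UNIV")
      case True
      then show ?thesis using P1 W(2) by simp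
    next
      case False
      then have ne: "- W \<noteq> {}" by auto
      \<comment> \<open>Continuous functions that vanish off \<open>W\<close> and increase to 1 at
        every point of \<open>W\<close>, since such a point has positive distance to the closed
        complement.\<close>
      define h where "h n x = min 1 (real n * infdist x (- W))" for n x
      have hc: "continuous_on UNIV (h n)" for n
        unfolding h_def by (intro continuous_intros)
      have hm: "h n \<in> borel_measurable borel" for n
        by (rule borel_measurable_continuous_onI[OF hc])
      show ?thesis
      proof (rule P_lim)
        show "P (\<lambda>\<eta>. complex_of_real (h n (char_of \<eta>)))" for n by (rule cont[OF hc])
        show "(\<lambda>\<eta>. complex_of_real (h n (char_of \<eta>))) \<in> borel_measurable borel" for n
          using hm by measurable
        show "(\<lambda>\<eta>. indicator A \<eta> :: complex) \<in> borel_measurable borel"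
          using \<open>open A\<close> by simp
        show "cmod (complex_of_real (h n (char_of \<eta>))) \<le> 1" for n \<eta>
        proof -
          have "0 \<le> real n * infdist (char_of \<eta>) (- W)" by (simp add: infdist_nonneg)
          then show ?thesis unfolding norm_of_real h_def by linarith
        qed
        fix \<eta> :: "'g dual"
        show "(\<lambda>n. complex_of_real (h n (char_of \<eta>))) \<longlonglongrightarrow> indicator A \<eta>"
        proof (cases "\<eta> \<in> A")
          case True
          then have "infdist (char_of \<eta>) (- W) > 0"
            using in_closed_iff_infdist_zero[of "- W" "char_of \<eta>"] ne W
              infdist_nonneg[of "char_of \<eta>" "- W"] by (auto simp: closed_Compl less_le)
          then obtain k :: nat where "1 < real k * infdist (char_of \<eta>) (- W)"
            using reals_Archimedean3 by blast
          then have "h n (char_of \<eta>) = 1" if "n \<ge> k" for n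
            using that mult_right_mono[of "real k" "real n" "infdist (char_of \<eta>) (- W)"]
            by (simp add: h_def infdist_nonneg)
          then show ?thesis
            using True by (intro tendsto_eventually eventually_sequentiallyI[of k]) simp
        next
          case False
          then have "infdist (char_of \<eta>) (- W) = 0" using W by (intro infdist_zero) auto
          then show ?thesis using False by (simp add: h_def)
        qed
      qed
    qed
  qed
  have ind: "P (\<lambda>\<eta>. indicator A \<eta>)" if A: "A \<in> sets borel" for A
  proof -
    have sb: "sigma_sets UNIV {S :: 'g dual set. open S} = sets borel" by (simp add: borel_def)
    have "Int_stable {S :: 'g dual set. open S}" by (auto simp: Int_stable_def)
    moreover have "{S :: 'g dual set. open S} \<subseteq> Pow UNIV" by simp
    moreover have "A \<in> sigma_sets UNIV {S. open S}" using A by (simp add: sb)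
    ultimately show ?thesis
    proof (induction rule: sigma_sets_induct_disjoint)
      case (basic A)
      then show ?case using op by simp
    next
      case empty
      then show ?case using P0 by simp
    next
      case (compl A)
      then have A: "A \<in> sets borel" by (simp add: sb)
      have "P (\<lambda>\<eta>. 1 + (-1) * indicator A \<eta>)"
        using A compl by (intro P_add P_scale P1) auto
      moreover have "(\<lambda>\<eta>. 1 + (-1) * indicator A \<eta>) = (\<lambda>\<eta>. indicator (UNIV - A) \<eta> :: complex)"
        by (auto simp: indicator_def)
      ultimately show ?case by simp
    next
      case (union A)
      then have A: "A i \<in> sets borel" for i by (auto simp: sb)
      have eq: "(\<Sum>i<n. indicator (A i) \<eta>) = (indicator (\<Union>i<n. A i) \<eta> :: complex)" for n \<eta>
        using union(1) by (simp add: indicator_UN_disjoint disjoint_family_on_def)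
      show ?case
      proof (rule P_lim)
        show "(\<lambda>\<eta>. \<Sum>i<n. indicator (A i) \<eta> :: complex) \<in> borel_measurable borel" for n
          using A by (intro borel_measurable_sum) auto
        show "P (\<lambda>\<eta>. \<Sum>i<n. indicator (A i) \<eta>)" for n
          using A union(3) by (intro P_sum) auto
        show "(\<lambda>\<eta>. indicator (\<Union>i. A i) \<eta> :: complex) \<in> borel_measurable borel"
          using A by (intro borel_measurable_indicator) auto
        show "cmod (\<Sum>i<n. indicator (A i) \<eta>) \<le> 1" for n \<eta>
          unfolding eq by (simp add: indicator_def)
        show "(\<lambda>n. \<Sum>i<n. indicator (A i) \<eta> :: complex) \<longlonglongrightarrow> indicator (\<Union>i. A i) \<eta>" for \<eta>
          unfolding eq by (rule LIMSEQ_indicator_UN)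
      qed
    qed
  qed
  \<comment> \<open>Boundedness stands inside the induction predicate, because the induction rule
    knows only measurability. Nonnegativity lets the summands and the approximants from below
    inherit a bound from the function they build.\<close>
  have nonneg: "(\<exists>B. \<forall>x. u x \<le> B) \<longrightarrow> P (\<lambda>\<eta>. complex_of_real (u \<eta>))"
    if "u \<in> borel_measurable borel" "\<And>x. 0 \<le> u x" for u :: "'g dual \<Rightarrow> real"
    using that
  proof (induction rule: borel_measurable_induct_real)
    case (set A)
    then show ?case using ind[of A] by (simp add: of_real_indicator)
  next
    case (mult u c)
    show ?case
    proof (intro impI)
      assume "\<exists>B. \<forall>x. c * u x \<le> B"
      then obtain B where B: "\<And>x. c * u x \<le> B" by blast
      show "P (\<lambda>\<eta>. complex_of_real (c * u \<eta>))"
      proof (cases "c = 0")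
        case True
        then show ?thesis using P0 by simp
      next
        case False
        then have "u x \<le> B / c" for x
          using B[of x] mult(1) by (simp add: field_simps)
        then have "P (\<lambda>\<eta>. complex_of_real (u \<eta>))" using mult.IH by blast
        then show ?thesis
          using P_scale[of "\<lambda>\<eta>. complex_of_real (u \<eta>)" "complex_of_real c"] mult(2) by simp
      qed
    qed
  next
    case (add u v)
    show ?case
    proof (intro impI)
      assume "\<exists>B. \<forall>x. v x + u x \<le> B"
      then obtain B where B: "\<And>x. v x + u x \<le> B" by blast
      have "u x \<le> B" "v x \<le> B" for x using B[of x] add.hyps(2,4)[of x] by simp_all
      then have "P (\<lambda>\<eta>. complex_of_real (u \<eta>))" "P (\<lambda>\<eta>. complex_of_real (v \<eta>))"
        using add.IH by blast+
      then show "P (\<lambda>\<eta>. complex_of_real (v \<eta> + u \<eta>))"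
        using P_add[of "\<lambda>\<eta>. complex_of_real (v \<eta>)" "\<lambda>\<eta>. complex_of_real (u \<eta>)"] add.hyps(1,3) by simp
    qed
  next
    case (seq U)
    show ?case
    proof (intro impI)
      assume "\<exists>B. \<forall>x. u x \<le> B"
      then obtain B where B: "\<And>x. u x \<le> B" by blast
      have UB: "U i x \<le> B" for i x
      proof -
        have "incseq (\<lambda>i. U i x)" using seq.hyps(3) by (auto simp: incseq_def le_fun_def)
        then have "U i x \<le> u x" using seq.hyps(4)[of x] by (intro incseq_le) auto
        then show ?thesis using B[of x] by simp
      qed
      show "P (\<lambda>\<eta>. complex_of_real (u \<eta>))"
      proof (rule P_lim)
        note [measurable] = seq(1)
        show "(\<lambda>\<eta>. complex_of_real (U i \<eta>)) \<in> borel_measurable borel" for i by measurable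
        show "P (\<lambda>\<eta>. complex_of_real (U i \<eta>))" for i using seq.IH UB by blast
        show "(\<lambda>i. complex_of_real (U i \<eta>)) \<longlonglongrightarrow> complex_of_real (u \<eta>)" for \<eta>
          using seq.hyps(4) by (intro tendsto_of_real) simp
        then show "(\<lambda>\<eta>. complex_of_real (u \<eta>)) \<in> borel_measurable borel"
          by (rule borel_measurable_LIMSEQ_metric[rotated]) measurable
        show "cmod (complex_of_real (U i \<eta>)) \<le> B" for i \<eta>
          using UB[of i \<eta>] seq(2)[of i \<eta>] by simp
      qed
    qed
  qed
  have real: "P (\<lambda>\<eta>. complex_of_real (u \<eta>))"
    if [measurable]: "u \<in> borel_measurable borel" and b: "\<And>\<eta>. \<bar>u \<eta>\<bar> \<le> B" for u B
  proof -
    have bd: "max 0 (u \<eta>) \<le> B" "max 0 (- u \<eta>) \<le> B" for \<eta>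
      using b[of \<eta>] by (auto simp: abs_le_iff)
    have "P (\<lambda>\<eta>. complex_of_real (max 0 (u \<eta>)))"
      by (rule nonneg[THEN mp]) (use bd(1) in \<open>auto\<close>)
    moreover have "P (\<lambda>\<eta>. complex_of_real (max 0 (- u \<eta>)))"
      by (rule nonneg[THEN mp]) (use bd(2) in \<open>auto\<close>)
    ultimately have "P (\<lambda>\<eta>. complex_of_real (max 0 (u \<eta>)) + (-1) * complex_of_real (max 0 (- u \<eta>)))"
      by (intro P_add P_scale) measurable
    moreover have "complex_of_real (max 0 a) + (-1) * complex_of_real (max 0 (- a)) = complex_of_real a" for a
      by (auto simp: max_def)
    ultimately show ?thesis by simp
  qed
  note [measurable] = f(1)
  have "P (\<lambda>\<eta>. complex_of_real (Re (f \<eta>)))"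
    by (rule real[of _ B]) (use order_trans[OF abs_Re_le_cmod f(2)] in auto)
  moreover have "P (\<lambda>\<eta>. complex_of_real (Im (f \<eta>)))"
    by (rule real[of _ B]) (use order_trans[OF abs_Im_le_cmod f(2)] in auto)
  ultimately have "P (\<lambda>\<eta>. complex_of_real (Re (f \<eta>)) + \<i> * complex_of_real (Im (f \<eta>)))"
    by (intro P_add P_scale) measurable
  then show ?thesis by (simp flip: complex_eq)
qed

section \<open>Haar measure\<close>

locale haar =
  fixes m :: "'g::{ab_group_add,countable} dual measure"
  assumes is_haar: "is_haar m"
begin

lemma sets_m [measurable_cong]: "sets m = sets borel"
  using is_haar by (simp add: is_haar_def)

lemma space_m [simp]: "space m = UNIV"
  using sets_eq_imp_space_eq[OF sets_m] by simp

sublocale finite_measure m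
  by (rule finite_measureI) (use is_haar in \<open>simp add: is_haar_def\<close>)

lemma measure_UNIV [simp]: "measure m UNIV = 1"
  using is_haar by (simp add: is_haar_def measure_def)

lemma measurable_m [simp]: "borel_measurable m = borel_measurable borel"
  by (rule measurable_cong_sets) (simp_all add: sets_m)

lemma measurable_translate_m [measurable]: "(+) \<xi> \<in> m \<rightarrow>\<^sub>M m"
  using measurable_translate[of \<xi>] measurable_cong_sets[OF sets_m sets_m] by simp

lemma distr_translate: "distr m m ((+) \<xi>) = m"
proof (rule measure_eqI)
  fix A assume "A \<in> sets (distr m m ((+) \<xi>))"
  then have A: "A \<in> sets m" by simp
  have *: "(+) \<xi> -` A = (+) (- \<xi>) ` A"
    by (force simp: image_iff)
  have "emeasure (distr m m ((+) \<xi>)) A = emeasure m ((+) \<xi> -` A)"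
    by (subst emeasure_distr) (use A measurable_translate_m in simp_all)
  also have "\<dots> = emeasure m A"
    unfolding * using is_haar A unfolding is_haar_def by blast
  finally show "emeasure (distr m m ((+) \<xi>)) A = emeasure m A" .
qed simp

lemma nn_integral_translate:
  assumes "f \<in> borel_measurable borel"
  shows "(\<integral>\<^sup>+\<eta>. f (\<xi> + \<eta>) \<partial>m) = (\<integral>\<^sup>+\<eta>. f \<eta> \<partial>m)"
proof -
  have "(\<integral>\<^sup>+\<eta>. f \<eta> \<partial>distr m m ((+) \<xi>)) = (\<integral>\<^sup>+\<eta>. f (\<xi> + \<eta>) \<partial>m)"
    using assms by (intro nn_integral_distr) measurable
  then show ?thesis by (simp add: distr_translate)
qed

lemma integral_translate:
  fixes f :: "'g dual \<Rightarrow> complex"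
  assumes "f \<in> borel_measurable borel"
  shows "(\<integral>\<eta>. f (\<xi> + \<eta>) \<partial>m) = (\<integral>\<eta>. f \<eta> \<partial>m)"
proof -
  have "(\<integral>\<eta>. f \<eta> \<partial>distr m m ((+) \<xi>)) = (\<integral>\<eta>. f (\<xi> + \<eta>) \<partial>m)"
    using assms by (intro integral_distr) measurable
  then show ?thesis by (simp add: distr_translate)
qed

lemma integrable_translate:
  fixes f :: "'g dual \<Rightarrow> 'b::{banach, second_countable_topology}"
  assumes "integrable m f"
  shows "integrable m (\<lambda>\<eta>. f (\<xi> + \<eta>))"
proof -
  have "integrable (distr m m ((+) \<xi>)) f" using assms by (simp add: distr_translate)
  then show ?thesis
    by (subst (asm) integrable_distr_eq) (use assms in measurable)
qed

text \<open>Translating by a \<xi> with \<open>char_of \<xi> \<tau> \<noteq> 1\<close> multiplies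
  the integral by that number, while invariance leaves it unchanged.\<close>

lemma integral_char:
  assumes "\<tau> \<noteq> 0"
  shows "(\<integral>\<eta>. char_of \<eta> \<tau> \<partial>m) = 0"
proof -
  have "is_subgroup {0::'g}" by (simp add: is_subgroup_def)
  then obtain \<xi> :: "'g dual" where \<xi>: "char_of \<xi> \<tau> \<noteq> 1"
    using annihilator_separates[of "{0}" \<tau>] assms by auto
  have "(\<integral>\<eta>. char_of \<eta> \<tau> \<partial>m) = (\<integral>\<eta>. char_of (\<xi> + \<eta>) \<tau> \<partial>m)"
    by (rule integral_translate[symmetric]) measurable
  also have "\<dots> = char_of \<xi> \<tau> * (\<integral>\<eta>. char_of \<eta> \<tau> \<partial>m)" by simp
  finally show ?thesis using \<xi> by simp
qed

end

section \<open>Semi-inner product spaces\<close>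

text \<open>A positive semidefinite Hermitian form on the carrier, with no vector space laws for
  \<open>hadd\<close> and \<open>hscale\<close>. Two vectors are identified when they have the same
  inner products; this takes the place of algebraic identities.\<close>

locale prehilb =
  fixes H :: "'h hilb"
  assumes carr_ne: "carr H \<noteq> {}"
    and add_closed: "\<lbrakk>x \<in> carr H; y \<in> carr H\<rbrakk> \<Longrightarrow> hadd H x y \<in> carr H"
    and scale_closed: "x \<in> carr H \<Longrightarrow> hscale H c x \<in> carr H"
    and inner_add_left: "\<lbrakk>x \<in> carr H; y \<in> carr H; z \<in> carr H\<rbrakk>
      \<Longrightarrow> hinner H (hadd H x y) z = hinner H x z + hinner H y z"
    and inner_scale_left: "\<lbrakk>x \<in> carr H; z \<in> carr H\<rbrakk>
      \<Longrightarrow> hinner H (hscale H c x) z = c * hinner H x z"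
    and inner_commute: "\<lbrakk>x \<in> carr H; y \<in> carr H\<rbrakk> \<Longrightarrow> hinner H y x = cnj (hinner H x y)"
    and inner_pos: "x \<in> carr H \<Longrightarrow> 0 \<le> Re (hinner H x x)"
begin

lemma diff_closed: "\<lbrakk>x \<in> carr H; y \<in> carr H\<rbrakk> \<Longrightarrow> hdiff H x y \<in> carr H"
  by (simp add: hdiff_def add_closed scale_closed)

lemma inner_diff_left: "\<lbrakk>x \<in> carr H; y \<in> carr H; z \<in> carr H\<rbrakk>
    \<Longrightarrow> hinner H (hdiff H x y) z = hinner H x z - hinner H y z"
  by (simp add: hdiff_def inner_add_left inner_scale_left scale_closed)

lemma inner_add_right: "\<lbrakk>x \<in> carr H; y \<in> carr H; z \<in> carr H\<rbrakk>
    \<Longrightarrow> hinner H z (hadd H x y) = hinner H z x + hinner H z y"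
  by (metis add_closed complex_cnj_add inner_add_left inner_commute)

lemma inner_scale_right: "\<lbrakk>x \<in> carr H; z \<in> carr H\<rbrakk>
    \<Longrightarrow> hinner H z (hscale H c x) = cnj c * hinner H z x"
  by (metis complex_cnj_mult inner_commute inner_scale_left scale_closed)

lemma inner_diff_right: "\<lbrakk>x \<in> carr H; y \<in> carr H; z \<in> carr H\<rbrakk>
    \<Longrightarrow> hinner H z (hdiff H x y) = hinner H z x - hinner H z y"
  by (simp add: hdiff_def inner_add_right inner_scale_right scale_closed)

lemmas closed_rules = add_closed scale_closed diff_closed
lemmas inner_rules = inner_add_left inner_scale_left inner_diff_left
  inner_add_right inner_scale_right inner_diff_right

lemma hnorm_nonneg [simp]: "x \<in> carr H \<Longrightarrow> 0 \<le> hnorm H x"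
  by (simp add: hnorm_def inner_pos)

lemma hnorm_power2: "x \<in> carr H \<Longrightarrow> (hnorm H x)\<^sup>2 = Re (hinner H x x)"
  by (simp add: hnorm_def inner_pos)

lemma inner_self: "x \<in> carr H \<Longrightarrow> hinner H x x = complex_of_real ((hnorm H x)\<^sup>2)"
  using inner_commute[of x x] by (simp add: hnorm_power2 complex_eq_iff)

lemma hnorm_scale: "x \<in> carr H \<Longrightarrow> hnorm H (hscale H c x) = cmod c * hnorm H x"
proof -
  assume x: "x \<in> carr H"
  have "hinner H (hscale H c x) (hscale H c x) = complex_of_real ((cmod c * hnorm H x)\<^sup>2)"
    using x complex_norm_square[of c]
    by (simp add: inner_rules closed_rules inner_self[OF x] power_mult_distrib mult.assoc)
  then have "(hnorm H (hscale H c x))\<^sup>2 = (cmod c * hnorm H x)\<^sup>2"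
    using x by (simp add: inner_self closed_rules del: of_real_power of_real_mult)
  then show ?thesis
    using x by (simp add: closed_rules power2_eq_iff_nonneg)
qed

lemma hnorm_add_power2:
  assumes "x \<in> carr H" "y \<in> carr H"
  shows "(hnorm H (hadd H x y))\<^sup>2 = (hnorm H x)\<^sup>2 + (hnorm H y)\<^sup>2 + 2 * Re (hinner H x y)"
  using assms inner_commute[of x y] by (simp add: hnorm_power2 inner_rules closed_rules)

lemma hnorm_diff_power2:
  assumes "x \<in> carr H" "y \<in> carr H"
  shows "(hnorm H (hdiff H x y))\<^sup>2 = (hnorm H x)\<^sup>2 + (hnorm H y)\<^sup>2 - 2 * Re (hinner H x y)"
  using assms inner_commute[of x y] by (simp add: hnorm_power2 inner_rules closed_rules)

text \<open>The squared norm of \<open>x\<close> minus \<open>t\<close> times the projection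
  direction \<open>\<langle>x,y\<rangle> y\<close> is nonnegative for all real \<open>t\<close>, and
  \<open>t = 1 / (hnorm H y)\<^sup>2\<close> is optimal. As the form is only semidefinite,
  \<open>hnorm H y = 0\<close> is treated apart: the expression is then affine in \<open>t\<close>
  and forces the inner product to vanish.\<close>

lemma Cauchy_Schwarz:
  assumes x: "x \<in> carr H" and y: "y \<in> carr H"
  shows "cmod (hinner H x y) \<le> hnorm H x * hnorm H y"
proof -
  define r where "r = cmod (hinner H x y)"
  have nn: "0 \<le> (hnorm H x)\<^sup>2 - 2 * t * r\<^sup>2 + t\<^sup>2 * r\<^sup>2 * (hnorm H y)\<^sup>2" for t :: real
  proof -
    let ?c = "complex_of_real t * hinner H x y"
    have "0 \<le> (hnorm H (hdiff H x (hscale H ?c y)))\<^sup>2" by simp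
    also have "\<dots> = (hnorm H x)\<^sup>2 + (cmod ?c * hnorm H y)\<^sup>2 - 2 * Re (cnj ?c * hinner H x y)"
      using x y by (simp add: hnorm_diff_power2 hnorm_scale inner_rules closed_rules
          del: complex_cnj_mult)
    also have "cnj ?c * hinner H x y = complex_of_real (t * r\<^sup>2)"
      by (simp add: r_def complex_norm_square mult_ac del: of_real_power)
    also have "(hnorm H x)\<^sup>2 + (cmod ?c * hnorm H y)\<^sup>2 - 2 * Re (complex_of_real (t * r\<^sup>2))
        = (hnorm H x)\<^sup>2 - 2 * t * r\<^sup>2 + t\<^sup>2 * r\<^sup>2 * (hnorm H y)\<^sup>2"
      by (simp add: norm_mult power_mult_distrib flip: r_def of_real_power of_real_mult)
    finally show ?thesis .
  qed
  show ?thesis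
  proof (cases "r = 0 \<or> hnorm H y = 0")
    case True
    then show ?thesis
    proof
      assume "hnorm H y = 0"
      have "r = 0"
      proof (rule ccontr)
        assume "r \<noteq> 0"
        \<comment> \<open>This \<open>t\<close> gives the affine expression the value -1.\<close>
        then show False
          using nn[of "((hnorm H x)\<^sup>2 + 1) / (2 * r\<^sup>2)"] \<open>hnorm H y = 0\<close> by (simp add: field_simps)
      qed
      then show ?thesis using x y by (simp add: r_def)
    qed (use x y in \<open>simp add: r_def\<close>)
  next
    case False
    then have pos: "0 < (hnorm H y)\<^sup>2" by simp
    define a where "a = 1 / (hnorm H y)\<^sup>2"
    have a: "a * (hnorm H y)\<^sup>2 = 1" using pos by (simp add: a_def)
    then have "a\<^sup>2 * r\<^sup>2 * (hnorm H y)\<^sup>2 = a * r\<^sup>2" by algebra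
    then have "a * r\<^sup>2 \<le> (hnorm H x)\<^sup>2" using nn[of a] by linarith
    then have "r\<^sup>2 \<le> (hnorm H x)\<^sup>2 * (hnorm H y)\<^sup>2"
      using pos by (simp add: a_def pos_divide_le_eq)
    then have "r\<^sup>2 \<le> (hnorm H x * hnorm H y)\<^sup>2" by (simp add: power_mult_distrib)
    then show ?thesis
      unfolding r_def[symmetric] by (rule power2_le_imp_le) (use x y in simp)
  qed
qed

lemma hnorm_triangle:
  assumes "x \<in> carr H" "y \<in> carr H"
  shows "hnorm H (hadd H x y) \<le> hnorm H x + hnorm H y"
proof (rule power2_le_imp_le)
  have "Re (hinner H x y) \<le> hnorm H x * hnorm H y"
    using Cauchy_Schwarz[OF assms] complex_Re_le_cmod order_trans by blast
  then show "(hnorm H (hadd H x y))\<^sup>2 \<le> (hnorm H x + hnorm H y)\<^sup>2"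
    using assms by (simp add: hnorm_add_power2 power2_sum)
qed (use assms in simp)

text \<open>The substitute for rewriting vectors: two different expressions for the same vector have
  the same inner products, hence the same norm.\<close>

lemma hnorm_cong:
  assumes "x \<in> carr H" "y \<in> carr H" "\<And>w. w \<in> carr H \<Longrightarrow> hinner H x w = hinner H y w"
  shows "hnorm H x = hnorm H y"
proof -
  have "hinner H x x = hinner H y y"
    using assms by (metis inner_commute)
  then show ?thesis by (simp add: hnorm_def)
qed

abbreviation hdist where "hdist x y \<equiv> hnorm H (hdiff H x y)"

lemma hdist_eqI:
  assumes "x \<in> carr H" "y \<in> carr H" "\<And>w. w \<in> carr H \<Longrightarrow> hinner H x w = hinner H y w"
  shows "hdist x y = 0"
proof -
  have "(hdist x y)\<^sup>2 = 0"
    using assms by (simp add: hnorm_power2 closed_rules inner_diff_left)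
  then show ?thesis by simp
qed

lemma hdist_self [simp]: "x \<in> carr H \<Longrightarrow> hdist x x = 0"
  by (rule hdist_eqI) auto

lemma hdist_commute:
  assumes "x \<in> carr H" "y \<in> carr H"
  shows "hdist x y = hdist y x"
proof -
  have "(hdist x y)\<^sup>2 = (hdist y x)\<^sup>2"
    using assms inner_commute[of x y] by (simp add: hnorm_diff_power2)
  then show ?thesis using assms by (simp add: closed_rules power2_eq_iff_nonneg)
qed

lemma hdist_triangle:
  assumes "x \<in> carr H" "y \<in> carr H" "z \<in> carr H"
  shows "hdist x z \<le> hdist x y + hdist y z"
proof -
  have "hdist x z = hnorm H (hadd H (hdiff H x y) (hdiff H y z))"
    using assms by (intro hnorm_cong) (auto simp: inner_rules closed_rules)
  also have "\<dots> \<le> hdist x y + hdist y z"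
    using assms by (intro hnorm_triangle) (auto simp: closed_rules)
  finally show ?thesis .
qed

lemma hdist_add:
  assumes "x \<in> carr H" "y \<in> carr H" "x' \<in> carr H" "y' \<in> carr H"
  shows "hdist (hadd H x y) (hadd H x' y') \<le> hdist x x' + hdist y y'"
proof -
  have "hdist (hadd H x y) (hadd H x' y') = hnorm H (hadd H (hdiff H x x') (hdiff H y y'))"
    using assms by (intro hnorm_cong) (auto simp: inner_rules closed_rules)
  also have "\<dots> \<le> hdist x x' + hdist y y'"
    using assms by (intro hnorm_triangle) (auto simp: closed_rules)
  finally show ?thesis .
qed

lemma hdist_scale:
  assumes "x \<in> carr H" "y \<in> carr H"
  shows "hdist (hscale H c x) (hscale H c y) = cmod c * hdist x y"
proof -
  have "hdist (hscale H c x) (hscale H c y) = hnorm H (hscale H c (hdiff H x y))"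
    using assms by (intro hnorm_cong) (auto simp: inner_rules closed_rules algebra_simps)
  also have "\<dots> = cmod c * hdist x y"
    using assms by (simp add: hnorm_scale closed_rules)
  finally show ?thesis .
qed

lemma hdist_scale_left:
  assumes "x \<in> carr H"
  shows "hdist (hscale H a x) (hscale H b x) = cmod (a - b) * hnorm H x"
proof -
  have "hdist (hscale H a x) (hscale H b x) = hnorm H (hscale H (a - b) x)"
    using assms by (intro hnorm_cong) (auto simp: inner_rules closed_rules algebra_simps)
  then show ?thesis using assms by (simp add: hnorm_scale)
qed

lemma hnorm_diff_le:
  assumes "x \<in> carr H" "y \<in> carr H"
  shows "\<bar>hnorm H x - hnorm H y\<bar> \<le> hdist x y"
proof -
  have *: "hnorm H x \<le> hnorm H y + hdist x y" if "x \<in> carr H" "y \<in> carr H" for x y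
  proof -
    have "hnorm H x = hnorm H (hadd H y (hdiff H x y))"
      using that by (intro hnorm_cong) (auto simp: inner_rules closed_rules)
    also have "\<dots> \<le> hnorm H y + hdist x y"
      using that by (intro hnorm_triangle) (auto simp: closed_rules)
    finally show ?thesis .
  qed
  show ?thesis
    using *[OF assms] *[OF assms(2,1)] hdist_commute[OF assms] by simp
qed

lemma hdist_power2_le:
  assumes "x \<in> carr H" "y \<in> carr H"
  shows "(hdist x y)\<^sup>2 \<le> 2 * (hnorm H x)\<^sup>2 + 2 * (hnorm H y)\<^sup>2"
proof -
  have "0 \<le> (hnorm H (hadd H x y))\<^sup>2" by simp
  then show ?thesis
    using assms unfolding hnorm_add_power2[OF assms] hnorm_diff_power2[OF assms] by simp
qed

lemma inner_tendsto:
  assumes "\<forall>\<^sub>F n in F. u n \<in> carr H" "x \<in> carr H" "w \<in> carr H" "((\<lambda>n. hdist (u n) x) \<longlongrightarrow> 0) F"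
  shows "((\<lambda>n. hinner H (u n) w) \<longlongrightarrow> hinner H x w) F"
proof (rule LIM_zero_cancel, rule tendsto_norm_zero_cancel, rule Lim_null_comparison)
  show "\<forall>\<^sub>F n in F. norm (cmod (hinner H (u n) w - hinner H x w)) \<le> hdist (u n) x * hnorm H w"
    using assms(1)
  proof eventually_elim
    case (elim n)
    then show ?case
      using Cauchy_Schwarz[of "hdiff H (u n) x" w] assms(2,3) by (simp add: inner_rules closed_rules)
  qed
  show "((\<lambda>n. hdist (u n) x * hnorm H w) \<longlongrightarrow> 0) F"
    using tendsto_mult_left_zero[OF assms(4)] .
qed

lemma hnorm_tendsto:
  assumes "\<forall>\<^sub>F n in F. u n \<in> carr H" "x \<in> carr H" "((\<lambda>n. hdist (u n) x) \<longlongrightarrow> 0) F"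
  shows "((\<lambda>n. hnorm H (u n)) \<longlongrightarrow> hnorm H x) F"
proof (rule LIM_zero_cancel, rule Lim_null_comparison)
  show "\<forall>\<^sub>F n in F. norm (hnorm H (u n) - hnorm H x) \<le> hdist (u n) x"
    using assms(1) by eventually_elim (use hnorm_diff_le assms(2) in simp)
qed (rule assms(3))

end

section \<open>Completeness and closed subspaces\<close>

definition hcomplete :: "'h hilb \<Rightarrow> bool" where
  "hcomplete H \<longleftrightarrow> (\<forall>u. (\<forall>n. u n \<in> carr H) \<and>
      (\<forall>e>0. \<exists>M. \<forall>m\<ge>M. \<forall>n\<ge>M. hnorm H (hdiff H (u m) (u n)) < e) \<longrightarrow>
      (\<exists>x\<in>carr H. (\<lambda>n::nat. hnorm H (hdiff H (u n) x)) \<longlonglongrightarrow> 0))"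

locale csubspace = prehilb H for H :: "'h hilb" +
  fixes V :: "'h set"
  assumes closed_subspace: "closed_subspace H V"
begin

lemma sub_carr: "v \<in> V \<Longrightarrow> v \<in> carr H"
  and sub_ne: "V \<noteq> {}"
  and sub_add: "\<lbrakk>u \<in> V; v \<in> V\<rbrakk> \<Longrightarrow> hadd H u v \<in> V"
  and sub_scale: "v \<in> V \<Longrightarrow> hscale H c v \<in> V"
  using closed_subspace unfolding closed_subspace_def by blast+

lemma sub_lim: "\<lbrakk>x \<in> carr H; \<And>n. u n \<in> V; (\<lambda>n::nat. hdist (u n) x) \<longlonglongrightarrow> 0\<rbrakk> \<Longrightarrow> x \<in> V"
  using closed_subspace unfolding closed_subspace_def by blast

lemma sub_diff: "\<lbrakk>u \<in> V; v \<in> V\<rbrakk> \<Longrightarrow> hdiff H u v \<in> V"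
  by (simp add: hdiff_def sub_add sub_scale)

text \<open>The constant sequence \<open>v\<close> converges to \<open>x\<close>. This is the device
  that passes from one representative of a vector to another throughout.\<close>

lemma sub_cong: "\<lbrakk>v \<in> V; x \<in> carr H; hdist v x = 0\<rbrakk> \<Longrightarrow> x \<in> V"
  using sub_lim[of x "\<lambda>_. v"] by simp

end

section \<open>The space of square-integrable functions\<close>

lemma hadd_L2 [simp]: "hadd (L2 N H) = (\<lambda>\<Phi> \<Psi> y. hadd H (\<Phi> y) (\<Psi> y))"
  and hscale_L2 [simp]: "hscale (L2 N H) = (\<lambda>c \<Phi> y. hscale H c (\<Phi> y))"
  and hdiff_L2 [simp]: "hdiff (L2 N H) = (\<lambda>\<Phi> \<Psi> y. hdiff H (\<Phi> y) (\<Psi> y))"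
  and hinner_L2: "hinner (L2 N H) = (\<lambda>\<Phi> \<Psi>. \<integral>y. hinner H (\<Phi> y) (\<Psi> y) \<partial>N)"
  by (simp_all add: L2_def hdiff_def fun_eq_iff)

lemma L2_carr_iff:
  "\<Phi> \<in> carr (L2 N H) \<longleftrightarrow> (\<forall>y\<in>space N. \<Phi> y \<in> carr H) \<and>
       (\<forall>h\<in>carr H. (\<lambda>y. hinner H (\<Phi> y) h) \<in> borel_measurable N) \<and>
       integrable N (\<lambda>y. (hnorm H (\<Phi> y))\<^sup>2)"
  by (simp add: L2_def)

lemma L2_carrD:
  assumes "\<Phi> \<in> carr (L2 N H)"
  shows "y \<in> space N \<Longrightarrow> \<Phi> y \<in> carr H"
    and "h \<in> carr H \<Longrightarrow> (\<lambda>y. hinner H (\<Phi> y) h) \<in> borel_measurable N"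
    and "integrable N (\<lambda>y. (hnorm H (\<Phi> y))\<^sup>2)"
  using assms by (auto simp: L2_carr_iff)

lemma L2_carr_cong:
  assumes "\<And>y. y \<in> space N \<Longrightarrow> \<Phi> y = \<Psi> y"
  shows "\<Phi> \<in> carr (L2 N H) \<longleftrightarrow> \<Psi> \<in> carr (L2 N H)"
proof -
  have "(\<lambda>y. hinner H (\<Phi> y) h) \<in> borel_measurable N \<longleftrightarrow> (\<lambda>y. hinner H (\<Psi> y) h) \<in> borel_measurable N" for h
    by (rule measurable_cong) (simp add: assms)
  moreover have "integrable N (\<lambda>y. (hnorm H (\<Phi> y))\<^sup>2) \<longleftrightarrow> integrable N (\<lambda>y. (hnorm H (\<Psi> y))\<^sup>2)"
    by (rule Bochner_Integration.integrable_cong) (simp_all add: assms)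
  ultimately show ?thesis by (simp add: L2_carr_iff assms)
qed

text \<open>Functions in \<open>L2\<close> are only weakly measurable; a countable dense set makes
  the pointwise inner product of two of them measurable, on which the structure of \<open>L2\<close>
  as an inner product space rests.\<close>

locale separable_prehilb = prehilb +
  assumes separable: "hseparable H"
begin

lemma L2_hnorm_measurable:
  assumes "\<Phi> \<in> carr (L2 N H)"
  shows "(\<lambda>y. hnorm H (\<Phi> y)) \<in> borel_measurable N"
proof -
  have "(\<lambda>y. sqrt ((hnorm H (\<Phi> y))\<^sup>2)) \<in> borel_measurable N"
    using L2_carrD(3)[OF assms] by measurable
  then show ?thesis
    by (rule measurable_cong[THEN iffD1, rotated]) (use L2_carrD(1)[OF assms] in auto)
qed

text \<open>\<open>\<Psi>\<close> is approximated within \<open>1 / real (Suc n)\<close> by a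
  function with countably many values \<open>d (k n y)\<close>. On each piece the inner product is
  against a fixed vector, hence measurable, and continuity of the form gives the limit.\<close>

lemma inner_measurable:
  assumes \<Phi>: "\<forall>y\<in>space N. \<Phi> y \<in> carr H" "\<forall>h\<in>carr H. (\<lambda>y. hinner H (\<Phi> y) h) \<in> borel_measurable N"
    and \<Psi>: "\<forall>y\<in>space N. \<Psi> y \<in> carr H" "\<forall>h\<in>carr H. (\<lambda>y. hinner H (\<Psi> y) h) \<in> borel_measurable N"
    and nm [measurable]: "(\<lambda>y. (hnorm H (\<Psi> y))\<^sup>2) \<in> borel_measurable N"
  shows "(\<lambda>y. hinner H (\<Phi> y) (\<Psi> y)) \<in> borel_measurable N"
proof -
  obtain D where D: "countable D" "D \<subseteq> carr H"
    "\<And>x e. x \<in> carr H \<Longrightarrow> e > 0 \<Longrightarrow> \<exists>d\<in>D. hdist x d < e"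
    using separable unfolding hseparable_def by blast
  have "D \<noteq> {}" using carr_ne D(3)[of _ 1] by fastforce
  define d where "d = from_nat_into D"
  have dc: "d k \<in> carr H" for k
    using from_nat_into[OF \<open>D \<noteq> {}\<close>] D(2) by (auto simp: d_def)
  have dd: "\<exists>k. hdist x (d k) < e" if "x \<in> carr H" "e > 0" for x e
    using D(3)[OF that] from_nat_into_surj[OF D(1)] unfolding d_def by metis
  \<comment> \<open>The test uses squares because the squared distance to a fixed vector expands
    into the squared norm of \<open>\<Psi>\<close> and an inner product, both known to be
    measurable; so the least index is measurable too.\<close>
  define k where "k n y = (LEAST k. (hdist (\<Psi> y) (d k))\<^sup>2 < (1 / real (Suc n))\<^sup>2)" for n y
  have k: "hdist (\<Psi> y) (d (k n y)) < 1 / real (Suc n)" if y: "y \<in> space N" for n y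
  proof -
    obtain j where "hdist (\<Psi> y) (d j) < 1 / real (Suc n)"
      using dd[of "\<Psi> y" "1 / real (Suc n)"] bspec[OF \<Psi>(1) y] by auto
    then have "(hdist (\<Psi> y) (d j))\<^sup>2 < (1 / real (Suc n))\<^sup>2"
      using \<Psi>(1) y dc by (intro power_strict_mono) (auto simp: closed_rules)
    then have "(hdist (\<Psi> y) (d (k n y)))\<^sup>2 < (1 / real (Suc n))\<^sup>2"
      unfolding k_def by (rule LeastI)
    then show ?thesis by (rule power2_less_imp_less) simp
  qed
  have [measurable]: "(\<lambda>y. (hdist (\<Psi> y) (d j))\<^sup>2) \<in> borel_measurable N" for j
  proof -
    have [measurable]: "(\<lambda>y. hinner H (\<Psi> y) (d j)) \<in> borel_measurable N"
      using \<Psi>(2) dc by blast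
    have "(\<lambda>y. (hnorm H (\<Psi> y))\<^sup>2 + (hnorm H (d j))\<^sup>2 - 2 * Re (hinner H (\<Psi> y) (d j))) \<in> borel_measurable N"
      by measurable
    then show ?thesis
      by (rule measurable_cong[THEN iffD1, rotated]) (use \<Psi>(1) dc in \<open>simp add: hnorm_diff_power2\<close>)
  qed
  have [measurable]: "k n \<in> measurable N (count_space UNIV)" for n
    unfolding k_def[abs_def] by measurable
  have m: "(\<lambda>y. hinner H (\<Phi> y) (d (k n y))) \<in> borel_measurable N" for n
  proof (rule measurable_compose_countable)
    show "(\<lambda>y. hinner H (\<Phi> y) (d j)) \<in> borel_measurable N" for j
      using \<Phi>(2) dc by blast
  qed measurable
  show ?thesis
  proof (rule borel_measurable_LIMSEQ_metric[OF m])
    fix y assume y: "y \<in> space N"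
    have *: "(\<lambda>n. hdist (d (k n y)) (\<Psi> y)) \<longlonglongrightarrow> 0"
    proof (rule tendsto_sandwich[OF _ _ tendsto_const LIMSEQ_Suc[OF lim_1_over_n]])
      show "\<forall>\<^sub>F n in sequentially. hdist (d (k n y)) (\<Psi> y) \<le> 1 / real (Suc n)"
        using k[OF y] hdist_commute[OF dc bspec[OF \<Psi>(1) y]]
        by (intro always_eventually allI) (simp add: less_imp_le)
      show "\<forall>\<^sub>F n in sequentially. 0 \<le> hdist (d (k n y)) (\<Psi> y)"
        using \<Psi>(1) y dc by (auto simp: closed_rules)
    qed
    have "(\<lambda>n. hinner H (d (k n y)) (\<Phi> y)) \<longlonglongrightarrow> hinner H (\<Psi> y) (\<Phi> y)"
      using dc y \<Psi>(1) \<Phi>(1) by (intro inner_tendsto *) auto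
    then have "(\<lambda>n. cnj (hinner H (d (k n y)) (\<Phi> y))) \<longlonglongrightarrow> cnj (hinner H (\<Psi> y) (\<Phi> y))"
      by (rule tendsto_cnj)
    moreover have "cnj (hinner H (d (k n y)) (\<Phi> y)) = hinner H (\<Phi> y) (d (k n y))" for n
      using \<Phi>(1) y dc by (intro inner_commute[symmetric]) auto
    moreover have "cnj (hinner H (\<Psi> y) (\<Phi> y)) = hinner H (\<Phi> y) (\<Psi> y)"
      using \<Phi>(1) \<Psi>(1) y dc by (intro inner_commute[symmetric]) auto
    ultimately show "(\<lambda>n. hinner H (\<Phi> y) (d (k n y))) \<longlonglongrightarrow> hinner H (\<Phi> y) (\<Psi> y)" by simp
  qed
qed

lemma L2_inner_measurable:
  "\<lbrakk>\<Phi> \<in> carr (L2 N H); \<Psi> \<in> carr (L2 N H)\<rbrakk> \<Longrightarrow> (\<lambda>y. hinner H (\<Phi> y) (\<Psi> y)) \<in> borel_measurable N"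
  by (rule inner_measurable) (auto simp: L2_carr_iff)

lemma L2_inner_integrable:
  assumes "\<Phi> \<in> carr (L2 N H)" "\<Psi> \<in> carr (L2 N H)"
  shows "integrable N (\<lambda>y. hinner H (\<Phi> y) (\<Psi> y))"
proof (rule Bochner_Integration.integrable_bound)
  show "integrable N (\<lambda>y. (hnorm H (\<Phi> y))\<^sup>2 + (hnorm H (\<Psi> y))\<^sup>2)"
    using assms by (auto simp: L2_carr_iff)
  show "AE y in N. norm (hinner H (\<Phi> y) (\<Psi> y)) \<le> norm ((hnorm H (\<Phi> y))\<^sup>2 + (hnorm H (\<Psi> y))\<^sup>2)"
  proof (rule AE_I2)
    fix y assume "y \<in> space N"
    then have c: "\<Phi> y \<in> carr H" "\<Psi> y \<in> carr H" using assms by (auto simp: L2_carr_iff)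
    have "hnorm H (\<Phi> y) * hnorm H (\<Psi> y) \<le> (hnorm H (\<Phi> y))\<^sup>2 + (hnorm H (\<Psi> y))\<^sup>2"
      using sum_squares_bound[of "hnorm H (\<Phi> y)" "hnorm H (\<Psi> y)"] mult_nonneg_nonneg[OF c[THEN hnorm_nonneg]]
      by linarith
    then show "norm (hinner H (\<Phi> y) (\<Psi> y)) \<le> norm ((hnorm H (\<Phi> y))\<^sup>2 + (hnorm H (\<Psi> y))\<^sup>2)"
      using Cauchy_Schwarz[OF c] by simp
  qed
qed (rule L2_inner_measurable[OF assms])

lemma L2_hdist_measurable:
  assumes "\<Phi> \<in> carr (L2 N H)" "\<Psi> \<in> carr (L2 N H)"
  shows "(\<lambda>y. hdist (\<Phi> y) (\<Psi> y)) \<in> borel_measurable N"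
proof -
  note [measurable] = L2_inner_measurable[OF assms] L2_hnorm_measurable[OF assms(1)]
    L2_hnorm_measurable[OF assms(2)]
  have "(\<lambda>y. sqrt ((hnorm H (\<Phi> y))\<^sup>2 + (hnorm H (\<Psi> y))\<^sup>2 - 2 * Re (hinner H (\<Phi> y) (\<Psi> y)))) \<in> borel_measurable N"
    by measurable
  then show ?thesis
    by (rule measurable_cong[THEN iffD1, rotated])
       (use L2_carrD(1)[OF assms(1)] L2_carrD(1)[OF assms(2)] in
         \<open>simp add: closed_rules flip: hnorm_diff_power2\<close>)
qed

lemma L2_scale_closed:
  assumes \<Phi>: "\<Phi> \<in> carr (L2 N H)" and g [measurable]: "g \<in> borel_measurable N"
    and B: "\<And>y. y \<in> space N \<Longrightarrow> cmod (g y) \<le> B"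
  shows "(\<lambda>y. hscale H (g y) (\<Phi> y)) \<in> carr (L2 N H)"
  unfolding L2_carr_iff
proof (intro conjI ballI)
  note [measurable] = L2_hnorm_measurable[OF \<Phi>]
  show "hscale H (g y) (\<Phi> y) \<in> carr H" if "y \<in> space N" for y
    using that \<Phi> by (simp add: L2_carr_iff closed_rules)
  show "(\<lambda>y. hinner H (hscale H (g y) (\<Phi> y)) h) \<in> borel_measurable N" if "h \<in> carr H" for h
  proof -
    have [measurable]: "(\<lambda>y. hinner H (\<Phi> y) h) \<in> borel_measurable N"
      using \<Phi> that by (simp add: L2_carr_iff)
    have "(\<lambda>y. g y * hinner H (\<Phi> y) h) \<in> borel_measurable N" by measurable
    then show ?thesis
      by (rule measurable_cong[THEN iffD1, rotated])
         (use \<Phi> that in \<open>simp add: L2_carr_iff inner_rules\<close>)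
  qed
  show "integrable N (\<lambda>y. (hnorm H (hscale H (g y) (\<Phi> y)))\<^sup>2)"
  proof (rule Bochner_Integration.integrable_bound)
    show "integrable N (\<lambda>y. B\<^sup>2 * (hnorm H (\<Phi> y))\<^sup>2)" using \<Phi> by (auto simp: L2_carr_iff)
    have "(\<lambda>y. (cmod (g y) * hnorm H (\<Phi> y))\<^sup>2) \<in> borel_measurable N" by measurable
    then show "(\<lambda>y. (hnorm H (hscale H (g y) (\<Phi> y)))\<^sup>2) \<in> borel_measurable N"
      by (rule measurable_cong[THEN iffD1, rotated])
         (use \<Phi> in \<open>simp add: L2_carr_iff hnorm_scale\<close>)
    show "AE y in N. norm ((hnorm H (hscale H (g y) (\<Phi> y)))\<^sup>2) \<le> norm (B\<^sup>2 * (hnorm H (\<Phi> y))\<^sup>2)"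
    proof (rule AE_I2)
      fix y assume "y \<in> space N"
      then show "norm ((hnorm H (hscale H (g y) (\<Phi> y)))\<^sup>2) \<le> norm (B\<^sup>2 * (hnorm H (\<Phi> y))\<^sup>2)"
        using B[of y] L2_carrD(1)[OF \<Phi>, of y]
        by (simp add: hnorm_scale power_mult_distrib mult_right_mono power_mono)
    qed
  qed
qed

lemma L2_add_closed:
  assumes \<Phi>: "\<Phi> \<in> carr (L2 N H)" and \<Psi>: "\<Psi> \<in> carr (L2 N H)"
  shows "(\<lambda>y. hadd H (\<Phi> y) (\<Psi> y)) \<in> carr (L2 N H)"
  unfolding L2_carr_iff
proof (intro conjI ballI)
  show "hadd H (\<Phi> y) (\<Psi> y) \<in> carr H" if "y \<in> space N" for y
    using that \<Phi> \<Psi> by (simp add: L2_carr_iff closed_rules)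
  show "(\<lambda>y. hinner H (hadd H (\<Phi> y) (\<Psi> y)) h) \<in> borel_measurable N" if "h \<in> carr H" for h
  proof -
    have [measurable]: "(\<lambda>y. hinner H (\<Phi> y) h) \<in> borel_measurable N"
        "(\<lambda>y. hinner H (\<Psi> y) h) \<in> borel_measurable N"
      using \<Phi> \<Psi> that by (simp_all add: L2_carr_iff)
    have "(\<lambda>y. hinner H (\<Phi> y) h + hinner H (\<Psi> y) h) \<in> borel_measurable N" by measurable
    then show ?thesis
      by (rule measurable_cong[THEN iffD1, rotated])
         (use \<Phi> \<Psi> that in \<open>simp add: L2_carr_iff inner_rules\<close>)
  qed
  have eq: "(hnorm H (hadd H (\<Phi> y) (\<Psi> y)))\<^sup>2
      = (hnorm H (\<Phi> y))\<^sup>2 + (hnorm H (\<Psi> y))\<^sup>2 + 2 * Re (hinner H (\<Phi> y) (\<Psi> y))"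
    if "y \<in> space N" for y
    by (intro hnorm_add_power2 L2_carrD(1)[OF \<Phi> that] L2_carrD(1)[OF \<Psi> that])
  have "integrable N (\<lambda>y. (hnorm H (\<Phi> y))\<^sup>2 + (hnorm H (\<Psi> y))\<^sup>2 + 2 * Re (hinner H (\<Phi> y) (\<Psi> y)))"
    using L2_inner_integrable[OF \<Phi> \<Psi>] \<Phi> \<Psi> by (auto simp: L2_carr_iff)
  moreover have "integrable N (\<lambda>y. (hnorm H (hadd H (\<Phi> y) (\<Psi> y)))\<^sup>2) \<longleftrightarrow>
     integrable N (\<lambda>y. (hnorm H (\<Phi> y))\<^sup>2 + (hnorm H (\<Psi> y))\<^sup>2 + 2 * Re (hinner H (\<Phi> y) (\<Psi> y)))"
    by (rule Bochner_Integration.integrable_cong[OF refl]) (rule eq)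
  ultimately show "integrable N (\<lambda>y. (hnorm H (hadd H (\<Phi> y) (\<Psi> y)))\<^sup>2)" by blast
qed

theorem prehilb_L2: "prehilb (L2 N H)"
proof
  obtain x where x: "x \<in> carr H" using carr_ne by blast
  \<comment> \<open>No zero vector is named in the structure. \<open>hscale H 0 x\<close> has all
    inner products 0, so the constant function with this value is square-integrable over any
    measure, finite or not.\<close>
  then have z: "hinner H (hscale H 0 x) w = 0" if "w \<in> carr H" for w
    using that by (simp add: inner_rules)
  have "hnorm H (hscale H 0 x) = 0" using x by (simp add: hnorm_scale)
  then have "(\<lambda>y. hscale H 0 x) \<in> carr (L2 N H)"
    by (simp add: L2_carr_iff z x closed_rules)
  then show "carr (L2 N H) \<noteq> {}" by blast
next
  fix \<Phi> \<Psi> assume "\<Phi> \<in> carr (L2 N H)" "\<Psi> \<in> carr (L2 N H)"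
  then show "hadd (L2 N H) \<Phi> \<Psi> \<in> carr (L2 N H)"
    by (simp add: L2_add_closed)
next
  fix \<Phi> c assume "\<Phi> \<in> carr (L2 N H)"
  then show "hscale (L2 N H) c \<Phi> \<in> carr (L2 N H)"
    by (simp add: L2_scale_closed[where B = "cmod c"])
next
  fix \<Phi> \<Psi> \<Theta> assume c: "\<Phi> \<in> carr (L2 N H)" "\<Psi> \<in> carr (L2 N H)" "\<Theta> \<in> carr (L2 N H)"
  have "hinner (L2 N H) (hadd (L2 N H) \<Phi> \<Psi>) \<Theta> = (\<integral>y. hinner H (\<Phi> y) (\<Theta> y) + hinner H (\<Psi> y) (\<Theta> y) \<partial>N)"
    unfolding hinner_L2 hadd_L2
    by (intro Bochner_Integration.integral_cong) (use c in \<open>simp_all add: L2_carr_iff inner_rules\<close>)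
  also have "\<dots> = hinner (L2 N H) \<Phi> \<Theta> + hinner (L2 N H) \<Psi> \<Theta>"
    unfolding hinner_L2 using c by (intro Bochner_Integration.integral_add L2_inner_integrable)
  finally show "hinner (L2 N H) (hadd (L2 N H) \<Phi> \<Psi>) \<Theta> = hinner (L2 N H) \<Phi> \<Theta> + hinner (L2 N H) \<Psi> \<Theta>" .
next
  fix \<Phi> \<Theta> c assume c: "\<Phi> \<in> carr (L2 N H)" "\<Theta> \<in> carr (L2 N H)"
  have "hinner (L2 N H) (hscale (L2 N H) c \<Phi>) \<Theta> = (\<integral>y. c * hinner H (\<Phi> y) (\<Theta> y) \<partial>N)"
    unfolding hinner_L2 hscale_L2
    by (intro Bochner_Integration.integral_cong) (use c in \<open>simp_all add: L2_carr_iff inner_rules\<close>)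
  then show "hinner (L2 N H) (hscale (L2 N H) c \<Phi>) \<Theta> = c * hinner (L2 N H) \<Phi> \<Theta>"
    unfolding hinner_L2 by simp
next
  fix \<Phi> \<Theta> assume c: "\<Phi> \<in> carr (L2 N H)" "\<Theta> \<in> carr (L2 N H)"
  have "hinner (L2 N H) \<Theta> \<Phi> = (\<integral>y. cnj (hinner H (\<Phi> y) (\<Theta> y)) \<partial>N)"
    unfolding hinner_L2
    by (intro Bochner_Integration.integral_cong)
       (use c L2_carrD(1) in \<open>auto intro!: inner_commute\<close>)
  then show "hinner (L2 N H) \<Theta> \<Phi> = cnj (hinner (L2 N H) \<Phi> \<Theta>)"
    unfolding hinner_L2 by simp
next
  fix \<Phi> assume c: "\<Phi> \<in> carr (L2 N H)"
  have "hinner (L2 N H) \<Phi> \<Phi> = (\<integral>y. complex_of_real ((hnorm H (\<Phi> y))\<^sup>2) \<partial>N)"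
    unfolding hinner_L2
    by (intro Bochner_Integration.integral_cong)
       (use c L2_carrD(1) in \<open>auto intro!: inner_self simp del: of_real_power\<close>)
  then show "0 \<le> Re (hinner (L2 N H) \<Phi> \<Phi>)" by (simp del: of_real_power)
qed

lemma hnorm_L2:
  assumes "\<Phi> \<in> carr (L2 N H)"
  shows "(hnorm (L2 N H) \<Phi>)\<^sup>2 = (\<integral>y. (hnorm H (\<Phi> y))\<^sup>2 \<partial>N)"
proof -
  interpret L: prehilb "L2 N H" by (rule prehilb_L2)
  have "hinner (L2 N H) \<Phi> \<Phi> = (\<integral>y. complex_of_real ((hnorm H (\<Phi> y))\<^sup>2) \<partial>N)"
    unfolding hinner_L2
    by (intro Bochner_Integration.integral_cong)
       (use assms L2_carrD(1) in \<open>auto intro!: inner_self simp del: of_real_power\<close>)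
  then show ?thesis using L.hnorm_power2[OF assms] by (simp del: of_real_power)
qed

lemma nn_hnorm_L2:
  assumes "\<Phi> \<in> carr (L2 N H)"
  shows "ennreal ((hnorm (L2 N H) \<Phi>)\<^sup>2) = (\<integral>\<^sup>+y. ennreal ((hnorm H (\<Phi> y))\<^sup>2) \<partial>N)"
  using assms by (simp add: hnorm_L2 nn_integral_eq_integral L2_carr_iff)

lemma hnorm_L2_AE_0:
  assumes "\<Phi> \<in> carr (L2 N H)"
  shows "hnorm (L2 N H) \<Phi> = 0 \<longleftrightarrow> (AE y in N. hnorm H (\<Phi> y) = 0)"
proof -
  note [measurable] = L2_hnorm_measurable[OF assms]
  have "hnorm (L2 N H) \<Phi> = 0 \<longleftrightarrow> ennreal ((hnorm (L2 N H) \<Phi>)\<^sup>2) = 0" by simp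
  also have "\<dots> \<longleftrightarrow> (AE y in N. hnorm H (\<Phi> y) = 0)"
    unfolding nn_hnorm_L2[OF assms] by (subst nn_integral_0_iff_AE) simp_all
  finally show ?thesis .
qed

lemma hdist_L2_AE_0:
  assumes "\<Phi> \<in> carr (L2 N H)" "\<Psi> \<in> carr (L2 N H)"
  shows "hnorm (L2 N H) (hdiff (L2 N H) \<Phi> \<Psi>) = 0 \<longleftrightarrow> (AE y in N. hdist (\<Phi> y) (\<Psi> y) = 0)"
  using hnorm_L2_AE_0[OF prehilb.diff_closed[OF prehilb_L2 assms]] by simp

lemma nn_hdist_L2:
  assumes "\<Phi> \<in> carr (L2 N H)" "\<Psi> \<in> carr (L2 N H)"
  shows "ennreal ((hnorm (L2 N H) (hdiff (L2 N H) \<Phi> \<Psi>))\<^sup>2)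
       = (\<integral>\<^sup>+y. ennreal ((hdist (\<Phi> y) (\<Psi> y))\<^sup>2) \<partial>N)"
  using nn_hnorm_L2[OF prehilb.diff_closed[OF prehilb_L2 assms]] by simp

lemma Cauchy_of_summable:
  assumes u: "\<And>n. u n \<in> carr H" and s: "summable (\<lambda>n. hdist (u n) (u (Suc n)))" and e: "e > 0"
  shows "\<exists>M. \<forall>m\<ge>M. \<forall>n\<ge>M. hdist (u m) (u n) < e"
proof -
  let ?g = "\<lambda>n. hdist (u n) (u (Suc n))"
  have step: "hdist (u m) (u n) \<le> sum ?g {m..<n}" if "m \<le> n" for m n
    using that
  proof (induction n rule: dec_induct)
    case (step n)
    have "hdist (u m) (u (Suc n)) \<le> hdist (u m) (u n) + ?g n" by (rule hdist_triangle[OF u u u])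
    also have "\<dots> \<le> sum ?g {m..<Suc n}" using step by simp
    finally show ?case .
  qed (simp add: u)
  obtain M where M: "\<And>m n. m \<ge> M \<Longrightarrow> norm (sum ?g {m..<n}) < e"
    using s e unfolding summable_Cauchy by blast
  have "hdist (u m) (u n) < e" if "m \<ge> M" "n \<ge> M" for m n
  proof (cases "m \<le> n")
    case True
    then show ?thesis using step[OF True] M[OF that(1), of n] by simp
  next
    case False
    then show ?thesis
      using step[of n m] M[OF that(2), of m] hdist_commute[OF u u, of m n] by simp
  qed
  then show ?thesis by blast
qed

text \<open>Riesz--Fischer: a subsequence with geometrically decaying increments converges almost
  everywhere, and Fatou's lemma turns pointwise into norm convergence.\<close>

theorem hcomplete_L2:
  assumes complete: "hcomplete H"
  shows "hcomplete (L2 N H)"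
  unfolding hcomplete_def
proof (intro allI impI, elim conjE)
  interpret L: prehilb "L2 N H" by (rule prehilb_L2)
  fix u :: "nat \<Rightarrow> _"
  assume u: "\<forall>n. u n \<in> carr (L2 N H)"
    and Cauchy: "\<forall>e>0. \<exists>M. \<forall>m\<ge>M. \<forall>n\<ge>M. L.hdist (u m) (u n) < e"
  have u: "u n \<in> carr (L2 N H)" for n using u by blast
  have uy: "u n y \<in> carr H" if "y \<in> space N" for n y using L2_carrD(1)[OF u that] .
  have "\<exists>M. \<forall>m\<ge>M. \<forall>n\<ge>M. L.hdist (u m) (u n) < (1/4) ^ j" for j :: nat
    using Cauchy by simp
  then obtain M where M: "\<And>j m n. m \<ge> M j \<Longrightarrow> n \<ge> M j \<Longrightarrow> L.hdist (u m) (u n) < (1/4) ^ j"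
    by metis
  \<comment> \<open>The sum makes \<open>r\<close> nondecreasing and at least \<open>M j\<close>, so
    all indices from \<open>r j\<close> on are within \<open>(1/4) ^ j\<close> of each
    other.\<close>
  define r where "r j = j + (\<Sum>i\<le>j. M i)" for j
  have r_ge: "j \<le> r j" "M j \<le> r j" for j
    unfolding r_def by (auto intro: trans_le_add2 member_le_sum)
  have r_mono: "r i \<le> r j" if "i \<le> j" for i j
    unfolding r_def using that by (intro add_mono sum_mono2) auto
  define g where "g j y = hdist (u (r j) y) (u (r (Suc j)) y)" for j y
  have g_meas [measurable]: "g j \<in> borel_measurable N" for j
    unfolding g_def by (rule L2_hdist_measurable[OF u u])
  \<comment> \<open>The weight \<open>4 ^ j\<close> balances two demands: the increments have
    squared norm at most \<open>(1/16) ^ j\<close>, so the weighted sum is still integrable; and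
    where it is finite, the increments are eventually at most \<open>(1/2) ^ j\<close>, hence
    summable.\<close>
  define E where "E = {y \<in> space N. (\<Sum>j. ennreal (4 ^ j * (g j y)\<^sup>2)) < \<infinity>}"
  have E_sets [measurable]: "E \<in> sets N" unfolding E_def by measurable
  have "(\<integral>\<^sup>+y. (\<Sum>j. ennreal (4 ^ j * (g j y)\<^sup>2)) \<partial>N) = (\<Sum>j. \<integral>\<^sup>+y. ennreal (4 ^ j * (g j y)\<^sup>2) \<partial>N)"
    by (intro nn_integral_suminf) measurable
  also have "\<dots> \<le> (\<Sum>j. ennreal ((1/4) ^ j))"
  proof (intro suminf_le summableI)
    fix j
    have "(\<integral>\<^sup>+y. ennreal (4 ^ j * (g j y)\<^sup>2) \<partial>N) = ennreal (4 ^ j) * (\<integral>\<^sup>+y. ennreal ((g j y)\<^sup>2) \<partial>N)"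
      by (simp add: ennreal_mult nn_integral_cmult)
    also have "\<dots> = ennreal (4 ^ j * (L.hdist (u (r j)) (u (r (Suc j))))\<^sup>2)"
      using nn_hdist_L2[OF u u] by (simp add: g_def ennreal_mult)
    also have "\<dots> \<le> ennreal (4 ^ j * ((1/4) ^ j)\<^sup>2)"
    proof (intro ennreal_leI mult_left_mono power_mono)
      show "L.hdist (u (r j)) (u (r (Suc j))) \<le> (1/4) ^ j"
        using M[of j "r j" "r (Suc j)"] r_ge(2)[of j] r_mono[of j "Suc j"] by simp
    qed (simp_all add: L.closed_rules u del: hdiff_L2)
    also have "4 ^ j * ((1/4) ^ j)\<^sup>2 = ((1/4::real) ^ j)"
      by (simp add: power2_eq_square flip: power_mult_distrib mult.assoc)
    finally show "(\<integral>\<^sup>+y. ennreal (4 ^ j * (g j y)\<^sup>2) \<partial>N) \<le> ennreal ((1/4) ^ j)" .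
  qed
  also have "\<dots> < \<infinity>"
    using summable_geometric[of "1/4::real"] by (simp add: suminf_ennreal2 less_top)
  finally have "AE y in N. (\<Sum>j. ennreal (4 ^ j * (g j y)\<^sup>2)) \<noteq> \<infinity>"
    by (intro nn_integral_noteq_infinite) auto
  then have AE_E: "AE y in N. y \<in> E"
    by (rule AE_mp) (auto simp: E_def less_top)
  have lim: "\<exists>x\<in>carr H. (\<lambda>j. hdist (u (r j) y) x) \<longlonglongrightarrow> 0" if y: "y \<in> E" for y
  proof -
    have yN: "y \<in> space N" using y by (simp add: E_def)
    have "summable (\<lambda>j. 4 ^ j * (g j y)\<^sup>2)"
      using y by (intro summable_suminf_not_top) (auto simp: E_def less_top)
    then have "\<forall>\<^sub>F j in sequentially. 4 ^ j * (g j y)\<^sup>2 < 1"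
      by (intro order_tendstoD(2)[OF summable_LIMSEQ_zero]) auto
    then have "\<forall>\<^sub>F j in sequentially. norm (g j y) \<le> (1/2) ^ j"
    proof eventually_elim
      case (elim j)
      have "(g j y)\<^sup>2 \<le> ((1/2) ^ j)\<^sup>2"
      proof -
        have "((1/2) ^ j)\<^sup>2 = 1 / (4::real) ^ j"
          by (simp add: power_divide power2_eq_square flip: power_mult_distrib)
        then show ?thesis using elim by (simp add: pos_le_divide_eq mult.commute)
      qed
      then show ?case using power2_le_imp_le[of "\<bar>g j y\<bar>" "(1/2) ^ j"] by simp
    qed
    then have "summable (\<lambda>j. g j y)"
      by (rule summable_comparison_test_ev) (simp add: summable_geometric)
    then have "\<exists>M. \<forall>m\<ge>M. \<forall>n\<ge>M. hdist (u (r m) y) (u (r n) y) < e" if "e > 0" for e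
      unfolding g_def by (intro Cauchy_of_summable uy yN that)
    then show ?thesis
      using complete uy[OF yN] unfolding hcomplete_def by simp
  qed
  obtain x0 where x0: "x0 \<in> carr H" using carr_ne by blast
  \<comment> \<open>Off the null set where convergence may fail the value is a vector of norm 0,
    which keeps inner products and norms measurable.\<close>
  define \<Phi> where "\<Phi> y = (if y \<in> E then SOME x. x \<in> carr H \<and> (\<lambda>j. hdist (u (r j) y) x) \<longlonglongrightarrow> 0
    else hscale H 0 x0)" for y
  have \<Phi>E: "\<Phi> y \<in> carr H \<and> (\<lambda>j. hdist (u (r j) y) (\<Phi> y)) \<longlonglongrightarrow> 0" if "y \<in> E" for y
    using that someI_ex[of "\<lambda>x. x \<in> carr H \<and> (\<lambda>j. hdist (u (r j) y) x) \<longlonglongrightarrow> 0"] lim[OF that]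
    by (auto simp: \<Phi>_def)
  have \<Phi>c: "\<Phi> y \<in> carr H" for y
    using \<Phi>E[of y] x0 by (cases "y \<in> E") (simp_all add: \<Phi>_def closed_rules)
  have \<Phi>m: "(\<lambda>y. hinner H (\<Phi> y) h) \<in> borel_measurable N" if h: "h \<in> carr H" for h
  proof (rule borel_measurable_LIMSEQ_metric)
    have [measurable]: "(\<lambda>y. hinner H (u (r j) y) h) \<in> borel_measurable N" for j
      using L2_carrD(2)[OF u h] .
    show "(\<lambda>y. if y \<in> E then hinner H (u (r j) y) h else 0) \<in> borel_measurable N" for j
      by measurable
    show "(\<lambda>j. if y \<in> E then hinner H (u (r j) y) h else 0) \<longlonglongrightarrow> hinner H (\<Phi> y) h" if "y \<in> space N" for y
    proof (cases "y \<in> E")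
      case True
      then show ?thesis
        using \<Phi>E[OF True] uy[OF that] h by (simp add: inner_tendsto)
    next
      case False
      then show ?thesis using x0 h by (simp add: \<Phi>_def inner_rules)
    qed
  qed
  have \<Phi>n: "(\<lambda>y. hnorm H (\<Phi> y)) \<in> borel_measurable N"
  proof (rule borel_measurable_LIMSEQ_metric)
    note [measurable] = L2_hnorm_measurable[OF u]
    show "(\<lambda>y. if y \<in> E then hnorm H (u (r j) y) else 0) \<in> borel_measurable N" for j
      by measurable
    show "(\<lambda>j. if y \<in> E then hnorm H (u (r j) y) else 0) \<longlonglongrightarrow> hnorm H (\<Phi> y)" if "y \<in> space N" for y
    proof (cases "y \<in> E")
      case True
      then show ?thesis
        using \<Phi>E[OF True] uy[OF that] by (simp add: hnorm_tendsto)
    next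
      case False
      then show ?thesis using x0 by (simp add: \<Phi>_def hnorm_scale)
    qed
  qed
  have dm: "(\<lambda>y. hdist (u j y) (\<Phi> y)) \<in> borel_measurable N" for j
  proof -
    have [measurable]: "(\<lambda>y. hinner H (u j y) (\<Phi> y)) \<in> borel_measurable N"
      using \<Phi>n \<Phi>c \<Phi>m L2_carrD(1,2)[OF u] by (intro inner_measurable) auto
    note [measurable] = \<Phi>n L2_hnorm_measurable[OF u]
    have "(\<lambda>y. sqrt ((hnorm H (u j y))\<^sup>2 + (hnorm H (\<Phi> y))\<^sup>2 - 2 * Re (hinner H (u j y) (\<Phi> y)))) \<in> borel_measurable N"
      by measurable
    then show ?thesis
      by (rule measurable_cong[THEN iffD1, rotated])
         (use uy \<Phi>c in \<open>simp add: closed_rules flip: hnorm_diff_power2\<close>)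
  qed
  have fatou: "(\<integral>\<^sup>+y. ennreal ((hdist (u n y) (\<Phi> y))\<^sup>2) \<partial>N) \<le> ennreal (((1/4) ^ j)\<^sup>2)"
    if n: "n \<ge> M j" for n j
  proof -
    have "(\<integral>\<^sup>+y. ennreal ((hdist (u n y) (\<Phi> y))\<^sup>2) \<partial>N)
        \<le> (\<integral>\<^sup>+y. liminf (\<lambda>k. ennreal ((hdist (u n y) (u (r k) y))\<^sup>2)) \<partial>N)"
    proof (rule nn_integral_mono_AE, use AE_E in eventually_elim)
      fix y assume y: "y \<in> E"
      then have yN: "y \<in> space N" by (simp add: E_def)
      have lim: "(\<lambda>k. hdist (u n y) (u (r k) y)) \<longlonglongrightarrow> hdist (u n y) (\<Phi> y)"
      proof (rule LIM_zero_cancel, rule Lim_null_comparison)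
        show "\<forall>\<^sub>F k in sequentially. norm (hdist (u n y) (u (r k) y) - hdist (u n y) (\<Phi> y)) \<le> hdist (u (r k) y) (\<Phi> y)"
        proof (rule always_eventually, rule allI)
          fix k
          have "hdist (u n y) (u (r k) y) \<le> hdist (u n y) (\<Phi> y) + hdist (\<Phi> y) (u (r k) y)"
            "hdist (u n y) (\<Phi> y) \<le> hdist (u n y) (u (r k) y) + hdist (u (r k) y) (\<Phi> y)"
            using uy[OF yN] \<Phi>c by (auto intro!: hdist_triangle)
          then show "norm (hdist (u n y) (u (r k) y) - hdist (u n y) (\<Phi> y)) \<le> hdist (u (r k) y) (\<Phi> y)"
            using hdist_commute[OF \<Phi>c uy[OF yN], of y "r k"] by (simp add: abs_le_iff)
        qed
      qed (use \<Phi>E[OF y] in blast)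
      have "(\<lambda>k. ennreal ((hdist (u n y) (u (r k) y))\<^sup>2)) \<longlonglongrightarrow> ennreal ((hdist (u n y) (\<Phi> y))\<^sup>2)"
        by (intro tendsto_ennrealI tendsto_power lim)
      then show "ennreal ((hdist (u n y) (\<Phi> y))\<^sup>2) \<le> liminf (\<lambda>k. ennreal ((hdist (u n y) (u (r k) y))\<^sup>2))"
        using lim_imp_Liminf[OF sequentially_bot] by fastforce
    qed
    also have "\<dots> \<le> liminf (\<lambda>k. \<integral>\<^sup>+y. ennreal ((hdist (u n y) (u (r k) y))\<^sup>2) \<partial>N)"
      using L2_hdist_measurable[OF u u] by (intro nn_integral_liminf) measurable
    also have "\<dots> \<le> ennreal (((1/4) ^ j)\<^sup>2)"
    proof (rule Liminf_le)
      show "\<forall>\<^sub>F k in sequentially. (\<integral>\<^sup>+y. ennreal ((hdist (u n y) (u (r k) y))\<^sup>2) \<partial>N) \<le> ennreal (((1/4) ^ j)\<^sup>2)"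
        using eventually_ge_at_top[of j]
      proof eventually_elim
        case (elim k)
        have "L.hdist (u n) (u (r k)) \<le> (1/4) ^ j"
          using M[OF n, of "r k"] r_ge(2)[of j] r_mono[OF elim] by simp
        then show ?case
          unfolding nn_hdist_L2[OF u u, symmetric]
          by (intro ennreal_leI power_mono) (simp_all add: L.closed_rules u del: hdiff_L2)
      qed
    qed simp
    finally show ?thesis .
  qed
  have \<Phi>L: "\<Phi> \<in> carr (L2 N H)"
    unfolding L2_carr_iff
  proof (intro conjI ballI \<Phi>c \<Phi>m)
    let ?n = "M 0"
    note [measurable] = \<Phi>n dm
    have "integrable N (\<lambda>y. (hdist (u ?n y) (\<Phi> y))\<^sup>2)"
      using fatou[of 0 ?n] by (intro integrableI_bounded) (auto intro: le_less_trans)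
    then have "integrable N (\<lambda>y. 2 * (hnorm H (u ?n y))\<^sup>2 + 2 * (hdist (u ?n y) (\<Phi> y))\<^sup>2)"
      using L2_carrD(3)[OF u[of ?n]] by auto
    then show "integrable N (\<lambda>y. (hnorm H (\<Phi> y))\<^sup>2)"
    proof (rule Bochner_Integration.integrable_bound)
      show "(\<lambda>y. (hnorm H (\<Phi> y))\<^sup>2) \<in> borel_measurable N" by measurable
      show "AE y in N. norm ((hnorm H (\<Phi> y))\<^sup>2) \<le> norm (2 * (hnorm H (u ?n y))\<^sup>2 + 2 * (hdist (u ?n y) (\<Phi> y))\<^sup>2)"
      proof (rule AE_I2)
        fix y assume y: "y \<in> space N"
        \<comment> \<open>\<open>\<Phi>\<close> is written as \<open>u - (u - \<Phi>)\<close>, a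
          difference of two functions already known to be square-integrable.\<close>
        have "hnorm H (\<Phi> y) = hdist (u ?n y) (hdiff H (u ?n y) (\<Phi> y))"
          using uy[OF y] \<Phi>c by (intro hnorm_cong) (auto simp: closed_rules inner_rules)
        then show "norm ((hnorm H (\<Phi> y))\<^sup>2) \<le> norm (2 * (hnorm H (u ?n y))\<^sup>2 + 2 * (hdist (u ?n y) (\<Phi> y))\<^sup>2)"
          using hdist_power2_le[of "u ?n y" "hdiff H (u ?n y) (\<Phi> y)"] uy[OF y] \<Phi>c
          by (simp add: closed_rules)
      qed
    qed
  qed
  have "(\<lambda>n. L.hdist (u n) \<Phi>) \<longlonglongrightarrow> 0"
  proof (rule LIMSEQ_I)
    fix e :: real assume "e > 0"
    then obtain j where j: "(1/4) ^ j < e" using real_arch_pow_inv[of e "1/4"] by auto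
    have "norm (L.hdist (u n) \<Phi> - 0) < e" if "n \<ge> M j" for n
    proof -
      have "ennreal ((L.hdist (u n) \<Phi>)\<^sup>2) \<le> ennreal (((1/4) ^ j)\<^sup>2)"
        unfolding nn_hdist_L2[OF u \<Phi>L] by (rule fatou[OF that])
      then have "(L.hdist (u n) \<Phi>)\<^sup>2 \<le> ((1/4) ^ j)\<^sup>2"
        by (simp add: ennreal_le_iff)
      then have "L.hdist (u n) \<Phi> \<le> (1/4) ^ j"
        by (rule power2_le_imp_le) simp
      then show ?thesis using j L.hnorm_nonneg[OF L.diff_closed[OF u \<Phi>L], of n] by simp
    qed
    then show "\<exists>no. \<forall>n\<ge>no. norm (L.hdist (u n) \<Phi> - 0) < e" by blast
  qed
  then show "\<exists>x\<in>carr (L2 N H). (\<lambda>n. L.hdist (u n) x) \<longlonglongrightarrow> 0"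
    using \<Phi>L by blast
qed

end

section \<open>Scalars and finite direct sums\<close>

lemma scalars_simps [simp]:
  "carr scalars = UNIV" "hadd scalars = (+)" "hscale scalars = (*)"
  "hinner scalars = (\<lambda>z w. z * cnj w)" "hdiff scalars = (-)" "hnorm scalars = cmod"
  by (auto simp: scalars_def hdiff_def hnorm_def fun_eq_iff complex_mult_cnj cmod_def)

lemma prehilb_scalars: "prehilb scalars"
  by unfold_locales (auto simp: algebra_simps complex_mult_cnj)

lemma separable_prehilb_scalars: "separable_prehilb scalars"
proof (intro separable_prehilb.intro separable_prehilb_axioms.intro prehilb_scalars)
  obtain D :: "complex set" where D: "countable D" "\<And>X. open X \<Longrightarrow> X \<noteq> {} \<Longrightarrow> \<exists>d\<in>D. d \<in> X"
    using countable_dense_exists by blast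
  have "\<exists>d\<in>D. cmod (x - d) < e" if "e > 0" for x e
    using D(2)[of "ball x e"] that by (auto simp: dist_norm)
  then show "hseparable scalars"
    unfolding hseparable_def using D(1) by (intro exI[of _ D]) auto
qed

lemma hcomplete_scalars: "hcomplete scalars"
  unfolding hcomplete_def
proof (intro allI impI, elim conjE)
  fix u :: "nat \<Rightarrow> complex"
  assume "\<forall>e>0. \<exists>M. \<forall>m\<ge>M. \<forall>n\<ge>M. hnorm scalars (hdiff scalars (u m) (u n)) < e"
  then have "Cauchy u" by (simp add: Cauchy_def dist_norm)
  then obtain x where "u \<longlonglongrightarrow> x" using Cauchy_convergent convergent_def by blast
  then have "(\<lambda>n. cmod (u n - x)) \<longlonglongrightarrow> 0" using LIM_zero tendsto_norm_zero by blast
  then show "\<exists>x\<in>carr scalars. (\<lambda>n. hnorm scalars (hdiff scalars (u n) x)) \<longlonglongrightarrow> 0" by auto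
qed

lemma hpower_simps:
  "carr (hpower n H) = {F. \<forall>i<n. F i \<in> carr H}"
  "hadd (hpower n H) = (\<lambda>F G i. hadd H (F i) (G i))"
  "hscale (hpower n H) = (\<lambda>c F i. hscale H c (F i))"
  "hdiff (hpower n H) = (\<lambda>F G i. hdiff H (F i) (G i))"
  "hinner (hpower n H) = (\<lambda>F G. \<Sum>i<n. hinner H (F i) (G i))"
  by (auto simp: hpower_def hdiff_def fun_eq_iff)

context prehilb begin

lemma prehilb_hpower: "prehilb (hpower n H)"
proof
  obtain x where "x \<in> carr H" using carr_ne by blast
  then have "(\<lambda>_. x) \<in> carr (hpower n H)" by (simp add: hpower_simps)
  then show "carr (hpower n H) \<noteq> {}" by blast
next
  fix F G assume c: "F \<in> carr (hpower n H)" "G \<in> carr (hpower n H)"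
  then have "hinner H (G i) (F i) = cnj (hinner H (F i) (G i))" if "i < n" for i
    using that by (intro inner_commute) (auto simp: hpower_simps)
  then show "hinner (hpower n H) G F = cnj (hinner (hpower n H) F G)"
    by (simp add: hpower_simps)
next
  fix F assume "F \<in> carr (hpower n H)"
  then show "0 \<le> Re (hinner (hpower n H) F F)"
    by (auto simp: hpower_simps intro!: sum_nonneg inner_pos)
qed (auto simp: hpower_simps closed_rules inner_rules sum.distrib sum_distrib_left)

lemma hnorm_hpower:
  assumes "F \<in> carr (hpower n H)"
  shows "(hnorm (hpower n H) F)\<^sup>2 = (\<Sum>i<n. (hnorm H (F i))\<^sup>2)"
  using assms prehilb.hnorm_power2[OF prehilb_hpower assms]
  by (simp add: hpower_simps hnorm_power2)

lemma hnorm_hpower_0: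
  assumes "F \<in> carr (hpower n H)"
  shows "hnorm (hpower n H) F = 0 \<longleftrightarrow> (\<forall>i<n. hnorm H (F i) = 0)"
proof -
  have "hnorm (hpower n H) F = 0 \<longleftrightarrow> (\<Sum>i<n. (hnorm H (F i))\<^sup>2) = 0"
    using hnorm_hpower[OF assms] by auto
  then show ?thesis by (simp add: sum_nonneg_eq_0_iff Ball_def)
qed

lemma hdist_hpower_0:
  assumes "F \<in> carr (hpower n H)" "G \<in> carr (hpower n H)"
  shows "hnorm (hpower n H) (hdiff (hpower n H) F G) = 0 \<longleftrightarrow> (\<forall>i<n. hdist (F i) (G i) = 0)"
  using hnorm_hpower_0[OF prehilb.diff_closed[OF prehilb_hpower assms]] by (simp add: hpower_simps)

lemma hnorm_0_subspace:
  assumes "hnorm H x = 0" "hnorm H y = 0" "x \<in> carr H" "y \<in> carr H"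
  shows "hnorm H (hadd H x y) = 0"
  using hnorm_triangle[OF assms(3,4)] hnorm_nonneg[OF add_closed[OF assms(3,4)]] assms(1,2) by linarith

lemma inner_hnorm_0:
  assumes "hnorm H x = 0 \<or> hnorm H y = 0" "x \<in> carr H" "y \<in> carr H"
  shows "hinner H x y = 0"
  using Cauchy_Schwarz[OF assms(2,3)] assms(1) by auto

lemma hdist_component_le:
  assumes "F \<in> carr (hpower n H)" "G \<in> carr (hpower n H)" "i < n"
  shows "hdist (F i) (G i) \<le> hnorm (hpower n H) (hdiff (hpower n H) F G)"
proof (rule power2_le_imp_le)
  interpret P: prehilb "hpower n H" by (rule prehilb_hpower)
  show "0 \<le> P.hdist F G" by (intro P.hnorm_nonneg P.diff_closed assms)
  have "(hdist (F i) (G i))\<^sup>2 \<le> (\<Sum>j<n. (hdist (F j) (G j))\<^sup>2)"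
    using assms(3) by (intro member_le_sum) auto
  also have "\<dots> = (P.hdist F G)\<^sup>2"
    using hnorm_hpower[OF P.diff_closed[OF assms(1,2)]] by (simp add: hpower_simps)
  finally show "(hdist (F i) (G i))\<^sup>2 \<le> (P.hdist F G)\<^sup>2" .
qed

end

text \<open>Tuples with entries in a countable dense set are dense. Only extensional tuples are
  taken, as the entries from index \<open>n\<close> on are arbitrary and could make the set
  uncountable.\<close>

lemma (in separable_prehilb) separable_prehilb_hpower: "separable_prehilb (hpower n H)"
proof (intro separable_prehilb.intro separable_prehilb_axioms.intro prehilb_hpower)
  interpret P: prehilb "hpower n H" by (rule prehilb_hpower)
  obtain D where D: "countable D" "D \<subseteq> carr H"
    "\<And>x e. x \<in> carr H \<Longrightarrow> e > 0 \<Longrightarrow> \<exists>d\<in>D. hdist x d < e"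
    using separable unfolding hseparable_def by blast
  have "\<exists>d\<in>Pi\<^sub>E {..<n} (\<lambda>_. D). P.hdist F d < e" if F: "F \<in> carr (hpower n H)" and e: "e > 0" for F e
  proof -
    \<comment> \<open>The squared distance is at most \<open>n\<close> times
      \<open>e'\<^sup>2\<close>, which stays strictly below \<open>e\<^sup>2\<close>; dividing by
      \<open>n + 1\<close> also covers \<open>n = 0\<close>.\<close>
    define e' where "e' = e / (real n + 1)"
    have e': "e' > 0" using e by (simp add: e'_def)
    have "\<forall>i\<in>{..<n}. \<exists>d. d \<in> D \<and> hdist (F i) d < e'"
      using D(3)[OF _ e'] F by (auto simp: hpower_simps)
    then obtain d where d: "\<And>i. i < n \<Longrightarrow> d i \<in> D \<and> hdist (F i) (d i) < e'"
      unfolding bchoice_iff by auto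
    let ?d = "restrict d {..<n}"
    have dc: "?d \<in> carr (hpower n H)" using d D(2) by (auto simp: hpower_simps)
    have "(P.hdist F ?d)\<^sup>2 = (\<Sum>i<n. (hdist (F i) (d i))\<^sup>2)"
      using hnorm_hpower[OF P.diff_closed[OF F dc]] by (simp add: hpower_simps)
    also have "\<dots> \<le> (\<Sum>i<n. e'\<^sup>2)"
      using d F D(2) by (intro sum_mono power_mono) (force simp: hpower_simps closed_rules)+
    also have "\<dots> = real n * e'\<^sup>2" by simp
    also have "\<dots> < (real n + 1)\<^sup>2 * e'\<^sup>2"
      using e' by (intro mult_strict_right_mono) (auto simp: power2_eq_square algebra_simps add_pos_nonneg)
    also have "\<dots> = e\<^sup>2" by (simp add: e'_def power_divide)
    finally have "P.hdist F ?d < e" using e by (intro power2_less_imp_less[of _ e]) auto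
    moreover have "?d \<in> Pi\<^sub>E {..<n} (\<lambda>_. D)" using d by auto
    ultimately show ?thesis by blast
  qed
  moreover have "countable (Pi\<^sub>E {..<n} (\<lambda>_. D))" using D(1) by (intro countable_PiE) auto
  moreover have "Pi\<^sub>E {..<n} (\<lambda>_. D) \<subseteq> carr (hpower n H)"
    using D(2) by (auto simp: hpower_simps PiE_def Pi_def)
  ultimately show "hseparable (hpower n H)" unfolding hseparable_def by blast
qed

lemma prehilb_L2_scalars: "prehilb (L2 N scalars)"
  using separable_prehilb.prehilb_L2[OF separable_prehilb_scalars] .

lemma hcomplete_L2_scalars: "hcomplete (L2 N scalars)"
  using separable_prehilb.hcomplete_L2[OF separable_prehilb_scalars hcomplete_scalars] .

lemma L2_scalars_restrict:
  assumes "f \<in> carr (L2 \<mu> scalars)" "C \<in> sets \<mu>"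
  shows "f \<in> carr (L2_tile \<mu> C)"
  using assms
  using integrable_mult_indicator[OF assms(2), of "\<lambda>x. (cmod (f x))\<^sup>2"]
  by (auto simp: carr_L2_scalars integrable_restrict_space intro!: measurable_restrict_space1)

lemma hnorm_L2_tile:
  assumes "f \<in> carr (L2_tile \<mu> C)" "C \<in> sets \<mu>"
  shows "ennreal ((hnorm (L2_tile \<mu> C) f)\<^sup>2) = (\<integral>\<^sup>+x\<in>C. ennreal ((cmod (f x))\<^sup>2) \<partial>\<mu>)"
  using separable_prehilb.nn_hnorm_L2[OF separable_prehilb_scalars assms(1)] assms(2)
  by (simp add: nn_integral_restrict_space)

text \<open>The restrictions of a countable dense set of the big space are dense: a function on the
  tile is extended by zero, approximated, and restricted again, which does not increase
  distances.\<close>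

lemma separable_prehilb_L2_tile:
  assumes "hseparable (L2 \<mu> scalars)" and C: "C \<in> sets \<mu>"
  shows "separable_prehilb (L2_tile \<mu> C)"
proof (intro separable_prehilb.intro separable_prehilb_axioms.intro prehilb_L2_scalars)
  interpret X: prehilb "L2 \<mu> scalars" by (rule prehilb_L2_scalars)
  interpret T: prehilb "L2_tile \<mu> C" by (rule prehilb_L2_scalars)
  obtain D where D: "countable D" "D \<subseteq> carr (L2 \<mu> scalars)"
    "\<And>x e. x \<in> carr (L2 \<mu> scalars) \<Longrightarrow> e > 0 \<Longrightarrow> \<exists>d\<in>D. X.hdist x d < e"
    using assms(1) unfolding hseparable_def by blast
  have "\<exists>d\<in>D. T.hdist f d < e" if f: "f \<in> carr (L2_tile \<mu> C)" and e: "e > 0" for f e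
  proof -
    define f' where "f' x = indicator C x *\<^sub>R f x" for x
    have CO: "C \<inter> space \<mu> \<in> sets \<mu>" using C by simp
    have "f' \<in> borel_measurable \<mu>"
      using f unfolding f'_def by (simp add: carr_L2_scalars borel_measurable_restrict_space_iff[OF CO])
    moreover have "integrable \<mu> (\<lambda>x. (cmod (f' x))\<^sup>2)"
    proof -
      have "(\<lambda>x. (cmod (f' x))\<^sup>2) = (\<lambda>x. indicator C x *\<^sub>R (cmod (f x))\<^sup>2)"
        by (auto simp: f'_def indicator_def fun_eq_iff)
      then show ?thesis
        using f CO by (simp add: carr_L2_scalars integrable_restrict_space)
    qed
    ultimately have f': "f' \<in> carr (L2 \<mu> scalars)" by (simp add: carr_L2_scalars)
    obtain d where d: "d \<in> D" "X.hdist f' d < e" using D(3)[OF f' e] by blast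
    then have dc: "d \<in> carr (L2 \<mu> scalars)" "d \<in> carr (L2_tile \<mu> C)"
      using D(2) L2_scalars_restrict[OF _ C] by auto
    have "ennreal ((T.hdist f d)\<^sup>2) = (\<integral>\<^sup>+x\<in>C. ennreal ((cmod (f x - d x))\<^sup>2) \<partial>\<mu>)"
      using hnorm_L2_tile[OF T.diff_closed[OF f dc(2)] C] by simp
    also have "\<dots> \<le> (\<integral>\<^sup>+x. ennreal ((cmod (f' x - d x))\<^sup>2) \<partial>\<mu>)"
      by (intro nn_integral_mono) (auto simp: f'_def indicator_def)
    also have "\<dots> = ennreal ((X.hdist f' d)\<^sup>2)"
      using separable_prehilb.nn_hdist_L2[OF separable_prehilb_scalars f' dc(1)] by simp
    finally have "(T.hdist f d)\<^sup>2 \<le> (X.hdist f' d)\<^sup>2" by (simp add: ennreal_le_iff)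
    then have "T.hdist f d \<le> X.hdist f' d"
      by (rule power2_le_imp_le) (rule X.hnorm_nonneg[OF X.diff_closed[OF f' dc(1)]])
    then show ?thesis using d by (intro bexI[of _ d]) auto
  qed
  moreover have "D \<subseteq> carr (L2_tile \<mu> C)" using D(2) L2_scalars_restrict[OF _ C] by blast
  ultimately show "hseparable (L2_tile \<mu> C)" unfolding hseparable_def using D(1) by blast
qed

section \<open>Quasi-invariant actions\<close>

locale quasi_action = sigma_finite_measure \<mu>
  for \<mu> :: "'x measure" +
  fixes \<sigma> :: "'g::{ab_group_add,countable} \<Rightarrow> 'x \<Rightarrow> 'x" and J :: "'g \<Rightarrow> 'x \<Rightarrow> real"
  assumes quasi: "quasi_invariant \<sigma> J \<mu>"
begin

lemma \<sigma>_measurable [measurable]: "\<sigma> g \<in> \<mu> \<rightarrow>\<^sub>M \<mu>"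
  and \<sigma>_comp: "x \<in> space \<mu> \<Longrightarrow> \<sigma> g (\<sigma> h x) = \<sigma> (g + h) x"
  and \<sigma>_0: "x \<in> space \<mu> \<Longrightarrow> \<sigma> 0 x = x"
  and J_pos: "x \<in> space \<mu> \<Longrightarrow> 0 < J g x"
  and emeasure_image: "A \<in> sets \<mu> \<Longrightarrow> emeasure \<mu> (\<sigma> g ` A) = (\<integral>\<^sup>+x\<in>A. ennreal (J g x) \<partial>\<mu>)"
  using quasi unfolding quasi_invariant_def measurable_action_def by blast+

lemma J_measurable [measurable]: "J g \<in> borel_measurable \<mu>"
proof -
  have "(\<lambda>(g, x). J g x) \<in> borel_measurable (count_space UNIV \<Otimes>\<^sub>M \<mu>)"
    using quasi by (simp add: quasi_invariant_def)
  from measurable_compose[OF measurable_Pair1'[of g "count_space UNIV" \<mu>] this]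
  show ?thesis by simp
qed

lemma \<sigma>_space: "x \<in> space \<mu> \<Longrightarrow> \<sigma> g x \<in> space \<mu>"
  using \<sigma>_measurable by (rule measurable_space)

text \<open>\<open>\<sigma> (- g)\<close> inverts \<open>\<sigma> g\<close> on the space. Images of
  measurable sets are therefore preimages, hence measurable.\<close>

lemma image_eq_vimage:
  assumes "A \<subseteq> space \<mu>"
  shows "\<sigma> g ` A = \<sigma> (- g) -` A \<inter> space \<mu>"
proof (intro set_eqI iffI)
  fix y assume "y \<in> \<sigma> g ` A"
  then obtain x where "x \<in> A" "y = \<sigma> g x" by blast
  then show "y \<in> \<sigma> (- g) -` A \<inter> space \<mu>"
    using assms by (auto simp: \<sigma>_comp \<sigma>_0 \<sigma>_space subset_iff)
next
  fix y assume y: "y \<in> \<sigma> (- g) -` A \<inter> space \<mu>"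
  then have "y = \<sigma> g (\<sigma> (- g) y)" by (simp add: \<sigma>_comp \<sigma>_0)
  then show "y \<in> \<sigma> g ` A" using y by blast
qed

lemma image_sets [measurable]: "A \<in> sets \<mu> \<Longrightarrow> \<sigma> g ` A \<in> sets \<mu>"
  using image_eq_vimage[OF sets.sets_into_space] measurable_sets[OF \<sigma>_measurable] by simp

text \<open>The Jacobian as a density: the push-forward under the inverse map
  \<open>\<sigma> (- g)\<close> assigns to \<open>A\<close> the measure of its image under
  \<open>\<sigma> g\<close>.\<close>

lemma distr_eq_density: "distr \<mu> \<mu> (\<sigma> (- g)) = density \<mu> (\<lambda>x. ennreal (J g x))"
proof (rule measure_eqI)
  fix A assume "A \<in> sets (distr \<mu> \<mu> (\<sigma> (- g)))"
  then have A: "A \<in> sets \<mu>" by simp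
  show "emeasure (distr \<mu> \<mu> (\<sigma> (- g))) A = emeasure (density \<mu> (\<lambda>x. ennreal (J g x))) A"
    using A emeasure_image[OF A, of g]
    by (simp add: emeasure_distr emeasure_density image_eq_vimage[OF sets.sets_into_space])
qed simp

lemma nn_integral_change:
  assumes [measurable]: "f \<in> borel_measurable \<mu>"
  shows "(\<integral>\<^sup>+x. ennreal (J g x) * f (\<sigma> g x) \<partial>\<mu>) = (\<integral>\<^sup>+x. f x \<partial>\<mu>)"
proof -
  have "(\<integral>\<^sup>+x. ennreal (J g x) * f (\<sigma> g x) \<partial>\<mu>) = (\<integral>\<^sup>+x. f (\<sigma> g x) \<partial>density \<mu> (\<lambda>x. ennreal (J g x)))"
    by (subst nn_integral_density) simp_all
  also have "\<dots> = (\<integral>\<^sup>+x. f (\<sigma> g (\<sigma> (- g) x)) \<partial>\<mu>)"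
    unfolding distr_eq_density[symmetric] by (subst nn_integral_distr) simp_all
  also have "\<dots> = (\<integral>\<^sup>+x. f x \<partial>\<mu>)"
    by (intro nn_integral_cong) (simp add: \<sigma>_comp \<sigma>_0)
  finally show ?thesis .
qed

lemma cocycle: "AE x in \<mu>. J (g + h) x = J g (\<sigma> h x) * J h x"
proof -
  have "density \<mu> (\<lambda>x. ennreal (J (g + h) x)) = density \<mu> (\<lambda>x. ennreal (J g (\<sigma> h x) * J h x))"
  proof (rule measure_eqI)
    fix A assume "A \<in> sets (density \<mu> (\<lambda>x. ennreal (J (g + h) x)))"
    then have A [measurable]: "A \<in> sets \<mu>" by simp
    then have AS: "A \<subseteq> space \<mu>" by (rule sets.sets_into_space)
    let ?f = "\<lambda>y. ennreal (J g y) * indicator (\<sigma> h ` A) y"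
    have "emeasure (density \<mu> (\<lambda>x. ennreal (J (g + h) x))) A = emeasure \<mu> (\<sigma> (g + h) ` A)"
      using A by (simp add: emeasure_density emeasure_image)
    also have "\<sigma> (g + h) ` A = \<sigma> g ` \<sigma> h ` A"
      using AS by (auto simp: image_image \<sigma>_comp subset_iff image_iff)
    also have "emeasure \<mu> (\<sigma> g ` \<sigma> h ` A) = (\<integral>\<^sup>+y. ?f y \<partial>\<mu>)"
      by (rule emeasure_image) measurable
    also have "\<dots> = (\<integral>\<^sup>+x. ennreal (J h x) * ?f (\<sigma> h x) \<partial>\<mu>)"
      by (rule nn_integral_change[symmetric]) measurable
    also have "\<dots> = (\<integral>\<^sup>+x. ennreal (J g (\<sigma> h x) * J h x) * indicator A x \<partial>\<mu>)"
    proof (rule nn_integral_cong)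
      fix x assume x: "x \<in> space \<mu>"
      then have "\<sigma> h x \<in> \<sigma> h ` A \<longleftrightarrow> x \<in> A"
        by (simp add: image_eq_vimage[OF AS] \<sigma>_comp \<sigma>_0 \<sigma>_space)
      then have "(indicator (\<sigma> h ` A) (\<sigma> h x) :: ennreal) = indicator A x"
        by (simp add: indicator_def)
      then show "ennreal (J h x) * ?f (\<sigma> h x) = ennreal (J g (\<sigma> h x) * J h x) * indicator A x"
        using J_pos[OF x] J_pos[OF \<sigma>_space[OF x]]
        by (simp add: ennreal_mult less_imp_le mult_ac)
    qed
    also have "\<dots> = emeasure (density \<mu> (\<lambda>x. ennreal (J g (\<sigma> h x) * J h x))) A"
      by (simp add: emeasure_density)
    finally show "emeasure (density \<mu> (\<lambda>x. ennreal (J (g + h) x))) A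
        = emeasure (density \<mu> (\<lambda>x. ennreal (J g (\<sigma> h x) * J h x))) A" .
  qed simp
  then have "AE x in \<mu>. ennreal (J (g + h) x) = ennreal (J g (\<sigma> h x) * J h x)"
    by (intro density_unique) auto
  then show ?thesis
    by (rule AE_mp) (intro AE_I2 impI, use J_pos \<sigma>_space in \<open>simp add: less_imp_le\<close>)
qed

abbreviation \<rho> where "\<rho> \<equiv> rep \<sigma> J"

lemma rep_measurable [measurable]:
  assumes [measurable]: "f \<in> borel_measurable \<mu>"
  shows "\<rho> g f \<in> borel_measurable \<mu>"
  unfolding rep_def by measurable

lemma norm_rep: "x \<in> space \<mu> \<Longrightarrow> (cmod (\<rho> g f x))\<^sup>2 = J (- g) x * (cmod (f (\<sigma> (- g) x)))\<^sup>2"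
  using J_pos[of x "- g"] by (simp add: rep_def norm_mult power_mult_distrib)

text \<open>The mass of \<open>\<rho> g f\<close> on \<open>A\<close> is that of \<open>f\<close> on
  the image of \<open>A\<close> under \<open>\<sigma> (- g)\<close>. For \<open>A = C\<close> and
  varying \<open>g\<close> these are the pieces of the tiling.\<close>

lemma nn_integral_rep:
  assumes [measurable]: "f \<in> borel_measurable \<mu>" "A \<in> sets \<mu>"
  shows "(\<integral>\<^sup>+x\<in>A. ennreal ((cmod (\<rho> g f x))\<^sup>2) \<partial>\<mu>)
    = (\<integral>\<^sup>+x. ennreal ((cmod (f x))\<^sup>2) * indicator A (\<sigma> g x) \<partial>\<mu>)"
proof -
  let ?f = "\<lambda>y. ennreal ((cmod (f y))\<^sup>2) * indicator A (\<sigma> g y)"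
  have "(\<integral>\<^sup>+x\<in>A. ennreal ((cmod (\<rho> g f x))\<^sup>2) \<partial>\<mu>) = (\<integral>\<^sup>+x. ennreal (J (- g) x) * ?f (\<sigma> (- g) x) \<partial>\<mu>)"
    by (intro nn_integral_cong)
       (simp add: norm_rep J_pos less_imp_le ennreal_mult \<sigma>_comp \<sigma>_0 mult_ac)
  also have "\<dots> = (\<integral>\<^sup>+x. ?f x \<partial>\<mu>)"
    by (rule nn_integral_change) measurable
  finally show ?thesis .
qed

lemma rep_carr:
  assumes f: "f \<in> carr (L2 \<mu> scalars)"
  shows "\<rho> g f \<in> carr (L2 \<mu> scalars)"
proof -
  have [measurable]: "f \<in> borel_measurable \<mu>" using f by (simp add: carr_L2_scalars)
  have "(\<integral>\<^sup>+x. ennreal ((cmod (\<rho> g f x))\<^sup>2) \<partial>\<mu>) = (\<integral>\<^sup>+x\<in>space \<mu>. ennreal ((cmod (\<rho> g f x))\<^sup>2) \<partial>\<mu>)"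
    by (intro nn_integral_cong) simp
  also have "\<dots> = (\<integral>\<^sup>+x. ennreal ((cmod (f x))\<^sup>2) \<partial>\<mu>)"
    by (subst nn_integral_rep) (auto intro!: nn_integral_cong simp: \<sigma>_space)
  also have "\<dots> < \<infinity>"
    using f by (simp add: carr_L2_scalars nn_integral_eq_integral)
  finally show ?thesis
    by (simp add: carr_L2_scalars integrable_iff_bounded)
qed

text \<open>Inherits the exceptional null set of \<open>cocycle\<close>, so the representation
  property can be used for classes of functions but not at a prescribed point.\<close>

lemma rep_rep: "AE x in \<mu>. \<rho> g (\<rho> h f) x = \<rho> (g + h) f x"
proof -
  have "AE x in \<mu>. J (- h + - g) x = J (- h) (\<sigma> (- g) x) * J (- g) x" by (rule cocycle)
  then show ?thesis
    by (rule AE_mp) (intro AE_I2 impI, simp add: rep_def \<sigma>_comp real_sqrt_mult mult_ac add_ac)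
qed

end

section \<open>The Zak transform\<close>

locale zak_setting = quasi_action \<mu> \<sigma> J + haar m
  for \<mu> :: "'x measure" and \<sigma> :: "'g::{ab_group_add,countable} \<Rightarrow> 'x \<Rightarrow> 'x"
    and J :: "'g \<Rightarrow> 'x \<Rightarrow> real" and m :: "'g dual measure" +
  fixes C :: "'x set"
  assumes tiling: "tiling_set \<sigma> \<mu> C" and separable_X: "hseparable (L2 \<mu> scalars)"
begin

abbreviation X where "X \<equiv> L2 \<mu> scalars"
abbreviation L where "L \<equiv> L2_tile \<mu> C"
abbreviation K where "K \<equiv> L2 m L"

lemma C_sets [measurable]: "C \<in> sets \<mu>"
  using tiling by (simp add: tiling_set_def)

text \<open>Almost every orbit meets the tile exactly once. The group is countable, so the null sets
  for all pairs of group elements can be discarded together.\<close>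

lemma tiling_AE: "AE x in \<mu>. \<exists>!\<tau>. \<sigma> \<tau> x \<in> C"
proof -
  have CS: "C \<subseteq> space \<mu>" using C_sets by (rule sets.sets_into_space)
  have sub: "(\<Union>g. \<sigma> g ` C) \<in> sets \<mu>" by (intro sets.countable_UN') auto
  have mem: "x \<in> \<sigma> g ` C \<longleftrightarrow> \<sigma> (- g) x \<in> C" if "x \<in> space \<mu>" for x g
    using that by (simp add: image_eq_vimage[OF CS])
  have "AE x in \<mu>. x \<notin> space \<mu> - (\<Union>g. \<sigma> g ` C)"
    using tiling sub by (intro AE_not_in) (auto simp: tiling_set_def null_sets_def)
  moreover have "AE x in \<mu>. \<forall>g h. g \<noteq> h \<longrightarrow> x \<notin> \<sigma> g ` C \<inter> \<sigma> h ` C"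
    unfolding AE_all_countable
  proof (intro allI)
    fix g h
    show "AE x in \<mu>. g \<noteq> h \<longrightarrow> x \<notin> \<sigma> g ` C \<inter> \<sigma> h ` C"
    proof (cases "g = h")
      case False
      then have "\<sigma> g ` C \<inter> \<sigma> h ` C \<in> null_sets \<mu>"
        using tiling by (auto simp: tiling_set_def null_sets_def)
      from AE_not_in[OF this] show ?thesis by (rule AE_mp) simp
    qed simp
  qed
  ultimately show ?thesis
  proof (rule AE_mp[OF _ AE_mp[OF _ AE_I2]], intro impI)
    fix x assume x: "x \<in> space \<mu>" and 1: "x \<notin> space \<mu> - (\<Union>g. \<sigma> g ` C)"
      and 2: "\<forall>g h. g \<noteq> h \<longrightarrow> x \<notin> \<sigma> g ` C \<inter> \<sigma> h ` C"
    obtain g where g: "\<sigma> (- g) x \<in> C" using 1 x mem[OF x] by blast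
    show "\<exists>!\<tau>. \<sigma> \<tau> x \<in> C"
    proof (rule ex1I)
      show "\<sigma> (- g) x \<in> C" by (rule g)
      fix \<tau> assume "\<sigma> \<tau> x \<in> C"
      then show "\<tau> = - g" using g 2[rule_format, of g "- \<tau>"] mem[OF x] by fastforce
    qed
  qed
qed

sublocale X: prehilb X by (rule prehilb_L2_scalars)
sublocale L: separable_prehilb L by (rule separable_prehilb_L2_tile[OF separable_X C_sets])
sublocale K: prehilb K by (rule L.prehilb_L2)

lemma hcomplete_K: "hcomplete K"
  by (rule L.hcomplete_L2[OF hcomplete_L2_scalars])

lemma rep_carr_L: "f \<in> carr X \<Longrightarrow> \<rho> \<tau> f \<in> carr L"
  using L2_scalars_restrict[OF rep_carr C_sets] .

text \<open>After exchanging sum and integral, exactly one \<tau> contributes at almost every point.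
  This is the Parseval identity behind the isometry.\<close>

lemma nn_tile_sum:
  assumes f: "f \<in> carr X"
  shows "(\<integral>\<^sup>+\<tau>. ennreal ((hnorm L (\<rho> \<tau> f))\<^sup>2) \<partial>count_space UNIV) = ennreal ((hnorm X f)\<^sup>2)"
proof -
  have [measurable]: "f \<in> borel_measurable \<mu>" using f by (simp add: carr_L2_scalars)
  have "(\<integral>\<^sup>+\<tau>. ennreal ((hnorm L (\<rho> \<tau> f))\<^sup>2) \<partial>count_space UNIV)
      = (\<integral>\<^sup>+\<tau>. (\<integral>\<^sup>+x. ennreal ((cmod (f x))\<^sup>2) * indicator C (\<sigma> \<tau> x) \<partial>\<mu>) \<partial>count_space UNIV)"
    by (intro nn_integral_cong) (simp add: hnorm_L2_tile[OF rep_carr_L[OF f] C_sets] nn_integral_rep)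
  also have "\<dots> = (\<integral>\<^sup>+x. (\<integral>\<^sup>+\<tau>. ennreal ((cmod (f x))\<^sup>2) * indicator C (\<sigma> \<tau> x) \<partial>count_space UNIV) \<partial>\<mu>)"
    by (rule nn_integral_count_space_nn_integral[symmetric]) auto
  also have "\<dots> = (\<integral>\<^sup>+x. ennreal ((cmod (f x))\<^sup>2) \<partial>\<mu>)"
  proof (rule nn_integral_cong_AE, use tiling_AE in eventually_elim)
    fix x assume "\<exists>!\<tau>. \<sigma> \<tau> x \<in> C"
    then obtain \<tau>0 where "\<sigma> \<tau> x \<in> C \<longleftrightarrow> \<tau> = \<tau>0" for \<tau> by blast
    then have "indicator C (\<sigma> \<tau> x) = (indicator {\<tau>0} \<tau> :: ennreal)" for \<tau>
      by (simp add: indicator_def)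
    then show "(\<integral>\<^sup>+\<tau>. ennreal ((cmod (f x))\<^sup>2) * indicator C (\<sigma> \<tau> x) \<partial>count_space UNIV)
        = ennreal ((cmod (f x))\<^sup>2)"
      by (simp add: nn_integral_cmult)
  qed
  also have "\<dots> = ennreal ((hnorm X f)\<^sup>2)"
    using separable_prehilb.nn_hnorm_L2[OF separable_prehilb_scalars f] by simp
  finally show ?thesis .
qed

lemma tile_has_sum:
  assumes f: "f \<in> carr X"
  shows "((\<lambda>\<tau>. (hnorm L (\<rho> \<tau> f))\<^sup>2) has_sum (hnorm X f)\<^sup>2) UNIV"
proof -
  let ?q = "\<lambda>\<tau>. (hnorm L (\<rho> \<tau> f))\<^sup>2"
  have "integrable (count_space UNIV) ?q"
    by (rule integrableI_nn_integral_finite[where x = "(hnorm X f)\<^sup>2"]) (auto simp: nn_tile_sum[OF f])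
  then have s: "Infinite_Set_Sum.abs_summable_on ?q UNIV" by (simp add: Infinite_Set_Sum.abs_summable_on_def)
  have "ennreal (infsetsum ?q UNIV) = ennreal ((hnorm X f)\<^sup>2)"
    using nn_integral_conv_infsetsum[OF s] nn_tile_sum[OF f] by simp
  then have "infsetsum ?q UNIV = (hnorm X f)\<^sup>2"
    by (subst (asm) ennreal_inj) (auto intro: infsetsum_nonneg)
  then have "infsum ?q UNIV = (hnorm X f)\<^sup>2" using infsetsum_infsum[OF s] by simp
  moreover have "?q summable_on UNIV"
    using s abs_summable_equivalent abs_summable_summable by blast
  ultimately show ?thesis by (metis has_sum_infsum)
qed

lemma L_simps [simp]:
  "hadd L = (\<lambda>f g x. f x + g x)" "hscale L = (\<lambda>c f x. c * f x)" "hdiff L = (\<lambda>f g x. f x - g x)"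
  by simp_all

section \<open>Partial sums of the Zak series\<close>

definition zterm :: "('x \<Rightarrow> complex) \<Rightarrow> 'g \<Rightarrow> 'g dual \<Rightarrow> 'x \<Rightarrow> complex" where
  "zterm f \<tau> = (\<lambda>\<eta> x. \<rho> \<tau> f x * char_of \<eta> (- \<tau>))"

definition zpart :: "('x \<Rightarrow> complex) \<Rightarrow> 'g set \<Rightarrow> 'g dual \<Rightarrow> 'x \<Rightarrow> complex" where
  "zpart f F = (\<lambda>\<eta> x. \<Sum>\<tau>\<in>F. \<rho> \<tau> f x * char_of \<eta> (- \<tau>))"

lemma const_carr_K:
  assumes "v \<in> carr L"
  shows "(\<lambda>_. v) \<in> carr K"
  using assms by (simp add: L2_carr_iff)

lemma mult_carr_K:
  assumes "\<Phi> \<in> carr K" "g \<in> borel_measurable borel" "\<And>\<eta>. cmod (g \<eta>) \<le> B"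
  shows "(\<lambda>\<eta> x. g \<eta> * \<Phi> \<eta> x) \<in> carr K"
  using L.L2_scale_closed[of \<Phi> m g B] assms by simp

lemma zterm_carr:
  assumes "f \<in> carr X"
  shows "zterm f \<tau> \<in> carr K"
  using mult_carr_K[OF const_carr_K[OF rep_carr_L[OF assms, of \<tau>]], of "\<lambda>\<eta>. char_of \<eta> (- \<tau>)" 1]
  by (simp add: zterm_def mult.commute del: char_of_minus)

text \<open>Orthogonality of characters: the dependence on \<eta> is the character value at
  \<open>\<tau>' - \<tau>\<close>, whose integral vanishes unless \<open>\<tau> = \<tau>'\<close>.
  The total mass 1 of Haar measure gives the diagonal.\<close>

lemma zterm_inner:
  assumes f: "f \<in> carr X"
  shows "hinner K (zterm f \<tau>) (zterm f \<tau>') = (if \<tau> = \<tau>' then hinner L (\<rho> \<tau> f) (\<rho> \<tau> f) else 0)"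
proof -
  have z: "zterm f \<tau> = (\<lambda>\<eta>. hscale L (char_of \<eta> (- \<tau>)) (\<rho> \<tau> f))" for \<tau>
    by (simp add: zterm_def fun_eq_iff mult.commute)
  have "hinner K (zterm f \<tau>) (zterm f \<tau>')
      = (\<integral>\<eta>. char_of \<eta> (- \<tau>) * cnj (char_of \<eta> (- \<tau>')) * hinner L (\<rho> \<tau> f) (\<rho> \<tau>' f) \<partial>m)"
    unfolding hinner_L2[of m] z
    by (simp add: L.inner_scale_left L.inner_scale_right L.scale_closed rep_carr_L[OF f] mult_ac
        del: L_simps hscale_L2)
  also have "\<dots> = (\<integral>\<eta>. char_of \<eta> (\<tau>' - \<tau>) * hinner L (\<rho> \<tau> f) (\<rho> \<tau>' f) \<partial>m)"
  proof -
    have "char_of \<eta> (- \<tau>) * cnj (char_of \<eta> (- \<tau>')) = char_of \<eta> (\<tau>' - \<tau>)" for \<eta>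
      using char_of_add[of \<eta> \<tau>' "- \<tau>"] by (simp add: mult.commute)
    then show ?thesis by simp
  qed
  also have "\<dots> = (\<integral>\<eta>. char_of \<eta> (\<tau>' - \<tau>) \<partial>m) * hinner L (\<rho> \<tau> f) (\<rho> \<tau>' f)"
    by simp
  also have "\<dots> = (if \<tau> = \<tau>' then hinner L (\<rho> \<tau> f) (\<rho> \<tau> f) else 0)"
    using integral_char[of "\<tau>' - \<tau>"] by simp
  finally show ?thesis .
qed

lemma zpart_empty: "zpart f {} = (\<lambda>_ _. 0)"
  by (simp add: zpart_def)

lemma zpart_insert:
  "\<lbrakk>finite F; \<tau> \<notin> F\<rbrakk> \<Longrightarrow> zpart f (insert \<tau> F) = hadd K (zterm f \<tau>) (zpart f F)"
  by (simp add: zpart_def zterm_def)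

lemma zero_carr_K: "(\<lambda>_ _. 0) \<in> carr K"
proof -
  obtain \<Phi> where "\<Phi> \<in> carr K" using K.carr_ne by blast
  from K.scale_closed[OF this, of 0] show ?thesis by simp
qed

lemma zpart_carr:
  assumes f: "f \<in> carr X" and "finite F"
  shows "zpart f F \<in> carr K"
  using assms(2)
proof (induction F rule: finite_induct)
  case (insert \<tau> F)
  show ?case
    unfolding zpart_insert[OF insert(1,2)] by (intro K.add_closed zterm_carr f insert)
qed (simp add: zpart_empty zero_carr_K)

lemma zterm_zpart_inner:
  assumes f: "f \<in> carr X" and "finite F" "\<tau> \<notin> F"
  shows "hinner K (zterm f \<tau>) (zpart f F) = 0"
  using assms(2,3)
proof (induction F rule: finite_induct)
  case empty
  have "hinner K (zterm f \<tau>) (hscale K 0 (zterm f \<tau>)) = 0"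
    using zterm_carr[OF f] by (simp only: K.inner_scale_right complex_cnj_zero mult_zero_left)
  then show ?case by (simp add: zpart_empty)
next
  case (insert \<tau>' F)
  then have "hinner K (zterm f \<tau>) (hadd K (zterm f \<tau>') (zpart f F)) = 0"
    using zterm_carr[OF f] zpart_carr[OF f insert(1)]
    by (subst K.inner_add_right) (auto simp: zterm_inner[OF f])
  then show ?case unfolding zpart_insert[OF insert(1,2)] .
qed

lemma zpart_norm:
  assumes f: "f \<in> carr X" and "finite F"
  shows "(hnorm K (zpart f F))\<^sup>2 = (\<Sum>\<tau>\<in>F. (hnorm L (\<rho> \<tau> f))\<^sup>2)"
  using assms(2)
proof (induction F rule: finite_induct)
  case empty
  have "hnorm K (hscale K 0 (zterm f 0)) = 0"
    using K.hnorm_scale[OF zterm_carr[OF f], of 0] by simp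
  then show ?case by (simp add: zpart_empty)
next
  case (insert \<tau> F)
  have "(hnorm K (zpart f (insert \<tau> F)))\<^sup>2 = (hnorm K (zterm f \<tau>))\<^sup>2 + (hnorm K (zpart f F))\<^sup>2"
    using K.hnorm_add_power2[OF zterm_carr[OF f] zpart_carr[OF f insert(1)], of \<tau>]
      zterm_zpart_inner[OF f insert(1,2)]
    unfolding zpart_insert[OF insert(1,2)] by simp
  also have "(hnorm K (zterm f \<tau>))\<^sup>2 = (hnorm L (\<rho> \<tau> f))\<^sup>2"
    by (simp add: K.hnorm_power2 L.hnorm_power2 zterm_carr[OF f] rep_carr_L[OF f] zterm_inner[OF f])
  finally show ?case using insert by simp
qed

lemma zpart_diff:
  assumes "finite F" "F' \<subseteq> F"
  shows "hdiff K (zpart f F) (zpart f F') = zpart f (F - F')"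
  using assms by (simp add: zpart_def sum_diff)

text \<open>By orthogonality the distance between nested partial sums is governed by a tail of the
  convergent sum in \<open>tile_has_sum\<close>.\<close>

lemma zpart_dist:
  assumes f: "f \<in> carr X" and F: "finite F" "F' \<subseteq> F"
  shows "(K.hdist (zpart f F) (zpart f F'))\<^sup>2
    = (\<Sum>\<tau>\<in>F. (hnorm L (\<rho> \<tau> f))\<^sup>2) - (\<Sum>\<tau>\<in>F'. (hnorm L (\<rho> \<tau> f))\<^sup>2)"
  using zpart_norm[OF f, of "F - F'"] F by (simp only: zpart_diff[OF F] sum_diff finite_Diff)

lemma tile_sum_le:
  assumes f: "f \<in> carr X" and "finite F"
  shows "(\<Sum>\<tau>\<in>F. (hnorm L (\<rho> \<tau> f))\<^sup>2) \<le> (hnorm X f)\<^sup>2"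
proof (rule has_sum_mono_neutral[OF has_sum_finite[OF assms(2)] tile_has_sum[OF f]])
qed auto

section \<open>Existence, isometry and equivariance of the Zak transform\<close>

abbreviation isZ where "isZ \<equiv> is_zakT \<sigma> J \<mu> C m"
abbreviation Zt where "Zt \<equiv> zakT \<sigma> J \<mu> C m"

lemma isZ_iff: "isZ f \<Phi> \<longleftrightarrow> \<Phi> \<in> carr K \<and>
    ((\<lambda>F. K.hdist (zpart f F) \<Phi>) \<longlongrightarrow> 0) (finite_subsets_at_top UNIV)"
  by (simp only: is_zakT_def zpart_def)

text \<open>Unconditional convergence is convergence of a net, while completeness concerns
  sequences. An increasing sequence of finite sets \<open>G n\<close> is chosen so that every finite
  \<open>F\<close> containing \<open>G n\<close> has its partial sum within
  \<open>1 / 2 ^ n\<close>; the limit along \<open>G n\<close> is then the limit of the net.\<close>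

lemma isZ_exists:
  assumes f: "f \<in> carr X"
  shows "\<exists>\<Phi>. isZ f \<Phi>"
proof -
  let ?q = "\<lambda>F. \<Sum>\<tau>\<in>F. (hnorm L (\<rho> \<tau> f))\<^sup>2"
  have "(?q \<longlongrightarrow> (hnorm X f)\<^sup>2) (finite_subsets_at_top UNIV)"
    using tile_has_sum[OF f] by (simp add: has_sum_def)
  \<comment> \<open>The tolerance is squared since the tail is a squared distance: a tail below
    \<open>(1 / 2 ^ n)\<^sup>2\<close> means distance at most \<open>1 / 2 ^ n\<close>.\<close>
  then have "\<exists>G. finite G \<and> (hnorm X f)\<^sup>2 - (1 / 2 ^ n)\<^sup>2 < ?q G" for n :: nat
    using order_tendstoD(1)[of ?q "(hnorm X f)\<^sup>2" _ "(hnorm X f)\<^sup>2 - (1 / 2 ^ n)\<^sup>2"]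
    by (fastforce simp: eventually_finite_subsets_at_top)
  then obtain G0 where G0: "\<And>n. finite (G0 n)" "\<And>n::nat. (hnorm X f)\<^sup>2 - (1 / 2 ^ n)\<^sup>2 < ?q (G0 n)"
    by metis
  define G where "G n = (\<Union>i\<le>n. G0 i)" for n
  have Gf: "finite (G n)" for n using G0(1) by (simp add: G_def)
  have Gmono: "G i \<subseteq> G j" if "i \<le> j" for i j using that by (force simp: G_def)
  have close: "K.hdist (zpart f F) (zpart f (G n)) \<le> 1 / 2 ^ n" if F: "finite F" "G n \<subseteq> F" for F n
  proof -
    have "?q (G0 n) \<le> ?q (G n)"
      using Gf by (intro sum_mono2) (auto simp: G_def)
    then have "(K.hdist (zpart f F) (zpart f (G n)))\<^sup>2 \<le> (1 / 2 ^ n)\<^sup>2"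
      unfolding zpart_dist[OF f F] using tile_sum_le[OF f F(1)] G0(2)[of n] by linarith
    then show ?thesis by (rule power2_le_imp_le) simp
  qed
  have "\<exists>M. \<forall>i\<ge>M. \<forall>j\<ge>M. K.hdist (zpart f (G i)) (zpart f (G j)) < e" if e: "e > 0" for e
  proof -
    obtain M where M: "1 / 2 ^ M < e" using real_arch_pow_inv[OF e, of "1/2"] by (auto simp: power_divide)
    have 1: "K.hdist (zpart f (G i)) (zpart f (G j)) < e" if "M \<le> j" "j \<le> i" for i j
    proof -
      have "K.hdist (zpart f (G i)) (zpart f (G j)) \<le> 1 / 2 ^ j" by (rule close[OF Gf Gmono[OF that(2)]])
      also have "\<dots> \<le> 1 / 2 ^ M" using that(1) by (simp add: field_simps)
      finally show ?thesis using M by simp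
    qed
    have "K.hdist (zpart f (G i)) (zpart f (G j)) < e" if "M \<le> i" "M \<le> j" for i j
    proof (cases "j \<le> i")
      case False
      then have "K.hdist (zpart f (G j)) (zpart f (G i)) < e" using 1 that by simp
      then show ?thesis using K.hdist_commute[OF zpart_carr[OF f Gf] zpart_carr[OF f Gf]] by metis
    qed (use 1 that in blast)
    then show ?thesis by blast
  qed
  then obtain \<Phi> where \<Phi>: "\<Phi> \<in> carr K" "(\<lambda>n. K.hdist (zpart f (G n)) \<Phi>) \<longlonglongrightarrow> 0"
    using hcomplete_K[unfolded hcomplete_def, THEN spec[of _ "\<lambda>n. zpart f (G n)"]]
      zpart_carr[OF f Gf] by blast
  have "((\<lambda>F. K.hdist (zpart f F) \<Phi>) \<longlongrightarrow> 0) (finite_subsets_at_top UNIV)"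
  proof (rule tendstoI)
    fix e :: real assume e: "e > 0"
    obtain M where M: "1 / 2 ^ M < e / 2" using real_arch_pow_inv[of "e/2" "1/2"] e by (auto simp: power_divide)
    have "\<forall>\<^sub>F n in sequentially. K.hdist (zpart f (G n)) \<Phi> < e / 2 \<and> n \<ge> M"
      using e by (intro eventually_conj order_tendstoD(2)[OF \<Phi>(2)] eventually_ge_at_top) simp
    then obtain n where n: "K.hdist (zpart f (G n)) \<Phi> < e / 2" "n \<ge> M"
      using eventually_happens'[OF sequentially_bot] by blast
    have "dist (K.hdist (zpart f F) \<Phi>) 0 < e" if F: "finite F" "G n \<subseteq> F" for F
    proof -
      note c = zpart_carr[OF f F(1)] zpart_carr[OF f Gf[of n]]
      have "1 / 2 ^ n \<le> 1 / (2::real) ^ M" using n(2) by (simp add: field_simps)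
      then have "K.hdist (zpart f F) \<Phi> < e"
        using K.hdist_triangle[OF c \<Phi>(1)] close[OF F] n M by linarith
      then show ?thesis
        using K.hnorm_nonneg[OF K.diff_closed[OF c(1) \<Phi>(1)]] by (simp add: dist_real_def)
    qed
    then show "\<forall>\<^sub>F F in finite_subsets_at_top UNIV. dist (K.hdist (zpart f F) \<Phi>) 0 < e"
      unfolding eventually_finite_subsets_at_top using Gf[of n] by blast
  qed
  then show ?thesis using \<Phi>(1) isZ_iff by blast
qed

lemma isZ_Zt: "f \<in> carr X \<Longrightarrow> isZ f (Zt f)"
  unfolding zakT_def by (rule someI_ex[OF isZ_exists])

lemma Zt_carr: "f \<in> carr X \<Longrightarrow> Zt f \<in> carr K"
  using isZ_Zt isZ_iff by blast

lemma eventually_zpart_carr: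
  "f \<in> carr X \<Longrightarrow> \<forall>\<^sub>F F in finite_subsets_at_top UNIV. zpart f F \<in> carr K"
  by (rule eventually_finite_subsets_at_top_weakI) (rule zpart_carr)

text \<open>The squared norms of the partial sums converge both to that of the limit and to the
  total mass of \<open>f\<close> over the tiles.\<close>

lemma isZ_norm:
  assumes f: "f \<in> carr X" and Z: "isZ f \<Phi>"
  shows "hnorm K \<Phi> = hnorm X f"
proof -
  have "((\<lambda>F. hnorm K (zpart f F)) \<longlongrightarrow> hnorm K \<Phi>) (finite_subsets_at_top UNIV)"
    using Z isZ_iff by (intro K.hnorm_tendsto eventually_zpart_carr[OF f]) auto
  then have "((\<lambda>F. (hnorm K (zpart f F))\<^sup>2) \<longlongrightarrow> (hnorm K \<Phi>)\<^sup>2) (finite_subsets_at_top UNIV)"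
    by (rule tendsto_power)
  moreover have "((\<lambda>F. (hnorm K (zpart f F))\<^sup>2) \<longlongrightarrow> (hnorm X f)\<^sup>2) (finite_subsets_at_top UNIV)"
  proof (rule Lim_transform_eventually)
    show "((\<lambda>F. \<Sum>\<tau>\<in>F. (hnorm L (\<rho> \<tau> f))\<^sup>2) \<longlongrightarrow> (hnorm X f)\<^sup>2) (finite_subsets_at_top UNIV)"
      using tile_has_sum[OF f] by (simp add: has_sum_def)
    show "\<forall>\<^sub>F F in finite_subsets_at_top UNIV. (\<Sum>\<tau>\<in>F. (hnorm L (\<rho> \<tau> f))\<^sup>2) = (hnorm K (zpart f F))\<^sup>2"
      by (rule eventually_finite_subsets_at_top_weakI) (simp only: zpart_norm[OF f])
  qed
  ultimately have "(hnorm K \<Phi>)\<^sup>2 = (hnorm X f)\<^sup>2"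
    using tendsto_unique finite_subsets_at_top_neq_bot by blast
  then show ?thesis using Z isZ_iff f by (simp add: power2_eq_iff_nonneg)
qed

text \<open>\<open>zakT\<close> is a choice among limits; this lemma turns any closure property of
  \<open>isZ\<close> into an identity for \<open>Zt\<close> up to distance 0.\<close>

lemma isZ_unique:
  assumes f: "f \<in> carr X" and "isZ f \<Phi>" "isZ f \<Psi>"
  shows "K.hdist \<Phi> \<Psi> = 0"
proof -
  have c: "\<Phi> \<in> carr K" "\<Psi> \<in> carr K" using assms isZ_iff by auto
  have "((\<lambda>F. K.hdist (zpart f F) \<Phi> + K.hdist (zpart f F) \<Psi>) \<longlongrightarrow> 0 + 0) (finite_subsets_at_top UNIV)"
    using assms isZ_iff by (intro tendsto_add) auto
  moreover have "\<forall>\<^sub>F F in finite_subsets_at_top UNIV. K.hdist \<Phi> \<Psi> \<le> K.hdist (zpart f F) \<Phi> + K.hdist (zpart f F) \<Psi>"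
    using eventually_zpart_carr[OF f]
  proof eventually_elim
    case (elim F)
    then show ?case using K.hdist_triangle[OF c(1) elim c(2)] K.hdist_commute[OF c(1) elim] by simp
  qed
  ultimately have "K.hdist \<Phi> \<Psi> \<le> 0 + 0"
    using tendsto_le[OF finite_subsets_at_top_neq_bot _ tendsto_const] by blast
  then show ?thesis using K.hnorm_nonneg[OF K.diff_closed[OF c]] by simp
qed

lemma isZ_add:
  assumes f: "f \<in> carr X" "g \<in> carr X" and Z: "isZ f \<Phi>" "isZ g \<Psi>"
  shows "isZ (hadd X f g) (hadd K \<Phi> \<Psi>)"
proof -
  have c: "\<Phi> \<in> carr K" "\<Psi> \<in> carr K" using Z isZ_iff by auto
  have eq: "zpart (hadd X f g) F = hadd K (zpart f F) (zpart g F)" for F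
    by (simp add: zpart_def rep_def fun_eq_iff sum.distrib distrib_left distrib_right)
  have "((\<lambda>F. K.hdist (zpart (hadd X f g) F) (hadd K \<Phi> \<Psi>)) \<longlongrightarrow> 0) (finite_subsets_at_top UNIV)"
  proof (rule Lim_null_comparison)
    show "((\<lambda>F. K.hdist (zpart f F) \<Phi> + K.hdist (zpart g F) \<Psi>) \<longlongrightarrow> 0) (finite_subsets_at_top UNIV)"
      using Z isZ_iff by (intro tendsto_add_zero) auto
    show "\<forall>\<^sub>F F in finite_subsets_at_top UNIV. norm (K.hdist (zpart (hadd X f g) F) (hadd K \<Phi> \<Psi>))
        \<le> K.hdist (zpart f F) \<Phi> + K.hdist (zpart g F) \<Psi>"
      using eventually_zpart_carr[OF f(1)] eventually_zpart_carr[OF f(2)]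
    proof eventually_elim
      case (elim F)
      have "0 \<le> K.hdist (zpart (hadd X f g) F) (hadd K \<Phi> \<Psi>)"
        unfolding eq by (intro K.hnorm_nonneg K.closed_rules elim c)
      then show ?case using K.hdist_add[OF elim c] unfolding eq by simp
    qed
  qed
  then show ?thesis using K.add_closed[OF c] isZ_iff by blast
qed

lemma isZ_scale:
  assumes f: "f \<in> carr X" and Z: "isZ f \<Phi>"
  shows "isZ (hscale X a f) (hscale K a \<Phi>)"
proof -
  have c: "\<Phi> \<in> carr K" using Z isZ_iff by auto
  have eq: "zpart (hscale X a f) F = hscale K a (zpart f F)" for F
    by (simp add: zpart_def rep_def fun_eq_iff sum_distrib_left mult_ac)
  have "((\<lambda>F. K.hdist (zpart (hscale X a f) F) (hscale K a \<Phi>)) \<longlongrightarrow> 0) (finite_subsets_at_top UNIV)"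
  proof (rule Lim_transform_eventually)
    show "((\<lambda>F. cmod a * K.hdist (zpart f F) \<Phi>) \<longlongrightarrow> 0) (finite_subsets_at_top UNIV)"
      using Z isZ_iff by (intro tendsto_mult_right_zero) auto
    show "\<forall>\<^sub>F F in finite_subsets_at_top UNIV. cmod a * K.hdist (zpart f F) \<Phi>
        = K.hdist (zpart (hscale X a f) F) (hscale K a \<Phi>)"
      using eventually_zpart_carr[OF f]
      by eventually_elim (use K.hdist_scale[OF _ c] eq in metis)
  qed
  then show ?thesis using K.scale_closed[OF c] isZ_iff by blast
qed

lemma isZ_diff:
  assumes f: "f \<in> carr X" "g \<in> carr X" and Z: "isZ f \<Phi>" "isZ g \<Psi>"
  shows "isZ (hdiff X f g) (hdiff K \<Phi> \<Psi>)"
  unfolding hdiff_def by (intro isZ_add isZ_scale f Z X.scale_closed)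

lemma isZ_rep:
  assumes f: "f \<in> carr X" and Z: "isZ f \<Phi>"
  shows "isZ (\<rho> \<gamma> f) (\<lambda>\<eta> x. char_of \<eta> \<gamma> * \<Phi> \<eta> x)"
proof -
  let ?M = "\<lambda>\<Phi> \<eta> x. char_of \<eta> \<gamma> * \<Phi> \<eta> x"
  have c: "\<Phi> \<in> carr K" using Z isZ_iff by auto
  have Mc: "?M \<Psi> \<in> carr K" if "\<Psi> \<in> carr K" for \<Psi>
    using mult_carr_K[OF that, of "\<lambda>\<eta>. char_of \<eta> \<gamma>" 1] by simp
  have Md: "K.hdist (?M \<Psi>) (?M \<Psi>') = K.hdist \<Psi> \<Psi>'" if "\<Psi> \<in> carr K" "\<Psi>' \<in> carr K" for \<Psi> \<Psi>'
  proof -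
    have "L.hdist (?M \<Psi> \<eta>) (?M \<Psi>' \<eta>) = L.hdist (\<Psi> \<eta>) (\<Psi>' \<eta>)" for \<eta>
      using L.hdist_scale[of "\<Psi> \<eta>" "\<Psi>' \<eta>" "char_of \<eta> \<gamma>"] that by (simp add: L2_carr_iff[of _ m])
    then have "ennreal ((K.hdist (?M \<Psi>) (?M \<Psi>'))\<^sup>2) = ennreal ((K.hdist \<Psi> \<Psi>')\<^sup>2)"
      using L.nn_hdist_L2[OF Mc[OF that(1)] Mc[OF that(2)]] L.nn_hdist_L2[OF that] by simp
    then have "(K.hdist (?M \<Psi>) (?M \<Psi>'))\<^sup>2 = (K.hdist \<Psi> \<Psi>')\<^sup>2" by simp
    then show ?thesis
      using K.hnorm_nonneg[OF K.diff_closed[OF Mc[OF that(1)] Mc[OF that(2)]]]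
        K.hnorm_nonneg[OF K.diff_closed[OF that]]
      by (rule power2_eq_imp_eq)
  qed
  \<comment> \<open>Only a statement about distance, because \<open>rep_rep\<close> holds almost
    everywhere; finiteness of \<open>F\<close> keeps the exceptional set null.\<close>
  have shift: "K.hdist (zpart (\<rho> \<gamma> f) F) (?M (zpart f ((+) \<gamma> ` F))) = 0" if F: "finite F" for F
  proof (subst L.hdist_L2_AE_0[OF zpart_carr[OF rep_carr[OF f] F] Mc[OF zpart_carr[OF f finite_imageI[OF F]]]],
      rule AE_I2)
    fix \<eta>
    have 1: "zpart (\<rho> \<gamma> f) F \<eta> \<in> carr L" "?M (zpart f ((+) \<gamma> ` F)) \<eta> \<in> carr L"
      using L2_carrD(1)[OF zpart_carr[OF rep_carr[OF f] F]]
        L2_carrD(1)[OF Mc[OF zpart_carr[OF f finite_imageI[OF F]]]] by simp_all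
    have "AE x in \<mu>. \<forall>\<tau>\<in>F. \<rho> \<tau> (\<rho> \<gamma> f) x = \<rho> (\<tau> + \<gamma>) f x"
      using F by (intro AE_finite_allI rep_rep)
    then have "AE x in \<mu>. zpart (\<rho> \<gamma> f) F \<eta> x = ?M (zpart f ((+) \<gamma> ` F)) \<eta> x"
    proof eventually_elim
      case (elim x)
      have "?M (zpart f ((+) \<gamma> ` F)) \<eta> x = (\<Sum>\<tau>\<in>F. char_of \<eta> \<gamma> * (\<rho> (\<gamma> + \<tau>) f x * char_of \<eta> (- (\<gamma> + \<tau>))))"
        by (simp add: zpart_def sum.reindex sum_distrib_left del: char_of_minus char_of_add)
      also have "\<dots> = zpart (\<rho> \<gamma> f) F \<eta> x"
        unfolding zpart_def
      proof (rule sum.cong[OF refl])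
        fix \<tau> assume "\<tau> \<in> F"
        then have 1: "\<rho> \<tau> (\<rho> \<gamma> f) x = \<rho> (\<gamma> + \<tau>) f x" using elim by (simp add: add.commute)
        have "\<gamma> + - (\<gamma> + \<tau>) = - \<tau>" by simp
        then have 2: "char_of \<eta> \<gamma> * char_of \<eta> (- (\<gamma> + \<tau>)) = char_of \<eta> (- \<tau>)"
          by (simp only: flip: char_of_add)
        show "char_of \<eta> \<gamma> * (\<rho> (\<gamma> + \<tau>) f x * char_of \<eta> (- (\<gamma> + \<tau>))) = \<rho> \<tau> (\<rho> \<gamma> f) x * char_of \<eta> (- \<tau>)"
          unfolding 1 2[symmetric] by (rule mult.left_commute)
      qed
      finally show ?case by simp
    qed
    then have "AE x in restrict_space \<mu> C. cmod (zpart (\<rho> \<gamma> f) F \<eta> x - ?M (zpart f ((+) \<gamma> ` F)) \<eta> x) = 0"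
      by (subst AE_restrict_space_iff) (auto elim: eventually_mono)
    then show "L.hdist (zpart (\<rho> \<gamma> f) F \<eta>) (?M (zpart f ((+) \<gamma> ` F)) \<eta>) = 0"
      by (subst separable_prehilb.hdist_L2_AE_0[OF separable_prehilb_scalars 1]) simp
  qed
  have "((\<lambda>F. K.hdist (zpart (\<rho> \<gamma> f) F) (?M \<Phi>)) \<longlongrightarrow> 0) (finite_subsets_at_top UNIV)"
  proof (rule Lim_transform_eventually)
    \<comment> \<open>Translation is a bijection of the group: a finite set contains
      \<open>G\<close> after translation by \<gamma> as soon as it contains the translate of
      \<open>G\<close> by \<open>- \<gamma>\<close>.\<close>
    have "filterlim (\<lambda>F. (+) \<gamma> ` F) (finite_subsets_at_top UNIV) (finite_subsets_at_top UNIV)"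
      unfolding filterlim_iff eventually_finite_subsets_at_top
    proof (intro allI impI, elim exE conjE)
      fix P and G :: "'g set" assume G: "finite G" "\<forall>Y. finite Y \<and> G \<subseteq> Y \<and> Y \<subseteq> UNIV \<longrightarrow> P Y"
      have "P ((+) \<gamma> ` Y)" if "finite Y" "(+) (- \<gamma>) ` G \<subseteq> Y" for Y
      proof -
        have "G = (+) \<gamma> ` (+) (- \<gamma>) ` G" by (simp add: image_image)
        also have "\<dots> \<subseteq> (+) \<gamma> ` Y" using that(2) by (rule image_mono)
        finally show ?thesis using G(2) that(1) by simp
      qed
      then show "\<exists>X. finite X \<and> X \<subseteq> UNIV \<and> (\<forall>Y. finite Y \<and> X \<subseteq> Y \<and> Y \<subseteq> UNIV \<longrightarrow> P ((+) \<gamma> ` Y))"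
        using G(1) by (intro exI[of _ "(+) (- \<gamma>) ` G"]) auto
    qed
    then show "((\<lambda>F. K.hdist (zpart f ((+) \<gamma> ` F)) \<Phi>) \<longlongrightarrow> 0) (finite_subsets_at_top UNIV)"
      using Z isZ_iff filterlim_compose by blast
    show "\<forall>\<^sub>F F in finite_subsets_at_top UNIV. K.hdist (zpart f ((+) \<gamma> ` F)) \<Phi> = K.hdist (zpart (\<rho> \<gamma> f) F) (?M \<Phi>)"
    proof (rule eventually_finite_subsets_at_top_weakI)
      fix F :: "'g set" assume F: "finite F"
      let ?A = "zpart (\<rho> \<gamma> f) F" and ?B = "zpart f ((+) \<gamma> ` F)"
      have A: "?A \<in> carr K" using zpart_carr[OF rep_carr[OF f] F] .
      have B: "?B \<in> carr K" using zpart_carr[OF f finite_imageI[OF F]] .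
      have "K.hdist ?B \<Phi> = K.hdist (?M ?B) (?M \<Phi>)" using Md[OF B c] by simp
      moreover have "K.hdist (?M ?B) (?M \<Phi>) = K.hdist ?A (?M \<Phi>)"
        using K.hdist_triangle[OF A Mc[OF B] Mc[OF c]] K.hdist_triangle[OF Mc[OF B] A Mc[OF c]]
          shift[OF F] K.hdist_commute[OF A Mc[OF B]] by linarith
      ultimately show "K.hdist ?B \<Phi> = K.hdist ?A (?M \<Phi>)" by simp
    qed
  qed
  then show ?thesis using Mc[OF c] isZ_iff by blast
qed

lemma Zt_add: "\<lbrakk>f \<in> carr X; g \<in> carr X\<rbrakk> \<Longrightarrow> K.hdist (hadd K (Zt f) (Zt g)) (Zt (hadd X f g)) = 0"
  by (intro isZ_unique[of "hadd X f g"] isZ_add isZ_Zt X.add_closed)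

lemma Zt_scale: "f \<in> carr X \<Longrightarrow> K.hdist (hscale K a (Zt f)) (Zt (hscale X a f)) = 0"
  by (intro isZ_unique[of "hscale X a f"] isZ_scale isZ_Zt X.scale_closed)

lemma Zt_rep: "f \<in> carr X \<Longrightarrow> K.hdist (\<lambda>\<eta> x. char_of \<eta> \<gamma> * Zt f \<eta> x) (Zt (\<rho> \<gamma> f)) = 0"
  by (intro isZ_unique[of "\<rho> \<gamma> f"] isZ_rep isZ_Zt rep_carr)

lemma Zt_dist: "\<lbrakk>f \<in> carr X; g \<in> carr X\<rbrakk> \<Longrightarrow> K.hdist (Zt f) (Zt g) = X.hdist f g"
  by (intro isZ_norm[of "hdiff X f g"] isZ_diff isZ_Zt X.diff_closed)

end

section \<open>Sections and folding the dual group over a fundamental domain\<close>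

lemma coset_iff: "x \<in> coset y H \<longleftrightarrow> x - y \<in> (H :: 'a::ab_group_add set)"
  unfolding coset_def by (force simp: image_iff algebra_simps)

lemma is_subgroup_annihilator: "is_subgroup (annihilator H)"
  by (auto simp: is_subgroup_def annihilator_def)

lemma is_subgroupD:
  assumes "is_subgroup H"
  shows "0 \<in> H" "\<lbrakk>x \<in> H; y \<in> H\<rbrakk> \<Longrightarrow> x + y \<in> H" "x \<in> H \<Longrightarrow> - x \<in> H" "\<lbrakk>x \<in> H; y \<in> H\<rbrakk> \<Longrightarrow> x - y \<in> H"
proof -
  show *: "0 \<in> H" "\<lbrakk>x \<in> H; y \<in> H\<rbrakk> \<Longrightarrow> x + y \<in> H" "x \<in> H \<Longrightarrow> - x \<in> H" for x y
    using assms by (auto simp: is_subgroup_def)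
  show "\<lbrakk>x \<in> H; y \<in> H\<rbrakk> \<Longrightarrow> x - y \<in> H"
    using *(2)[of x "- y"] *(3)[of y] by simp
qed

locale zak_section = zak_setting \<mu> \<sigma> J m C
  for \<mu> :: "'x measure" and \<sigma> :: "'g::{ab_group_add,countable} \<Rightarrow> 'x \<Rightarrow> 'x"
    and J :: "'g \<Rightarrow> 'x \<Rightarrow> real" and m :: "'g dual measure" and C :: "'x set" +
  fixes \<Gamma> :: "'g set" and \<gamma>s :: "nat \<Rightarrow> 'g dual" and s :: nat and \<Omega> :: "'g dual set"
  assumes \<Gamma>: "is_subgroup \<Gamma>" and \<gamma>s: "bij_betw \<gamma>s {..s} (annihilator \<Gamma>)"
    and \<Omega>_sets': "\<Omega> \<in> sets m" and \<Omega>: "is_section \<Omega> UNIV (annihilator \<Gamma>)"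
begin

abbreviation N where "N \<equiv> restrict_space m \<Omega>"
abbreviation H where "H \<equiv> hpower (Suc s) L"
abbreviation KN where "KN \<equiv> L2 N H"

sublocale H: separable_prehilb H by (rule L.separable_prehilb_hpower)
sublocale KN: prehilb KN by (rule H.prehilb_L2)

lemma \<Omega>_sets [measurable]: "\<Omega> \<in> sets borel"
  using \<Omega>_sets' by (simp add: sets_m)

lemma space_N [simp]: "space N = \<Omega>"
  by (simp add: space_restrict_space)

lemma \<Omega>_int: "\<Omega> \<inter> space m \<in> sets m"
  using \<Omega>_sets' by simp

lemma measurable_N: "f \<in> borel_measurable borel \<Longrightarrow> f \<in> borel_measurable N"
  by (rule measurable_restrict_space1) simp

lemma \<gamma>s_mem: "i \<le> s \<Longrightarrow> \<gamma>s i \<in> annihilator \<Gamma>"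
  using \<gamma>s by (auto simp: bij_betw_def)

text \<open>The point \<omega> where the coset of \<eta> meets \<Omega> determines
  \<open>\<gamma>s i = \<eta> - \<omega>\<close>. Equivalently, the translates of \<Omega> by the
  \<open>\<gamma>s i\<close> tile the dual.\<close>

lemma section_unique: "\<exists>!i. i \<le> s \<and> \<eta> - \<gamma>s i \<in> \<Omega>"
proof -
  note A = is_subgroupD[OF is_subgroup_annihilator[of \<Gamma>]]
  have "\<exists>!\<omega>. \<omega> \<in> \<Omega> \<and> \<omega> \<in> coset \<eta> (annihilator \<Gamma>)"
    using \<Omega> unfolding is_section_def cosets_def by blast
  then obtain \<omega> where \<omega>: "\<omega> \<in> \<Omega>" "\<omega> - \<eta> \<in> annihilator \<Gamma>"
    "\<And>\<omega>'. \<omega>' \<in> \<Omega> \<Longrightarrow> \<omega>' - \<eta> \<in> annihilator \<Gamma> \<Longrightarrow> \<omega>' = \<omega>"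
    unfolding coset_iff by (elim ex1E) blast
  have "\<eta> - \<omega> \<in> annihilator \<Gamma>" using A(3)[OF \<omega>(2)] by simp
  then have "\<eta> - \<omega> \<in> \<gamma>s ` {..s}" using \<gamma>s unfolding bij_betw_def by simp
  then obtain i where i: "i \<le> s" "\<gamma>s i = \<eta> - \<omega>" by auto
  show ?thesis
  proof (rule ex1I[of _ i])
    show "i \<le> s \<and> \<eta> - \<gamma>s i \<in> \<Omega>" using i \<omega>(1) by simp
    fix j assume j: "j \<le> s \<and> \<eta> - \<gamma>s j \<in> \<Omega>"
    have "\<eta> - \<gamma>s j - \<eta> \<in> annihilator \<Gamma>" using A(3)[OF \<gamma>s_mem[of j]] j by simp
    then have "\<eta> - \<gamma>s j = \<omega>" using \<omega>(3)[of "\<eta> - \<gamma>s j"] j by simp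
    then have "\<gamma>s j = \<gamma>s i" unfolding i(2) by (simp add: algebra_simps)
    then show "j = i"
      using inj_onD[OF bij_betw_imp_inj_on[OF \<gamma>s], of j i] i(1) j by simp
  qed
qed

lemma \<gamma>s_0: "\<exists>i\<le>s. \<gamma>s i = 0"
proof -
  have "0 \<in> annihilator \<Gamma>" by (simp add: annihilator_def)
  then have "0 \<in> \<gamma>s ` {..s}" using \<gamma>s unfolding bij_betw_def by simp
  then show ?thesis by auto
qed

lemma section_shift:
  assumes "\<omega> \<in> \<Omega>" "i \<le> s"
  shows "\<omega> + \<gamma>s i \<in> \<Omega> \<longleftrightarrow> \<gamma>s i = 0"
proof
  assume "\<omega> + \<gamma>s i \<in> \<Omega>"
  obtain i0 where i0: "i0 \<le> s" "\<gamma>s i0 = 0" using \<gamma>s_0 by blast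
  have uniq: "j = k" if "j \<le> s \<and> \<omega> + \<gamma>s i - \<gamma>s j \<in> \<Omega>" "k \<le> s \<and> \<omega> + \<gamma>s i - \<gamma>s k \<in> \<Omega>" for j k
    by (rule ex1E[OF section_unique[of "\<omega> + \<gamma>s i"]]) (use that in blast)
  have "i = i0" by (rule uniq) (use assms i0 \<open>\<omega> + \<gamma>s i \<in> \<Omega>\<close> in simp_all)
  then show "\<gamma>s i = 0" using i0 by simp
qed (use assms in simp)

lemma measurable_shift [measurable]: "(\<lambda>\<omega>. \<omega> + \<gamma>s i) \<in> borel \<rightarrow>\<^sub>M borel"
  using measurable_translate[of "\<gamma>s i"] by (simp add: add.commute)

text \<open>The dual is the disjoint union of the translates of \<Omega>, and invariance of Haar
  measure moves each of them back to \<Omega>. No constant appears because \<Omega> carries the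
  restricted measure.\<close>

lemma nn_integral_unfold:
  assumes [measurable]: "g \<in> borel_measurable borel"
  shows "(\<integral>\<^sup>+\<omega>. (\<Sum>i<Suc s. g (\<omega> + \<gamma>s i)) \<partial>N) = (\<integral>\<^sup>+\<eta>. g \<eta> \<partial>m)"
proof -
  have [measurable]: "(\<lambda>\<eta>. indicator \<Omega> (\<eta> - \<gamma>s i) :: ennreal) \<in> borel_measurable borel" for i
  proof -
    have "(\<lambda>\<eta>. indicator \<Omega> (- \<gamma>s i + \<eta>) :: ennreal) \<in> borel_measurable borel" by measurable
    then show ?thesis by simp
  qed
  have "(\<integral>\<^sup>+\<omega>. (\<Sum>i<Suc s. g (\<omega> + \<gamma>s i)) \<partial>N) = (\<integral>\<^sup>+\<omega>. (\<Sum>i<Suc s. g (\<omega> + \<gamma>s i)) * indicator \<Omega> \<omega> \<partial>m)"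
    by (subst nn_integral_restrict_space) (simp_all add: \<Omega>_sets' sets_m)
  also have "\<dots> = (\<Sum>i<Suc s. \<integral>\<^sup>+\<omega>. g (\<omega> + \<gamma>s i) * indicator \<Omega> \<omega> \<partial>m)"
    unfolding sum_distrib_right by (intro nn_integral_sum) simp
  also have "\<dots> = (\<Sum>i<Suc s. \<integral>\<^sup>+\<eta>. g \<eta> * indicator \<Omega> (\<eta> - \<gamma>s i) \<partial>m)"
  proof (rule sum.cong[OF refl])
    fix i
    show "(\<integral>\<^sup>+\<omega>. g (\<omega> + \<gamma>s i) * indicator \<Omega> \<omega> \<partial>m) = (\<integral>\<^sup>+\<eta>. g \<eta> * indicator \<Omega> (\<eta> - \<gamma>s i) \<partial>m)"
      using nn_integral_translate[of "\<lambda>\<eta>. g \<eta> * indicator \<Omega> (\<eta> - \<gamma>s i)" "\<gamma>s i"]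
      by (simp add: add.commute)
  qed
  also have "\<dots> = (\<integral>\<^sup>+\<eta>. (\<Sum>i<Suc s. g \<eta> * indicator \<Omega> (\<eta> - \<gamma>s i)) \<partial>m)"
    by (intro nn_integral_sum[symmetric]) simp
  also have "\<dots> = (\<integral>\<^sup>+\<eta>. g \<eta> \<partial>m)"
  proof (rule nn_integral_cong)
    fix \<eta>
    obtain i0 where i0: "\<And>i. i \<le> s \<and> \<eta> - \<gamma>s i \<in> \<Omega> \<longleftrightarrow> i = i0"
      using section_unique[of \<eta>] by (elim ex1E) blast
    have "(\<Sum>i<Suc s. g \<eta> * indicator \<Omega> (\<eta> - \<gamma>s i)) = (\<Sum>i<Suc s. if i = i0 then g \<eta> else 0)"
      using i0 by (intro sum.cong) (auto simp: indicator_def less_Suc_eq_le)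
    also have "\<dots> = g \<eta>" using i0[of i0] by (simp add: less_Suc_eq_le)
    finally show "(\<Sum>i<Suc s. g \<eta> * indicator \<Omega> (\<eta> - \<gamma>s i)) = g \<eta>" .
  qed
  finally show ?thesis .
qed

text \<open>The second factor of Z, after the transform with values on the whole dual. Separating
  the two lets isometry be shown by orthogonality for one and by tiling of the dual for the
  other.\<close>

definition unfold :: "('g dual \<Rightarrow> 'x \<Rightarrow> complex) \<Rightarrow> 'g dual \<Rightarrow> nat \<Rightarrow> 'x \<Rightarrow> complex" where
  "unfold \<Phi> = (\<lambda>\<omega> i. \<Phi> (\<omega> + \<gamma>s i))"

lemma unfold_carr_H: "\<Phi> \<in> carr K \<Longrightarrow> unfold \<Phi> \<omega> \<in> carr H"
  by (simp add: unfold_def hpower_simps L2_carr_iff[of _ m])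

lemma hnorm_unfold:
  "\<Phi> \<in> carr K \<Longrightarrow> (hnorm H (unfold \<Phi> \<omega>))\<^sup>2 = (\<Sum>i<Suc s. (hnorm L (\<Phi> (\<omega> + \<gamma>s i)))\<^sup>2)"
  by (simp only: L.hnorm_hpower[OF unfold_carr_H]) (simp add: unfold_def)

lemma unfold_carr:
  assumes \<Phi>: "\<Phi> \<in> carr K"
  shows "unfold \<Phi> \<in> carr KN"
  unfolding L2_carr_iff[of _ N]
proof (intro conjI ballI)
  show "unfold \<Phi> \<omega> \<in> carr H" for \<omega> by (rule unfold_carr_H[OF \<Phi>])
  fix h assume h: "h \<in> carr H"
  have "(\<lambda>\<omega>. \<Sum>i<Suc s. hinner L (\<Phi> (\<omega> + \<gamma>s i)) (h i)) \<in> borel_measurable borel"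
  proof (rule borel_measurable_sum)
    fix i assume "i \<in> {..<Suc s}"
    then have "(\<lambda>\<eta>. hinner L (\<Phi> \<eta>) (h i)) \<in> borel_measurable borel"
      using L2_carrD(2)[OF \<Phi>, of "h i"] h by (simp add: hpower_simps)
    then show "(\<lambda>\<omega>. hinner L (\<Phi> (\<omega> + \<gamma>s i)) (h i)) \<in> borel_measurable borel"
      by (rule measurable_compose[OF measurable_shift])
  qed
  then show "(\<lambda>\<omega>. hinner H (unfold \<Phi> \<omega>) h) \<in> borel_measurable N"
    by (simp only: hpower_simps unfold_def measurable_N)
next
  have "integrable m (\<lambda>\<omega>. (hnorm L (\<Phi> (\<omega> + \<gamma>s i)))\<^sup>2)" for i
    using integrable_translate[OF L2_carrD(3)[OF \<Phi>], of "\<gamma>s i"] by (simp add: add.commute)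
  then have "integrable m (\<lambda>\<omega>. (hnorm H (unfold \<Phi> \<omega>))\<^sup>2)"
    unfolding hnorm_unfold[OF \<Phi>] by (intro Bochner_Integration.integrable_sum)
  then show "integrable N (\<lambda>\<omega>. (hnorm H (unfold \<Phi> \<omega>))\<^sup>2)"
    unfolding integrable_restrict_space[OF \<Omega>_int] by (rule integrable_mult_indicator[OF \<Omega>_sets'])
qed

lemma unfold_norm:
  assumes \<Phi>: "\<Phi> \<in> carr K"
  shows "hnorm KN (unfold \<Phi>) = hnorm K \<Phi>"
proof -
  have [measurable]: "(\<lambda>\<eta>. hnorm L (\<Phi> \<eta>)) \<in> borel_measurable borel"
    using L.L2_hnorm_measurable[OF \<Phi>] by simp
  have "ennreal ((hnorm KN (unfold \<Phi>))\<^sup>2) = (\<integral>\<^sup>+\<omega>. (\<Sum>i<Suc s. ennreal ((hnorm L (\<Phi> (\<omega> + \<gamma>s i)))\<^sup>2)) \<partial>N)"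
    unfolding H.nn_hnorm_L2[OF unfold_carr[OF \<Phi>]] hnorm_unfold[OF \<Phi>]
    by (simp only: sum_ennreal zero_le_power2)
  also have "\<dots> = (\<integral>\<^sup>+\<eta>. ennreal ((hnorm L (\<Phi> \<eta>))\<^sup>2) \<partial>m)"
    by (rule nn_integral_unfold) measurable
  also have "\<dots> = ennreal ((hnorm K \<Phi>)\<^sup>2)" by (rule L.nn_hnorm_L2[OF \<Phi>, symmetric])
  finally have "(hnorm KN (unfold \<Phi>))\<^sup>2 = (hnorm K \<Phi>)\<^sup>2" by simp
  then show ?thesis
    using KN.hnorm_nonneg[OF unfold_carr[OF \<Phi>]] K.hnorm_nonneg[OF \<Phi>] by (rule power2_eq_imp_eq)
qed

lemma unfold_add: "unfold (hadd K \<Phi> \<Psi>) = hadd KN (unfold \<Phi>) (unfold \<Psi>)"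
  and unfold_scale: "unfold (hscale K a \<Phi>) = hscale KN a (unfold \<Phi>)"
  and unfold_diff: "unfold (hdiff K \<Phi> \<Psi>) = hdiff KN (unfold \<Phi>) (unfold \<Psi>)"
  by (simp_all add: unfold_def hpower_simps)

lemma unfold_dist:
  "\<lbrakk>\<Phi> \<in> carr K; \<Psi> \<in> carr K\<rbrakk> \<Longrightarrow> KN.hdist (unfold \<Phi>) (unfold \<Psi>) = K.hdist \<Phi> \<Psi>"
  using unfold_norm[OF K.diff_closed] by (simp only: unfold_diff)

section \<open>The transform Z and the image of a subspace\<close>

abbreviation Zk where "Zk \<equiv> zak \<sigma> J \<mu> C m \<gamma>s"

lemma Zk_eq: "Zk f = unfold (Zt f)"
  by (simp add: zak_def unfold_def)

lemma Zk_carr: "f \<in> carr X \<Longrightarrow> Zk f \<in> carr KN"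
  unfolding Zk_eq by (intro unfold_carr Zt_carr)

lemma Zk_dist: "\<lbrakk>f \<in> carr X; g \<in> carr X\<rbrakk> \<Longrightarrow> KN.hdist (Zk f) (Zk g) = X.hdist f g"
  unfolding Zk_eq by (simp only: unfold_dist Zt_carr Zt_dist)

lemma Zk_add:
  assumes "f \<in> carr X" "g \<in> carr X"
  shows "KN.hdist (hadd KN (Zk f) (Zk g)) (Zk (hadd X f g)) = 0"
  unfolding Zk_eq unfold_add[symmetric]
  using unfold_dist[OF K.add_closed[OF assms[THEN Zt_carr]] Zt_carr[OF X.add_closed[OF assms]]] Zt_add[OF assms]
  by simp

lemma Zk_scale:
  assumes "f \<in> carr X"
  shows "KN.hdist (hscale KN a (Zk f)) (Zk (hscale X a f)) = 0"
  unfolding Zk_eq unfold_scale[symmetric]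
  using unfold_dist[OF K.scale_closed[OF Zt_carr[OF assms]] Zt_carr[OF X.scale_closed[OF assms]]] Zt_scale[OF assms]
  by simp

lemma Zk_rep:
  assumes "f \<in> carr X"
  shows "KN.hdist (\<lambda>\<omega> i x. char_of \<omega> \<gamma> * (char_of (\<gamma>s i) \<gamma> * Zk f \<omega> i x)) (Zk (\<rho> \<gamma> f)) = 0"
proof -
  have "(\<lambda>\<eta> x. char_of \<eta> \<gamma> * Zt f \<eta> x) \<in> carr K"
    using mult_carr_K[OF Zt_carr[OF assms], of "\<lambda>\<eta>. char_of \<eta> \<gamma>" 1] by simp
  from unfold_dist[OF this Zt_carr[OF rep_carr[OF assms]]]
  have "KN.hdist (unfold (\<lambda>\<eta> x. char_of \<eta> \<gamma> * Zt f \<eta> x)) (Zk (\<rho> \<gamma> f)) = 0"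
    using Zt_rep[OF assms] unfolding Zk_eq by simp
  then show ?thesis by (simp add: unfold_def Zk_eq mult.assoc)
qed

abbreviation ZV where "ZV V \<equiv> zak_image \<sigma> J \<mu> C m \<gamma>s s \<Omega> V"

lemma ZV_iff: "\<Psi> \<in> ZV V \<longleftrightarrow> \<Psi> \<in> carr KN \<and> (\<exists>f\<in>V. KN.hdist \<Psi> (Zk f) = 0)"
  by (simp only: zak_image_def Let_def mem_Collect_eq)

lemma ZV_I: "\<lbrakk>\<Psi> \<in> carr KN; f \<in> V; KN.hdist \<Psi> (Zk f) = 0\<rbrakk> \<Longrightarrow> \<Psi> \<in> ZV V"
  unfolding ZV_iff by (intro conjI bexI[of _ f])

lemma ZV_E:
  assumes "\<Psi> \<in> ZV V"
  obtains f where "f \<in> V" "KN.hdist \<Psi> (Zk f) = 0"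
  using assms unfolding ZV_iff by (elim conjE bexE)

lemma ZV_carr: "\<Psi> \<in> ZV V \<Longrightarrow> \<Psi> \<in> carr KN"
  unfolding ZV_iff by (elim conjE)

lemma Zk_ZV: "\<lbrakk>f \<in> V; f \<in> carr X\<rbrakk> \<Longrightarrow> Zk f \<in> ZV V"
  by (intro ZV_I[of "Zk f" f] Zk_carr KN.hdist_self)

text \<open>Sums and multiples are matched only up to distance 0, since \<open>Zk\<close> involves a
  choice of representatives. For limits, the isometry makes the preimages a Cauchy sequence;
  completeness of the source gives a limit, which lies in \<open>V\<close>, and its transform is at
  distance 0 from the given limit.\<close>

lemma closed_subspace_ZV:
  assumes V: "closed_subspace X V"
  shows "closed_subspace KN (ZV V)"
  unfolding closed_subspace_def
proof (intro conjI ballI allI impI)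
  interpret V: csubspace X V by unfold_locales (rule V)
  show "ZV V \<subseteq> carr KN" using ZV_carr by (rule subsetI)
  obtain f where f: "f \<in> V" using V.sub_ne by blast
  show "ZV V \<noteq> {}" using Zk_ZV[OF f V.sub_carr[OF f]] by auto
  show "hadd KN \<Phi> \<Psi> \<in> ZV V" if \<Phi>: "\<Phi> \<in> ZV V" and \<Psi>: "\<Psi> \<in> ZV V" for \<Phi> \<Psi>
  proof -
    obtain f where f: "f \<in> V" "KN.hdist \<Phi> (Zk f) = 0" using \<Phi> by (rule ZV_E)
    obtain g where g: "g \<in> V" "KN.hdist \<Psi> (Zk g) = 0" using \<Psi> by (rule ZV_E)
    note c = ZV_carr[OF \<Phi>] ZV_carr[OF \<Psi>]
    note fc = V.sub_carr[OF f(1)] V.sub_carr[OF g(1)]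
    note zc = fc[THEN Zk_carr]
    have "KN.hdist (hadd KN \<Phi> \<Psi>) (Zk (hadd X f g)) \<le> 0"
      using KN.hdist_triangle[OF KN.add_closed[OF c] KN.add_closed[OF zc] Zk_carr[OF X.add_closed[OF fc]]]
        KN.hdist_add[OF c zc] Zk_add[OF fc] f(2) g(2) by linarith
    then have "KN.hdist (hadd KN \<Phi> \<Psi>) (Zk (hadd X f g)) = 0"
      using KN.hnorm_nonneg[OF KN.diff_closed[OF KN.add_closed[OF c] Zk_carr[OF X.add_closed[OF fc]]]] by linarith
    then show ?thesis
      using KN.add_closed[OF c] V.sub_add[OF f(1) g(1)] by (intro ZV_I)
  qed
  show "hscale KN a \<Phi> \<in> ZV V" if \<Phi>: "\<Phi> \<in> ZV V" for a \<Phi>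
  proof -
    obtain f where f: "f \<in> V" "KN.hdist \<Phi> (Zk f) = 0" using \<Phi> by (rule ZV_E)
    note c = ZV_carr[OF \<Phi>]
    note fc = V.sub_carr[OF f(1)]
    note zc = Zk_carr[OF fc]
    have "KN.hdist (hscale KN a \<Phi>) (hscale KN a (Zk f)) = 0"
      using KN.hdist_scale[OF c zc, of a] f(2) by simp
    then have "KN.hdist (hscale KN a \<Phi>) (Zk (hscale X a f)) \<le> 0"
      using KN.hdist_triangle[OF KN.scale_closed[OF c] KN.scale_closed[OF zc] Zk_carr[OF X.scale_closed[OF fc]], of a a a]
         Zk_scale[OF fc, of a] by linarith
    then have "KN.hdist (hscale KN a \<Phi>) (Zk (hscale X a f)) = 0"
      using KN.hnorm_nonneg[OF KN.diff_closed[OF KN.scale_closed[OF c] Zk_carr[OF X.scale_closed[OF fc]]], of a a] by linarith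
    then show ?thesis
      using KN.scale_closed[OF c] V.sub_scale[OF f(1)] by (intro ZV_I)
  qed
  show "\<Psi> \<in> ZV V" if \<Psi>: "\<Psi> \<in> carr KN" and u: "(\<forall>n. u n \<in> ZV V) \<and> (\<lambda>n::nat. KN.hdist (u n) \<Psi>) \<longlonglongrightarrow> 0" for u \<Psi>
  proof -
    have uc: "u n \<in> carr KN" for n by (rule ZV_carr[OF u[THEN conjunct1, THEN spec]])
    have "\<exists>f. f \<in> V \<and> KN.hdist (u n) (Zk f) = 0" for n
      using u[THEN conjunct1, rule_format, of n] unfolding ZV_iff by (elim conjE bexE) (intro exI conjI)
    then obtain f where f: "\<And>n. f n \<in> V" "\<And>n. KN.hdist (u n) (Zk (f n)) = 0" by metis
    have fc: "f n \<in> carr X" for n by (rule V.sub_carr[OF f(1)])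
    have zc: "Zk (f n) \<in> carr KN" for n by (rule Zk_carr[OF fc])
    have le: "KN.hdist (Zk (f n)) \<Psi> \<le> KN.hdist (u n) \<Psi>" for n
      using KN.hdist_triangle[OF zc uc \<Psi>, of n n] f(2)[of n] KN.hdist_commute[OF uc zc, of n n] by linarith
    have lim: "(\<lambda>n. KN.hdist (Zk (f n)) \<Psi>) \<longlonglongrightarrow> 0"
    proof (rule tendsto_sandwich[OF _ _ tendsto_const u[THEN conjunct2]])
      show "\<forall>\<^sub>F n in sequentially. 0 \<le> KN.hdist (Zk (f n)) \<Psi>"
        by (intro always_eventually allI KN.hnorm_nonneg KN.diff_closed zc \<Psi>)
      show "\<forall>\<^sub>F n in sequentially. KN.hdist (Zk (f n)) \<Psi> \<le> KN.hdist (u n) \<Psi>"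
        by (intro always_eventually allI le)
    qed
    have "\<exists>M. \<forall>i\<ge>M. \<forall>j\<ge>M. X.hdist (f i) (f j) < e" if e: "e > 0" for e
    proof -
      have "\<forall>\<^sub>F n in sequentially. KN.hdist (Zk (f n)) \<Psi> < e / 2"
        using e by (intro order_tendstoD(2)[OF lim]) simp
      then obtain M where M: "\<And>n. n \<ge> M \<Longrightarrow> KN.hdist (Zk (f n)) \<Psi> < e / 2"
        by (auto simp: eventually_sequentially)
      have "X.hdist (f i) (f j) < e" if "i \<ge> M" "j \<ge> M" for i j
        using KN.hdist_triangle[OF zc \<Psi> zc, of i j] M[OF that(1)] M[OF that(2)]
          KN.hdist_commute[OF \<Psi> zc, of j] Zk_dist[OF fc fc, of i j] by linarith
      then show ?thesis by blast
    qed
    then obtain g where g: "g \<in> carr X" "(\<lambda>n. X.hdist (f n) g) \<longlonglongrightarrow> 0"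
      using hcomplete_L2_scalars[of \<mu>, unfolded hcomplete_def, THEN spec[of _ f]] fc by blast
    have gV: "g \<in> V" by (rule V.sub_lim[OF g(1) f(1) g(2)])
    have "(\<lambda>n. KN.hdist (Zk (f n)) \<Psi> + X.hdist (f n) g) \<longlonglongrightarrow> 0 + 0"
      by (intro tendsto_add lim g(2))
    moreover have "KN.hdist \<Psi> (Zk g) \<le> KN.hdist (Zk (f n)) \<Psi> + X.hdist (f n) g" for n
      using KN.hdist_triangle[OF \<Psi> zc Zk_carr[OF g(1)], of n] KN.hdist_commute[OF \<Psi> zc, of n]
        Zk_dist[OF fc g(1), of n] by linarith
    ultimately have "KN.hdist \<Psi> (Zk g) \<le> 0 + 0"
      by (intro tendsto_le[OF sequentially_bot _ tendsto_const]) auto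
    then have "KN.hdist \<Psi> (Zk g) = 0"
      using KN.hnorm_nonneg[OF KN.diff_closed[OF \<Psi> Zk_carr[OF g(1)]]] by linarith
    then show ?thesis using \<Psi> gV by (intro ZV_I)
  qed
qed

section \<open>Multiplicatively invariant spaces over the section\<close>

text \<open>If \<tau> lies outside \<Gamma>, some \<open>a\<close> in the finite group of
  annihilating characters has \<open>char_of a \<tau> \<noteq> 1\<close>; translating the sum by
  \<open>a\<close> multiplies it by this number, so it is 0.\<close>

lemma sum_char_annihilator:
  "(\<Sum>i<Suc s. char_of (\<gamma>s i) \<tau>) = (if \<tau> \<in> \<Gamma> then of_nat (Suc s) else 0)"
proof (cases "\<tau> \<in> \<Gamma>")
  case True
  then have "char_of (\<gamma>s i) \<tau> = 1" if "i < Suc s" for i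
    using \<gamma>s_mem[of i] that by (simp add: annihilator_def)
  then show ?thesis using True by simp
next
  case False
  obtain a where a: "a \<in> annihilator \<Gamma>" "char_of a \<tau> \<noteq> 1"
    using annihilator_separates[OF \<Gamma> False] by blast
  note A = is_subgroupD[OF is_subgroup_annihilator[of \<Gamma>]]
  let ?S = "\<Sum>\<xi>\<in>annihilator \<Gamma>. char_of \<xi> \<tau>"
  have "bij_betw ((+) a) (annihilator \<Gamma>) (annihilator \<Gamma>)"
  proof (rule bij_betw_imageI)
    show "(+) a ` annihilator \<Gamma> = annihilator \<Gamma>"
    proof (intro equalityI subsetI)
      fix \<xi> assume "\<xi> \<in> annihilator \<Gamma>"
      then have "\<xi> - a \<in> annihilator \<Gamma>" "\<xi> = a + (\<xi> - a)" using A(4) a(1) by simp_all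
      then show "\<xi> \<in> (+) a ` annihilator \<Gamma>" by (rule rev_image_eqI)
    qed (use A(2) a(1) in auto)
  qed simp
  from sum.reindex_bij_betw[OF this, of "\<lambda>\<xi>. char_of \<xi> \<tau>"]
  have "char_of a \<tau> * ?S = ?S" by (simp add: sum_distrib_left)
  then have "?S = 0" using a(2) by simp
  then show ?thesis
    using sum.reindex_bij_betw[OF \<gamma>s, of "\<lambda>\<xi>. char_of \<xi> \<tau>"] False
    by (simp add: lessThan_Suc_atMost)
qed

text \<open>On \<open>\<Omega>\<close> a function is the periodization of its extension by zero, and the periodization
  of a character vanishes unless the character comes from \<open>\<Gamma>\<close>.\<close>

lemma section_monotone_class [consumes 2, case_names char add scale limit cong]:
  fixes P :: "('g dual \<Rightarrow> complex) \<Rightarrow> bool"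
  assumes g: "g \<in> borel_measurable borel" "\<And>\<eta>. cmod (g \<eta>) \<le> B"
    and P_char: "\<And>\<gamma>. \<gamma> \<in> \<Gamma> \<Longrightarrow> P (\<lambda>\<eta>. char_of \<eta> \<gamma>)"
    and P_add: "\<And>f g. f \<in> borel_measurable borel \<Longrightarrow> g \<in> borel_measurable borel \<Longrightarrow>
       P f \<Longrightarrow> P g \<Longrightarrow> P (\<lambda>\<eta>. f \<eta> + g \<eta>)"
    and P_scale: "\<And>c f. f \<in> borel_measurable borel \<Longrightarrow> P f \<Longrightarrow> P (\<lambda>\<eta>. c * f \<eta>)"
    and P_lim: "\<And>u f B. (\<And>n. u n \<in> borel_measurable borel) \<Longrightarrow> f \<in> borel_measurable borel \<Longrightarrow>
       (\<And>n. P (u n)) \<Longrightarrow> (\<And>n \<eta>. cmod (u n \<eta>) \<le> B) \<Longrightarrow> (\<And>\<eta>. (\<lambda>n::nat. u n \<eta>) \<longlonglongrightarrow> f \<eta>) \<Longrightarrow> P f"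
    and P_cong: "\<And>f g. (\<And>\<omega>. \<omega> \<in> \<Omega> \<Longrightarrow> f \<omega> = g \<omega>) \<Longrightarrow> P f \<Longrightarrow> P g"
  shows "P g"
proof -
  define per where "per h = (\<lambda>\<omega>. \<Sum>i<Suc s. h (\<omega> + \<gamma>s i))" for h :: "'g dual \<Rightarrow> complex"
  have per_meas: "per h \<in> borel_measurable borel" if "h \<in> borel_measurable borel" for h
    unfolding per_def by (intro borel_measurable_sum measurable_compose[OF measurable_shift that])
  \<comment> \<open>The class theorem on the whole dual is applied to the property
    \<open>h \<mapsto> P (per h)\<close>; periodization is linear and respects bounded pointwise
    limits because it is a finite sum.\<close>
  have "P (per (\<lambda>\<eta>. indicator \<Omega> \<eta> * g \<eta>))"
  proof (rule dual_monotone_class[where P = "\<lambda>h. P (per h)"])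
    show "(\<lambda>\<eta>. indicator \<Omega> \<eta> * g \<eta>) \<in> borel_measurable borel" using g(1) by measurable
    show "cmod (indicator \<Omega> \<eta> * g \<eta>) \<le> B" for \<eta>
      using g(2)[of \<eta>] order_trans[OF norm_ge_zero g(2)[of \<eta>]] by (simp add: indicator_def)
    show "P (per (\<lambda>\<eta>. char_of \<eta> \<tau>))" for \<tau>
    proof -
      have eq: "per (\<lambda>\<eta>. char_of \<eta> \<tau>) = (\<lambda>\<eta>. (if \<tau> \<in> \<Gamma> then of_nat (Suc s) else 0) * char_of \<eta> \<tau>)"
        by (simp add: per_def fun_eq_iff flip: sum_distrib_left sum_char_annihilator)
      show ?thesis
      proof (cases "\<tau> \<in> \<Gamma>")
        case True
        then show ?thesis unfolding eq by (intro P_scale P_char measurable_char_of_apply)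
      next
        case False
        \<comment> \<open>The zero function enters the class as a multiple of the exponential of
          \<open>0 \<in> \<Gamma>\<close>.\<close>
        have "P (\<lambda>\<eta>. 0 * char_of \<eta> 0)"
          using is_subgroupD(1)[OF \<Gamma>] by (intro P_scale P_char measurable_char_of_apply)
        then show ?thesis using False unfolding eq by simp
      qed
    qed
    show "P (per (\<lambda>\<eta>. f \<eta> + h \<eta>))"
      if "f \<in> borel_measurable borel" "h \<in> borel_measurable borel" "P (per f)" "P (per h)" for f h
      using P_add[OF per_meas[OF that(1)] per_meas[OF that(2)] that(3,4)] by (simp add: per_def sum.distrib)
    show "P (per (\<lambda>\<eta>. c * f \<eta>))" if "f \<in> borel_measurable borel" "P (per f)" for c f
      using P_scale[OF per_meas[OF that(1)] that(2), of c] by (simp add: per_def sum_distrib_left distrib_left)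
    fix u and f :: "'g dual \<Rightarrow> complex" and B :: real
    assume u: "\<And>n. u n \<in> borel_measurable borel" "f \<in> borel_measurable borel" "\<And>n. P (per (u n))"
      "\<And>n \<eta>. cmod (u n \<eta>) \<le> B" "\<And>\<eta>. (\<lambda>n::nat. u n \<eta>) \<longlonglongrightarrow> f \<eta>"
    show "P (per f)"
    proof (rule P_lim[OF per_meas[OF u(1)] per_meas[OF u(2)] u(3)])
      show "cmod (per (u n) \<eta>) \<le> (\<Sum>i<Suc s. B)" for n \<eta>
        unfolding per_def by (rule order_trans[OF norm_sum]) (intro sum_mono u(4))
      show "(\<lambda>n. per (u n) \<eta>) \<longlonglongrightarrow> per f \<eta>" for \<eta>
        unfolding per_def by (intro tendsto_sum u(5))
    qed
  qed
  moreover have "per (\<lambda>\<eta>. indicator \<Omega> \<eta> * g \<eta>) \<omega> = g \<omega>" if "\<omega> \<in> \<Omega>" for \<omega>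
  proof -
    obtain i0 where i0: "i0 \<le> s" "\<gamma>s i0 = 0" using \<gamma>s_0 by blast
    \<comment> \<open>A nonzero translate by an annihilating character leaves \<Omega>, so only the
      index of the trivial character survives.\<close>
    have "indicator \<Omega> (\<omega> + \<gamma>s i) * g (\<omega> + \<gamma>s i) = (if i = i0 then g \<omega> else 0)" if i: "i < Suc s" for i
    proof (cases "i = i0")
      case False
      then have "\<gamma>s i \<noteq> 0"
        using inj_onD[OF bij_betw_imp_inj_on[OF \<gamma>s], of i i0] i i0 by auto
      then show ?thesis using section_shift[OF \<open>\<omega> \<in> \<Omega>\<close>, of i] i False by simp
    qed (use \<open>\<omega> \<in> \<Omega>\<close> i0 in simp)
    then have "per (\<lambda>\<eta>. indicator \<Omega> \<eta> * g \<eta>) \<omega> = (\<Sum>i<Suc s. if i = i0 then g \<omega> else 0)"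
      unfolding per_def by (intro sum.cong) auto
    then show ?thesis using i0(1) by simp
  qed
  ultimately show ?thesis by (rule P_cong[rotated])
qed

text \<open>Vanishing against the exponentials spreads to all bounded Borel functions, among them
  the conjugate sign of \<open>f\<close>, against which the integral is that of
  \<open>cmod (f \<omega>)\<close>.\<close>

lemma determining_exponentials: "determining_set N (exponentials \<Gamma>)"
  unfolding determining_set_def
proof (intro conjI allI impI)
  show "exponentials \<Gamma> \<subseteq> Linf N"
    unfolding exponentials_def Linf_def by (auto intro!: measurable_N exI[of _ 1])
  fix f assume "integrable N f \<and> (\<forall>g\<in>exponentials \<Gamma>. (\<integral>y. f y * g y \<partial>N) = 0)"
  then have f: "integrable N f" and f0: "\<And>\<gamma>. \<gamma> \<in> \<Gamma> \<Longrightarrow> (\<integral>\<omega>. f \<omega> * char_of \<omega> \<gamma> \<partial>N) = 0"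
    by (auto simp: exponentials_def)
  have fm [measurable]: "f \<in> borel_measurable N" using f by simp
  have int: "integrable N (\<lambda>\<omega>. f \<omega> * g \<omega>)"
    if g: "g \<in> borel_measurable borel" and B: "\<And>\<eta>. cmod (g \<eta>) \<le> B" for g B
  proof (rule Bochner_Integration.integrable_bound)
    note [measurable] = measurable_N[OF g]
    show "(\<lambda>\<omega>. f \<omega> * g \<omega>) \<in> borel_measurable N" by measurable
    show "integrable N (\<lambda>\<omega>. B * norm (f \<omega>))" using f by simp
    have "norm (f \<omega> * g \<omega>) \<le> norm (B * norm (f \<omega>))" for \<omega>
    proof -
      have "norm (f \<omega>) * norm (g \<omega>) \<le> norm (f \<omega>) * B" by (intro mult_left_mono B) simp
      then show ?thesis using order_trans[OF norm_ge_zero B[of \<omega>]] by (simp add: norm_mult mult.commute)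
    qed
    then show "AE \<omega> in N. norm (f \<omega> * g \<omega>) \<le> norm (B * norm (f \<omega>))" by simp
  qed
  \<comment> \<open>Integrability is carried in the predicate so that the integral of a sum may be
    split.\<close>
  have all: "(\<integral>\<omega>. f \<omega> * g \<omega> \<partial>N) = 0 \<and> integrable N (\<lambda>\<omega>. f \<omega> * g \<omega>)"
    if g: "g \<in> borel_measurable borel" "\<And>\<eta>. cmod (g \<eta>) \<le> B" for g B
    using g
  proof (induction rule: section_monotone_class)
    case (char \<gamma>)
    then show ?case using f0 int[of "\<lambda>\<eta>. char_of \<eta> \<gamma>" 1] by simp
  next
    case (add f g)
    then show ?case by (simp add: distrib_left)
  next
    case (scale c f)
    then show ?case by (simp add: mult.left_commute)
  next
    case (limit u h B)
    have hB: "cmod (h \<eta>) \<le> B" for \<eta>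
      by (rule tendsto_upperbound[OF tendsto_norm[OF limit.hyps(4)]]) (simp_all add: limit.hyps(3))
    note [measurable] = measurable_N[OF limit(1)] measurable_N[OF limit(2)]
    have "(\<lambda>n. \<integral>\<omega>. f \<omega> * u n \<omega> \<partial>N) \<longlonglongrightarrow> (\<integral>\<omega>. f \<omega> * h \<omega> \<partial>N)"
    proof (rule integral_dominated_convergence[where w = "\<lambda>\<omega>. B * norm (f \<omega>)"])
      show "AE \<omega> in N. (\<lambda>n. f \<omega> * u n \<omega>) \<longlonglongrightarrow> f \<omega> * h \<omega>"
        by (intro AE_I2 tendsto_intros limit.hyps(4))
      show "integrable N (\<lambda>\<omega>. B * norm (f \<omega>))" using f by simp
      have "norm (f \<omega>) * norm (u n \<omega>) \<le> norm (f \<omega>) * B" for \<omega> n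
        by (intro mult_left_mono limit.hyps(3)) simp
      then show "AE \<omega> in N. norm (f \<omega> * u n \<omega>) \<le> B * norm (f \<omega>)" for n
        by (simp add: norm_mult mult.commute)
    qed measurable
    then have "(\<integral>\<omega>. f \<omega> * h \<omega> \<partial>N) = 0"
      using limit.IH by (simp add: LIMSEQ_const_iff)
    then show ?case using int[OF limit(2) hB] by blast
  next
    case (cong g h)
    have "(\<integral>\<omega>. f \<omega> * g \<omega> \<partial>N) = (\<integral>\<omega>. f \<omega> * h \<omega> \<partial>N)"
      by (rule Bochner_Integration.integral_cong) (simp_all add: cong(1))
    moreover have "integrable N (\<lambda>\<omega>. f \<omega> * g \<omega>) = integrable N (\<lambda>\<omega>. f \<omega> * h \<omega>)"
      by (rule Bochner_Integration.integrable_cong) (simp_all add: cong(1))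
    ultimately show ?case using cong(2) by simp
  qed
  \<comment> \<open>Extension by zero: the class theorem speaks of Borel functions on the whole
    dual, while \<open>f\<close> is measurable only on \<Omega>.\<close>
  define F where "F \<eta> = indicator \<Omega> \<eta> *\<^sub>R f \<eta>" for \<eta>
  have F: "F \<in> borel_measurable borel"
    using fm unfolding F_def by (simp add: borel_measurable_restrict_space_iff[OF \<Omega>_int])
  have "(\<integral>\<omega>. f \<omega> * cnj (sgn (F \<omega>)) \<partial>N) = 0"
  proof (rule all[THEN conjunct1])
    have "sgn \<in> borel_measurable (borel :: complex measure)"
      unfolding sgn_eq[abs_def] by measurable
    then show "(\<lambda>\<eta>. cnj (sgn (F \<eta>))) \<in> borel_measurable borel"
      by (intro borel_measurable_continuous_on[OF continuous_on_cnj[OF continuous_on_id]]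
          measurable_compose[OF F])
    show "cmod (cnj (sgn (F \<eta>))) \<le> 1" for \<eta> by (simp add: norm_sgn)
  qed
  moreover have "(\<integral>\<omega>. f \<omega> * cnj (sgn (F \<omega>)) \<partial>N) = (\<integral>\<omega>. complex_of_real (cmod (f \<omega>)) \<partial>N)"
  proof (rule Bochner_Integration.integral_cong[OF refl])
    fix \<omega> assume "\<omega> \<in> space N"
    then have "F \<omega> = f \<omega>" by (simp add: F_def)
    moreover have "z * cnj (sgn z) = complex_of_real (cmod z)" for z
    proof (cases "z = 0")
      case False
      have "z * cnj (sgn z) = z * cnj z / complex_of_real (cmod z)" by (simp add: sgn_eq)
      also have "\<dots> = complex_of_real (cmod z)"
        using False by (simp add: complex_norm_square[symmetric] power2_eq_square)
      finally show ?thesis .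
    qed simp
    ultimately show "f \<omega> * cnj (sgn (F \<omega>)) = complex_of_real (cmod (f \<omega>))" by simp
  qed
  ultimately have "(\<integral>\<omega>. cmod (f \<omega>) \<partial>N) = 0" by simp
  then have "AE \<omega> in N. cmod (f \<omega>) = 0"
    using f by (subst (asm) integral_nonneg_eq_0_iff_AE) auto
  then show "AE \<omega> in N. f \<omega> = 0" by simp
qed

lemma mult_carr_KN:
  assumes "\<Phi> \<in> carr KN" "g \<in> borel_measurable borel" "\<And>\<eta>. cmod (g \<eta>) \<le> B"
  shows "(\<lambda>\<omega> i x. g \<omega> * \<Phi> \<omega> i x) \<in> carr KN"
  using H.L2_scale_closed[OF assms(1) measurable_N[OF assms(2)] assms(3)] by (simp add: hpower_simps)

lemma hdist_KN_0:
  assumes "\<Phi> \<in> carr KN" "\<Psi> \<in> carr KN"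
  shows "KN.hdist \<Phi> \<Psi> = 0 \<longleftrightarrow> (AE \<omega> in N. \<forall>i\<le>s. L.hdist (\<Phi> \<omega> i) (\<Psi> \<omega> i) = 0)"
  unfolding H.hdist_L2_AE_0[OF assms]
proof (rule AE_cong)
  fix \<omega> assume "\<omega> \<in> space N"
  then have "\<Phi> \<omega> \<in> carr H" "\<Psi> \<omega> \<in> carr H"
    by (rule L2_carrD(1)[OF assms(1)], rule L2_carrD(1)[OF assms(2)])
  then show "H.hdist (\<Phi> \<omega>) (\<Psi> \<omega>) = 0 \<longleftrightarrow> (\<forall>i\<le>s. L.hdist (\<Phi> \<omega> i) (\<Psi> \<omega> i) = 0)"
    using L.hdist_hpower_0[of "\<Phi> \<omega>" "Suc s" "\<Psi> \<omega>"] by (simp only: less_Suc_eq_le)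
qed

text \<open>For fixed \<open>\<Phi>\<close> the admissible multipliers form a class to which
  \<open>section_monotone_class\<close> applies: dominated convergence turns bounded pointwise
  limits of multipliers into norm limits of products, and \<open>M\<close> is closed.\<close>

lemma MI_mult:
  assumes M: "closed_subspace KN M"
    and \<Gamma>M: "\<And>\<Phi> \<gamma>. \<Phi> \<in> M \<Longrightarrow> \<gamma> \<in> \<Gamma> \<Longrightarrow> (\<lambda>\<omega> i x. char_of \<omega> \<gamma> * \<Phi> \<omega> i x) \<in> M"
    and \<Phi>: "\<Phi> \<in> M" and g: "g \<in> borel_measurable borel" "\<And>\<eta>. cmod (g \<eta>) \<le> B"
  shows "(\<lambda>\<omega> i x. g \<omega> * \<Phi> \<omega> i x) \<in> M"
proof -
  interpret M: csubspace KN M by unfold_locales (rule M)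
  have \<Phi>c: "\<Phi> \<in> carr KN" using M.sub_carr[OF \<Phi>] .
  show ?thesis
    using g
  proof (induction rule: section_monotone_class)
    case (char \<gamma>)
    then show ?case using \<Gamma>M[OF \<Phi>] by simp
  next
    case (add f g)
    then show ?case using M.sub_add[OF add(3,4)] by (simp add: hpower_simps distrib_right)
  next
    case (scale c f)
    then show ?case using M.sub_scale[OF scale(2), of c] by (simp add: hpower_simps mult.assoc)
  next
    case (limit u h B)
    have hB: "cmod (h \<eta>) \<le> B" for \<eta>
      by (rule tendsto_upperbound[OF tendsto_norm[OF limit.hyps(4)]]) (simp_all add: limit.hyps(3))
    let ?m = "\<lambda>g \<omega> i x. g \<omega> * \<Phi> \<omega> i x"
    have hc: "?m h \<in> carr KN" by (rule mult_carr_KN[OF \<Phi>c limit(2) hB])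
    have uc: "?m (u n) \<in> carr KN" for n by (rule mult_carr_KN[OF \<Phi>c limit.hyps(1,3)])
    note [measurable] = measurable_N[OF limit(1)] measurable_N[OF limit(2)] H.L2_hnorm_measurable[OF \<Phi>c]
    have d: "(KN.hdist (?m (u n)) (?m h))\<^sup>2 = (\<integral>\<omega>. (cmod (u n \<omega> - h \<omega>))\<^sup>2 * (hnorm H (\<Phi> \<omega>))\<^sup>2 \<partial>N)" for n
    proof -
      have "(KN.hdist (?m (u n)) (?m h))\<^sup>2 = (\<integral>\<omega>. (H.hdist (?m (u n) \<omega>) (?m h \<omega>))\<^sup>2 \<partial>N)"
        using H.hnorm_L2[OF KN.diff_closed[OF uc[of n] hc]] by simp
      also have "\<dots> = (\<integral>\<omega>. (cmod (u n \<omega> - h \<omega>))\<^sup>2 * (hnorm H (\<Phi> \<omega>))\<^sup>2 \<partial>N)"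
      proof (rule Bochner_Integration.integral_cong[OF refl])
        fix \<omega> assume "\<omega> \<in> space N"
        then have "\<Phi> \<omega> \<in> carr H" by (rule L2_carrD(1)[OF \<Phi>c])
        from H.hdist_scale_left[OF this, of "u n \<omega>" "h \<omega>"]
        show "(H.hdist (?m (u n) \<omega>) (?m h \<omega>))\<^sup>2 = (cmod (u n \<omega> - h \<omega>))\<^sup>2 * (hnorm H (\<Phi> \<omega>))\<^sup>2"
          by (simp add: hpower_simps power_mult_distrib)
      qed
      finally show ?thesis .
    qed
    have "(\<lambda>n. \<integral>\<omega>. (cmod (u n \<omega> - h \<omega>))\<^sup>2 * (hnorm H (\<Phi> \<omega>))\<^sup>2 \<partial>N) \<longlonglongrightarrow> (\<integral>\<omega>. 0 \<partial>N)"
    \<comment> \<open>Both \<open>u n\<close> and its limit are bounded by \<open>B\<close>, so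
      their difference is bounded by \<open>2 * B\<close>.\<close>
    proof (rule integral_dominated_convergence[where w = "\<lambda>\<omega>. (2 * B)\<^sup>2 * (hnorm H (\<Phi> \<omega>))\<^sup>2"])
      have "(\<lambda>n. (cmod (u n \<omega> - h \<omega>))\<^sup>2 * (hnorm H (\<Phi> \<omega>))\<^sup>2) \<longlonglongrightarrow> (cmod (h \<omega> - h \<omega>))\<^sup>2 * (hnorm H (\<Phi> \<omega>))\<^sup>2" for \<omega>
        by (intro tendsto_intros limit.hyps(4))
      then show "AE \<omega> in N. (\<lambda>n. (cmod (u n \<omega> - h \<omega>))\<^sup>2 * (hnorm H (\<Phi> \<omega>))\<^sup>2) \<longlonglongrightarrow> 0" by simp
      show "integrable N (\<lambda>\<omega>. (2 * B)\<^sup>2 * (hnorm H (\<Phi> \<omega>))\<^sup>2)"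
        using L2_carrD(3)[OF \<Phi>c] by (rule integrable_mult_right)
      have "cmod (u n \<omega> - h \<omega>) \<le> 2 * B" for n \<omega>
        using norm_triangle_ineq4[of "u n \<omega>" "h \<omega>"] limit.hyps(3)[of n \<omega>] hB[of \<omega>] by linarith
      then have "(cmod (u n \<omega> - h \<omega>))\<^sup>2 * (hnorm H (\<Phi> \<omega>))\<^sup>2 \<le> (2 * B)\<^sup>2 * (hnorm H (\<Phi> \<omega>))\<^sup>2" for n \<omega>
        by (intro mult_right_mono power_mono) simp_all
      then show "AE \<omega> in N. norm ((cmod (u n \<omega> - h \<omega>))\<^sup>2 * (hnorm H (\<Phi> \<omega>))\<^sup>2) \<le> (2 * B)\<^sup>2 * (hnorm H (\<Phi> \<omega>))\<^sup>2" for n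
        by simp
    qed measurable
    then have "(\<lambda>n. (KN.hdist (?m (u n)) (?m h))\<^sup>2) \<longlonglongrightarrow> 0" unfolding d by simp
    then have "(\<lambda>n. sqrt ((KN.hdist (?m (u n)) (?m h))\<^sup>2)) \<longlonglongrightarrow> sqrt 0" by (rule tendsto_real_sqrt)
    moreover have "sqrt ((KN.hdist (?m (u n)) (?m h))\<^sup>2) = KN.hdist (?m (u n)) (?m h)" for n
      by (rule real_sqrt_unique[OF refl KN.hnorm_nonneg[OF KN.diff_closed[OF uc hc]]])
    ultimately have "(\<lambda>n. KN.hdist (?m (u n)) (?m h)) \<longlonglongrightarrow> 0" by (simp only: real_sqrt_zero)
    then show ?case by (rule M.sub_lim[OF hc limit.IH])
  next
    case (cong f g)
    have "(\<lambda>\<omega> i x. f \<omega> * \<Phi> \<omega> i x) \<in> carr KN" by (rule M.sub_carr[OF cong(2)])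
    moreover from this have gc: "(\<lambda>\<omega> i x. g \<omega> * \<Phi> \<omega> i x) \<in> carr KN"
      by (rule L2_carr_cong[THEN iffD1, rotated]) (simp add: cong(1))
    moreover have "AE \<omega> in N. H.hdist (\<lambda>i x. f \<omega> * \<Phi> \<omega> i x) (\<lambda>i x. g \<omega> * \<Phi> \<omega> i x) = 0"
    proof (rule AE_I2)
      fix \<omega> assume "\<omega> \<in> space N"
      then show "H.hdist (\<lambda>i x. f \<omega> * \<Phi> \<omega> i x) (\<lambda>i x. g \<omega> * \<Phi> \<omega> i x) = 0"
        using H.hdist_self[OF L2_carrD(1)[OF gc]] cong(1) by simp
    qed
    ultimately have "KN.hdist (\<lambda>\<omega> i x. f \<omega> * \<Phi> \<omega> i x) (\<lambda>\<omega> i x. g \<omega> * \<Phi> \<omega> i x) = 0"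
      by (subst H.hdist_L2_AE_0)
    then show ?case by (rule M.sub_cong[OF cong(2) gc])
  qed
qed

section \<open>Coordinate multipliers and the orthogonal decomposition\<close>

text \<open>A diagonal operator that does not depend on \<omega>. It covers both the characters
  \<open>i \<mapsto> (\<delta>, \<gamma>s i)\<close> and the coset projections, so the two sides of
  the equivalence can be compared as multipliers.\<close>

definition coord_mult :: "(nat \<Rightarrow> complex) \<Rightarrow> (nat \<Rightarrow> 'x \<Rightarrow> complex) \<Rightarrow> nat \<Rightarrow> 'x \<Rightarrow> complex" where
  "coord_mult c F = (\<lambda>i x. c i * F i x)"

lemma coord_mult_carr_H:
  assumes "F \<in> carr H"
  shows "coord_mult c F \<in> carr H"
proof -
  have "(\<lambda>x. c i * F i x) \<in> carr L" if "i < Suc s" for i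
    using L.scale_closed[of "F i" "c i"] assms that by (simp add: hpower_simps)
  then show ?thesis by (simp add: coord_mult_def hpower_simps)
qed

lemma inner_coord_mult:
  assumes F: "F \<in> carr H" and G: "G \<in> carr H"
  shows "hinner H (coord_mult c F) G = (\<Sum>i<Suc s. c i * hinner L (F i) (G i))"
    and "hinner H F (coord_mult c G) = (\<Sum>i<Suc s. cnj (c i) * hinner L (F i) (G i))"
proof -
  have 1: "hinner L (\<lambda>x. c i * F i x) (G i) = c i * hinner L (F i) (G i)"
    "hinner L (F i) (\<lambda>x. c i * G i x) = cnj (c i) * hinner L (F i) (G i)" if "i < Suc s" for i
    using L.inner_scale_left[of "F i" "G i" "c i"] L.inner_scale_right[of "G i" "F i" "c i"] F G that
    by (simp_all add: hpower_simps)
  show "hinner H (coord_mult c F) G = (\<Sum>i<Suc s. c i * hinner L (F i) (G i))"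
    unfolding hpower_simps coord_mult_def by (intro sum.cong refl 1) simp
  show "hinner H F (coord_mult c G) = (\<Sum>i<Suc s. cnj (c i) * hinner L (F i) (G i))"
    unfolding hpower_simps coord_mult_def by (intro sum.cong refl 1) simp
qed

text \<open>Weak measurability follows by moving the multiplier to the fixed vector, where it
  becomes its conjugate. The norm is not linear and needs the route through
  \<open>H.inner_measurable\<close>.\<close>

lemma coord_mult_carr:
  assumes \<Phi>: "\<Phi> \<in> carr KN"
  shows "(\<lambda>\<omega>. coord_mult c (\<Phi> \<omega>)) \<in> carr KN"
proof -
  note \<Phi>H = L2_carrD(1)[OF \<Phi>]
  have cH: "coord_mult c (\<Phi> \<omega>) \<in> carr H" if "\<omega> \<in> space N" for c \<omega>
    by (rule coord_mult_carr_H[OF \<Phi>H[OF that]])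
  have weak: "(\<lambda>\<omega>. hinner H (coord_mult c (\<Phi> \<omega>)) h) \<in> borel_measurable N" if h: "h \<in> carr H" for c h
  proof -
    have "(\<lambda>\<omega>. hinner H (\<Phi> \<omega>) (coord_mult (\<lambda>i. cnj (c i)) h)) \<in> borel_measurable N"
      by (rule L2_carrD(2)[OF \<Phi> coord_mult_carr_H[OF h]])
    then show ?thesis
      by (rule measurable_cong[THEN iffD1, rotated]) (simp only: inner_coord_mult \<Phi>H h complex_cnj_cnj)
  qed
  \<comment> \<open>With the weights \<open>(cmod (c i))\<^sup>2\<close> the squared norm of the
    product becomes an inner product of two weakly measurable functions.\<close>
  define c2 where "c2 i = complex_of_real ((cmod (c i))\<^sup>2)" for i
  have norm_eq: "(hnorm H (coord_mult c (\<Phi> \<omega>)))\<^sup>2 = (\<Sum>i<Suc s. (cmod (c i))\<^sup>2 * (hnorm L (\<Phi> \<omega> i))\<^sup>2)"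
    if \<omega>: "\<omega> \<in> space N" for \<omega>
  proof -
    have "hnorm L (\<lambda>x. c i * \<Phi> \<omega> i x) = cmod (c i) * hnorm L (\<Phi> \<omega> i)" if "i < Suc s" for i
      using L.hnorm_scale[of "\<Phi> \<omega> i" "c i"] \<Phi>H[OF \<omega>] that by (simp add: hpower_simps)
    then show ?thesis
      unfolding L.hnorm_hpower[OF cH[OF \<omega>]] by (intro sum.cong) (auto simp: coord_mult_def power_mult_distrib)
  qed
  have inner_eq: "Re (hinner H (coord_mult c2 (\<Phi> \<omega>)) (\<Phi> \<omega>)) = (hnorm H (coord_mult c (\<Phi> \<omega>)))\<^sup>2"
    if \<omega>: "\<omega> \<in> space N" for \<omega>
  proof -
    have "hinner L (\<Phi> \<omega> i) (\<Phi> \<omega> i) = complex_of_real ((hnorm L (\<Phi> \<omega> i))\<^sup>2)" if "i < Suc s" for i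
      using \<Phi>H[OF \<omega>] that by (intro L.inner_self) (simp add: hpower_simps)
    then show ?thesis
      unfolding norm_eq[OF \<omega>] inner_coord_mult(1)[OF \<Phi>H[OF \<omega>] \<Phi>H[OF \<omega>]] Re_sum
      by (intro sum.cong) (auto simp: c2_def simp flip: of_real_mult simp del: of_real_power)
  qed
  have meas: "(\<lambda>\<omega>. (hnorm H (coord_mult c (\<Phi> \<omega>)))\<^sup>2) \<in> borel_measurable N"
  proof -
    have "(\<lambda>\<omega>. hinner H (coord_mult c2 (\<Phi> \<omega>)) (\<Phi> \<omega>)) \<in> borel_measurable N"
    proof (rule H.inner_measurable)
      show "\<forall>\<omega>\<in>space N. coord_mult c2 (\<Phi> \<omega>) \<in> carr H" using cH by (rule ballI)
      show "\<forall>h\<in>carr H. (\<lambda>\<omega>. hinner H (coord_mult c2 (\<Phi> \<omega>)) h) \<in> borel_measurable N"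
        using weak by (rule ballI)
      show "\<forall>\<omega>\<in>space N. \<Phi> \<omega> \<in> carr H" using \<Phi>H by (rule ballI)
      show "\<forall>h\<in>carr H. (\<lambda>\<omega>. hinner H (\<Phi> \<omega>) h) \<in> borel_measurable N"
        using L2_carrD(2)[OF \<Phi>] by (rule ballI)
      show "(\<lambda>\<omega>. (hnorm H (\<Phi> \<omega>))\<^sup>2) \<in> borel_measurable N"
        using L2_carrD(3)[OF \<Phi>] by (rule borel_measurable_integrable)
    qed
    then have "(\<lambda>\<omega>. Re (hinner H (coord_mult c2 (\<Phi> \<omega>)) (\<Phi> \<omega>))) \<in> borel_measurable N" by measurable
    then show ?thesis
      by (rule measurable_cong[THEN iffD1, rotated]) (rule inner_eq)
  qed
  have "integrable N (\<lambda>\<omega>. (hnorm H (coord_mult c (\<Phi> \<omega>)))\<^sup>2)"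
  proof (rule Bochner_Integration.integrable_bound[OF _ meas])
    let ?c = "\<Sum>i<Suc s. (cmod (c i))\<^sup>2"
    show "integrable N (\<lambda>\<omega>. ?c * (hnorm H (\<Phi> \<omega>))\<^sup>2)"
      using L2_carrD(3)[OF \<Phi>] by (rule integrable_mult_right)
    show "AE \<omega> in N. norm ((hnorm H (coord_mult c (\<Phi> \<omega>)))\<^sup>2) \<le> norm (?c * (hnorm H (\<Phi> \<omega>))\<^sup>2)"
    proof (rule AE_I2)
      fix \<omega> assume \<omega>: "\<omega> \<in> space N"
      have "(\<Sum>i<Suc s. (cmod (c i))\<^sup>2 * (hnorm L (\<Phi> \<omega> i))\<^sup>2) \<le> (\<Sum>i<Suc s. ?c * (hnorm L (\<Phi> \<omega> i))\<^sup>2)"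
        by (intro sum_mono mult_right_mono member_le_sum) auto
      also have "\<dots> = ?c * (hnorm H (\<Phi> \<omega>))\<^sup>2"
        unfolding L.hnorm_hpower[OF \<Phi>H[OF \<omega>]] by (rule sum_distrib_left[symmetric])
      finally have le: "(hnorm H (coord_mult c (\<Phi> \<omega>)))\<^sup>2 \<le> ?c * (hnorm H (\<Phi> \<omega>))\<^sup>2"
        unfolding norm_eq[OF \<omega>] .
      moreover have "0 \<le> ?c * (hnorm H (\<Phi> \<omega>))\<^sup>2" by (intro mult_nonneg_nonneg sum_nonneg) simp_all
      ultimately show "norm ((hnorm H (coord_mult c (\<Phi> \<omega>)))\<^sup>2) \<le> norm (?c * (hnorm H (\<Phi> \<omega>))\<^sup>2)"
        unfolding real_norm_def abs_of_nonneg[OF zero_le_power2] by linarith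
    qed
  qed
  then show ?thesis
    unfolding L2_carr_iff[of _ N] using cH weak by blast
qed

lemma hdist_coord_mult_eq:
  assumes "F \<in> carr H" "G \<in> carr H" "i \<le> s" "L.hdist (F i) (G i) = 0" "c i = d i"
  shows "L.hdist (coord_mult c F i) (coord_mult d G i) = 0"
  using L.hdist_scale[of "F i" "G i" "c i"] assms by (simp add: coord_mult_def hpower_simps)

lemma KN_coord_mult_cong:
  assumes "\<Phi> \<in> carr KN" "\<Psi> \<in> carr KN" "KN.hdist \<Phi> \<Psi> = 0" "\<And>i. i \<le> s \<Longrightarrow> c i = d i"
  shows "KN.hdist (\<lambda>\<omega>. coord_mult c (\<Phi> \<omega>)) (\<lambda>\<omega>. coord_mult d (\<Psi> \<omega>)) = 0"
  unfolding hdist_KN_0[OF coord_mult_carr[OF assms(1)] coord_mult_carr[OF assms(2)]]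
proof (rule AE_mp[OF hdist_KN_0[THEN iffD1, OF assms(1-3)] AE_I2], intro impI allI)
  fix \<omega> i assume "\<omega> \<in> space N" "\<forall>i\<le>s. L.hdist (\<Phi> \<omega> i) (\<Psi> \<omega> i) = 0" "i \<le> s"
  then show "L.hdist (coord_mult c (\<Phi> \<omega>) i) (coord_mult d (\<Psi> \<omega>) i) = 0"
    using L2_carrD(1)[OF assms(1)] L2_carrD(1)[OF assms(2)] assms(4)
    by (intro hdist_coord_mult_eq) auto
qed

lemma KN_coord_mult_1:
  assumes "\<Phi> \<in> carr KN" "\<And>i. i \<le> s \<Longrightarrow> c i = 1"
  shows "KN.hdist (\<lambda>\<omega>. coord_mult c (\<Phi> \<omega>)) \<Phi> = 0"
  using KN_coord_mult_cong[OF assms(1,1) KN.hdist_self[OF assms(1)], of c "\<lambda>_. 1"] assms(2)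
  by (simp add: coord_mult_def)

end

section \<open>The coset decomposition and the fibrewise projections\<close>

locale zak_refined = zak_section \<mu> \<sigma> J m C \<Gamma> \<gamma>s s \<Omega>
  for \<mu> :: "'x measure" and \<sigma> :: "'g::{ab_group_add,countable} \<Rightarrow> 'x \<Rightarrow> 'x"
    and J :: "'g \<Rightarrow> 'x \<Rightarrow> real" and m :: "'g dual measure" and C :: "'x set"
    and \<Gamma> :: "'g set" and \<gamma>s :: "nat \<Rightarrow> 'g dual" and s :: nat and \<Omega> :: "'g dual set" +
  fixes \<Delta> :: "'g set" and \<N> :: "'g dual set"
  assumes \<N>: "is_section \<N> (annihilator \<Gamma>) (annihilator \<Delta>)"
begin

abbreviation HP where "HP \<equiv> H_part \<mu> C \<gamma>s s \<Delta>"

text \<open>Complex-valued so that it can serve as a coordinate multiplier;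
  \<open>coord_mult (mask \<xi>)\<close> is the orthogonal projection onto
  \<open>HP \<xi>\<close>.\<close>

definition mask :: "'g dual \<Rightarrow> nat \<Rightarrow> complex" where
  "mask \<xi> i = (if \<gamma>s i \<in> coset \<xi> (annihilator \<Delta>) then 1 else 0)"

lemma finite_\<N>: "finite \<N>"
proof -
  have "finite (annihilator \<Gamma>)" using bij_betw_finite[OF \<gamma>s] by simp
  then show ?thesis using \<N> finite_subset unfolding is_section_def by blast
qed

text \<open>The section property places \<xi> in the coset of \<open>\<gamma>s i\<close>, whereas
  \<open>H_part\<close> places \<open>\<gamma>s i\<close> in the coset of \<xi>; symmetry of the
  coset relation connects them.\<close>

lemma \<N>_unique: "i \<le> s \<Longrightarrow> \<exists>!\<xi>. \<xi> \<in> \<N> \<and> \<gamma>s i \<in> coset \<xi> (annihilator \<Delta>)"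
proof -
  assume i: "i \<le> s"
  have sym: "\<xi> - \<gamma>s i \<in> annihilator \<Delta> \<longleftrightarrow> \<gamma>s i - \<xi> \<in> annihilator \<Delta>" for \<xi>
    using is_subgroupD(3)[OF is_subgroup_annihilator[of \<Delta>], of "\<xi> - \<gamma>s i"]
      is_subgroupD(3)[OF is_subgroup_annihilator[of \<Delta>], of "\<gamma>s i - \<xi>"] by auto
  have "\<exists>!\<xi>. \<xi> \<in> \<N> \<and> \<xi> \<in> coset (\<gamma>s i) (annihilator \<Delta>)"
    using \<N> \<gamma>s_mem[OF i] unfolding is_section_def cosets_def by blast
  then show ?thesis by (simp only: coset_iff sym)
qed

text \<open>At each index exactly one mask is 1. With \<open>a = 1\<close> the masks form a
  partition of unity; with the character values as coefficients they express a multiplier that is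
  constant on cosets.\<close>

lemma sum_mask:
  assumes "i \<le> s"
  shows "(\<Sum>\<xi>\<in>\<N>. a \<xi> * mask \<xi> i) = a (THE \<xi>. \<xi> \<in> \<N> \<and> \<gamma>s i \<in> coset \<xi> (annihilator \<Delta>))"
proof -
  obtain \<xi>0 where \<xi>0: "\<And>\<xi>. \<xi> \<in> \<N> \<and> \<gamma>s i \<in> coset \<xi> (annihilator \<Delta>) \<longleftrightarrow> \<xi> = \<xi>0"
    by (rule ex1E[OF \<N>_unique[OF assms]]) blast
  have "(\<Sum>\<xi>\<in>\<N>. a \<xi> * mask \<xi> i) = (\<Sum>\<xi>\<in>\<N>. if \<xi> = \<xi>0 then a \<xi> else 0)"
    using \<xi>0 by (intro sum.cong) (auto simp: mask_def)
  also have "\<dots> = a \<xi>0" using \<xi>0[of \<xi>0] finite_\<N> by simp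
  finally show ?thesis using \<xi>0 by simp
qed

lemma HP_iff: "F \<in> HP \<xi> \<longleftrightarrow> F \<in> carr H \<and> (\<forall>i\<le>s. mask \<xi> i = 0 \<longrightarrow> hnorm L (F i) = 0)"
  by (auto simp: H_part_def mask_def)

lemma carr_H_D: "F \<in> carr H \<Longrightarrow> i \<le> s \<Longrightarrow> F i \<in> carr L"
  by (simp add: hpower_simps)

lemma coord_mult_mask_HP:
  assumes "F \<in> carr H"
  shows "coord_mult (mask \<xi>) F \<in> HP \<xi>"
  unfolding HP_iff
proof (intro conjI allI impI)
  show "coord_mult (mask \<xi>) F \<in> carr H" by (rule coord_mult_carr_H[OF assms])
  fix i assume i: "i \<le> s" "mask \<xi> i = 0"
  then show "hnorm L (coord_mult (mask \<xi>) F i) = 0"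
    using L.hnorm_scale[OF carr_H_D[OF assms i(1)], of 0] by (simp add: coord_mult_def)
qed

lemma closed_subspace_HP: "closed_subspace H (HP \<xi>)"
  unfolding closed_subspace_def
proof (intro conjI ballI allI impI)
  show "HP \<xi> \<subseteq> carr H" using HP_iff by blast
  obtain F where "F \<in> carr H" using H.carr_ne by blast
  then show "HP \<xi> \<noteq> {}" using coord_mult_mask_HP by blast
  show "hadd H F G \<in> HP \<xi>" if F: "F \<in> HP \<xi>" and G: "G \<in> HP \<xi>" for F G
  proof -
    have c: "F \<in> carr H" "G \<in> carr H" using F G HP_iff by auto
    have "hnorm L (hadd H F G i) = 0" if "i \<le> s" "mask \<xi> i = 0" for i
      using L.hnorm_0_subspace[of "F i" "G i"] F G that c[THEN carr_H_D, OF that(1)]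
      by (simp add: HP_iff hpower_simps)
    then show ?thesis using H.add_closed[OF c] HP_iff by blast
  qed
  show "hscale H a F \<in> HP \<xi>" if F: "F \<in> HP \<xi>" for a F
  proof -
    have c: "F \<in> carr H" using F HP_iff by auto
    have "hnorm L (hscale H a F i) = 0" if "i \<le> s" "mask \<xi> i = 0" for i
      using L.hnorm_scale[OF carr_H_D[OF c that(1)], of a] F that by (simp add: HP_iff hpower_simps)
    then show ?thesis using H.scale_closed[OF c] HP_iff by blast
  qed
  show "F \<in> HP \<xi>" if F: "F \<in> carr H" and u: "(\<forall>n. u n \<in> HP \<xi>) \<and> (\<lambda>n::nat. H.hdist (u n) F) \<longlonglongrightarrow> 0" for u F
    unfolding HP_iff
  proof (intro conjI allI impI F)
    fix i assume i: "i \<le> s" "mask \<xi> i = 0"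
    have un: "u n \<in> HP \<xi>" for n using u by blast
    have uc: "u n \<in> carr H" for n using un HP_iff by blast
    \<comment> \<open>Off the coset the entries of \<open>u n\<close> have norm 0, so the norm of
      \<open>F i\<close> is at most the distance from \<open>u n\<close> to \<open>F\<close>, which
      tends to 0.\<close>
    have "hnorm L (F i) \<le> H.hdist (u n) F" for n
    proof -
      have "hnorm L (u n i) = 0" using un i HP_iff by blast
      then have "hnorm L (F i) \<le> L.hdist (u n i) (F i)"
        using L.hnorm_diff_le[OF carr_H_D[OF uc i(1), of n] carr_H_D[OF F i(1)]] by linarith
      also have "\<dots> \<le> H.hdist (u n) F"
        using i(1) by (intro L.hdist_component_le uc F) simp
      finally show ?thesis .
    qed
    then have "hnorm L (F i) \<le> 0"
      using tendsto_lowerbound[OF u[THEN conjunct2]] by (metis (no_types, lifting) always_eventually sequentially_bot)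
    then show "hnorm L (F i) = 0" using L.hnorm_nonneg[OF carr_H_D[OF F i(1)]] by linarith
  qed
qed

text \<open>\<open>T\<close> is abstract because the argument serves twice: for a single tuple in
  \<open>H\<close>, and for functions on \<Omega> in \<open>KN\<close>. The hypothesis
  \<open>zero\<close> covers the empty sum.\<close>

lemma sum_coord_mult_mem:
  assumes M: "csubspace H' M" and "finite A"
    and mem: "\<And>\<xi>. \<xi> \<in> A \<Longrightarrow> T (f \<xi>) \<in> M" and zero: "T (\<lambda>_. 0) \<in> M"
    and T: "\<And>c d. T (\<lambda>i::nat. c i + d i) = hadd H' (T c) (T (d :: nat \<Rightarrow> complex))"
  shows "T (\<lambda>i. \<Sum>\<xi>\<in>A. f \<xi> i) \<in> M"
  using assms(2) mem
proof (induction A rule: finite_induct)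
  case (insert \<xi> A)
  then have "hadd H' (T (f \<xi>)) (T (\<lambda>i. \<Sum>\<xi>\<in>A. f \<xi> i)) \<in> M"
    by (intro csubspace.sub_add[OF M]) auto
  then show ?case using insert(1,2) by (simp flip: T)
qed (simp add: zero)

text \<open>An index belongs to one coset only, so in every coordinate one of the two factors has
  norm 0. A subspace containing all summands contains the masked parts of each tuple, and these add
  up to it.\<close>

lemma orthogonal_decomposition_HP: "orthogonal_decomposition H \<N> HP"
  unfolding orthogonal_decomposition_def
proof (intro conjI ballI allI impI)
  show "closed_subspace H (HP \<xi>)" for \<xi> by (rule closed_subspace_HP)
  fix \<xi> \<xi>' F G assume \<xi>: "\<xi> \<in> \<N>" "\<xi>' \<in> \<N>" "\<xi> \<noteq> \<xi>'" and F: "F \<in> HP \<xi>" and G: "G \<in> HP \<xi>'"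
  have "hinner L (F i) (G i) = 0" if i: "i < Suc s" for i
  proof (rule L.inner_hnorm_0)
    have i: "i \<le> s" using i by simp
    have "mask \<xi> i = 0 \<or> mask \<xi>' i = 0"
      by (rule ex1E[OF \<N>_unique[OF i]]) (use \<xi> in \<open>auto simp: mask_def\<close>)
    then show "hnorm L (F i) = 0 \<or> hnorm L (G i) = 0" using F G i HP_iff by blast
    show "F i \<in> carr L" "G i \<in> carr L" using F G i HP_iff carr_H_D by blast+
  qed
  then show "hinner H F G = 0" by (simp add: hpower_simps)
next
  fix M assume M: "closed_subspace H M \<and> (\<forall>\<xi>\<in>\<N>. HP \<xi> \<subseteq> M)"
  interpret M: csubspace H M by unfold_locales (use M in blast)
  have "F \<in> M" if F: "F \<in> carr H" for F
  proof -
    have "coord_mult (\<lambda>i. \<Sum>\<xi>\<in>\<N>. mask \<xi> i) F \<in> M"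
    proof (rule sum_coord_mult_mem[where T = "\<lambda>c. coord_mult c F", OF M.csubspace_axioms finite_\<N>])
      show "coord_mult (mask \<xi>) F \<in> M" if "\<xi> \<in> \<N>" for \<xi>
        using M that coord_mult_mask_HP[OF F] by blast
      obtain G where G: "G \<in> M" using M.sub_ne by blast
      have "H.hdist (hscale H 0 G) (coord_mult (\<lambda>_. 0) F) = 0"
        using H.hdist_self[OF coord_mult_carr_H[OF F, of "\<lambda>_. 0"]] by (simp add: hpower_simps coord_mult_def)
      then show "coord_mult (\<lambda>_. 0) F \<in> M"
        by (rule M.sub_cong[OF M.sub_scale[OF G] coord_mult_carr_H[OF F]])
    qed (simp add: coord_mult_def hpower_simps distrib_right)
    moreover have "H.hdist (coord_mult (\<lambda>i. \<Sum>\<xi>\<in>\<N>. mask \<xi> i) F) F = 0"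
      unfolding L.hdist_hpower_0[OF coord_mult_carr_H[OF F] F]
    proof (intro allI impI)
      fix i assume "i < Suc s"
      then have i: "i \<le> s" by simp
      have "(\<Sum>\<xi>\<in>\<N>. mask \<xi> i) = 1" using sum_mask[OF i, of "\<lambda>_. 1"] by simp
      then show "L.hdist (coord_mult (\<lambda>i. \<Sum>\<xi>\<in>\<N>. mask \<xi> i) F i) (F i) = 0"
        using L.hdist_self[OF carr_H_D[OF F i]] by (simp add: coord_mult_def)
    qed
    ultimately show ?thesis by (rule M.sub_cong[OF _ F])
  qed
  then show "M = carr H" using M.sub_carr by blast
qed

lemma is_oproj_mask:
  assumes F: "F \<in> carr H"
  shows "is_oproj H (HP \<xi>) F (coord_mult (mask \<xi>) F)"
  unfolding is_oproj_def
proof (intro conjI ballI coord_mult_mask_HP[OF F])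
  fix G assume G: "G \<in> HP \<xi>"
  have Gc: "G \<in> carr H" using G HP_iff by blast
  have "hinner L (F i) (G i) = mask \<xi> i * hinner L (F i) (G i)" if i: "i < Suc s" for i
  proof (cases "mask \<xi> i = 0")
    case True
    then have "hnorm L (G i) = 0" using G i HP_iff by (simp add: less_Suc_eq_le)
    then have "hinner L (F i) (G i) = 0"
      using carr_H_D[OF F] carr_H_D[OF Gc] i by (intro L.inner_hnorm_0) auto
    then show ?thesis by simp
  qed (auto simp: mask_def)
  then have "hinner H F G = (\<Sum>i<Suc s. mask \<xi> i * hinner L (F i) (G i))"
    unfolding hpower_simps by (intro sum.cong) auto
  then have "hinner H F G = hinner H (coord_mult (mask \<xi>) F) G"
    by (simp only: inner_coord_mult[OF F Gc])
  then show "hinner H (hdiff H F (coord_mult (mask \<xi>) F)) G = 0"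
    by (simp only: H.inner_diff_left[OF F coord_mult_carr_H[OF F] Gc] diff_self)
qed

text \<open>Two candidates differ by an element of \<open>HP \<xi>\<close> to which both residuals
  are orthogonal; this difference is orthogonal to itself.\<close>

lemma is_oproj_unique:
  assumes F: "F \<in> carr H" and P: "is_oproj H (HP \<xi>) F P"
  shows "H.hdist (coord_mult (mask \<xi>) F) P = 0"
proof -
  interpret S: csubspace H "HP \<xi>" by unfold_locales (rule closed_subspace_HP)
  let ?Q = "coord_mult (mask \<xi>) F"
  have Q: "is_oproj H (HP \<xi>) F ?Q" by (rule is_oproj_mask[OF F])
  have mem: "P \<in> HP \<xi>" "?Q \<in> HP \<xi>" using P Q by (auto simp: is_oproj_def)
  have d: "hdiff H ?Q P \<in> HP \<xi>" by (rule S.sub_diff[OF mem(2,1)])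
  note c = S.sub_carr[OF mem(1)] S.sub_carr[OF mem(2)] S.sub_carr[OF d]
  have "hinner H (hdiff H F P) (hdiff H ?Q P) = 0" "hinner H (hdiff H F ?Q) (hdiff H ?Q P) = 0"
    using P Q d by (auto simp: is_oproj_def)
  then have "hinner H (hdiff H ?Q P) (hdiff H ?Q P) = 0"
    by (simp only: H.inner_diff_left[OF F c(1) c(3)] H.inner_diff_left[OF F c(2) c(3)]
        H.inner_diff_left[OF c(2) c(1) c(3)]) simp
  then show ?thesis by (simp add: hnorm_def)
qed

text \<open>Replaces the relation \<open>is_oproj\<close>, which fixes a projection only up to
  distance 0 and almost everywhere, by an explicit operator; the closed subspace absorbs the
  ambiguity.\<close>

lemma proj_image_iff:
  assumes M: "closed_subspace KN M"
  shows "proj_image N H (HP \<xi>) M \<subseteq> M \<longleftrightarrow> (\<forall>\<Phi>\<in>M. (\<lambda>\<omega>. coord_mult (mask \<xi>) (\<Phi> \<omega>)) \<in> M)"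
proof -
  interpret M: csubspace KN M by unfold_locales (rule M)
  show ?thesis
  proof (intro iffI ballI subsetI)
    fix \<Phi> assume sub: "proj_image N H (HP \<xi>) M \<subseteq> M" and \<Phi>: "\<Phi> \<in> M"
    have c: "\<Phi> \<in> carr KN" by (rule M.sub_carr[OF \<Phi>])
    have "AE \<omega> in N. is_oproj H (HP \<xi>) (\<Phi> \<omega>) (coord_mult (mask \<xi>) (\<Phi> \<omega>))"
      by (intro AE_I2 is_oproj_mask L2_carrD(1)[OF c])
    then have "(\<lambda>\<omega>. coord_mult (mask \<xi>) (\<Phi> \<omega>)) \<in> proj_image N H (HP \<xi>) M"
      unfolding proj_image_def mem_Collect_eq by (intro conjI coord_mult_carr[OF c] bexI[OF _ \<Phi>])
    then show "(\<lambda>\<omega>. coord_mult (mask \<xi>) (\<Phi> \<omega>)) \<in> M" by (rule subsetD[OF sub])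
  next
    fix \<Psi> assume all: "\<forall>\<Phi>\<in>M. (\<lambda>\<omega>. coord_mult (mask \<xi>) (\<Phi> \<omega>)) \<in> M" and "\<Psi> \<in> proj_image N H (HP \<xi>) M"
    then obtain \<Phi> where \<Psi>: "\<Psi> \<in> carr KN" and \<Phi>: "\<Phi> \<in> M"
      and AE: "AE \<omega> in N. is_oproj H (HP \<xi>) (\<Phi> \<omega>) (\<Psi> \<omega>)"
      unfolding proj_image_def mem_Collect_eq by (elim conjE bexE)
    have c: "\<Phi> \<in> carr KN" by (rule M.sub_carr[OF \<Phi>])
    have "KN.hdist (\<lambda>\<omega>. coord_mult (mask \<xi>) (\<Phi> \<omega>)) \<Psi> = 0"
      unfolding H.hdist_L2_AE_0[OF coord_mult_carr[OF c] \<Psi>]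
      by (rule AE_mp[OF AE AE_I2]) (intro impI is_oproj_unique L2_carrD(1)[OF c])
    then show "\<Psi> \<in> M" by (rule M.sub_cong[OF bspec[OF all \<Phi>] \<Psi>])
  qed
qed

section \<open>Shifts on the transform side and the equivalence\<close>

lemma KN_mult_cong:
  assumes c: "\<Phi> \<in> carr KN" "\<Psi> \<in> carr KN" and d: "KN.hdist \<Phi> \<Psi> = 0"
    and g: "g \<in> borel_measurable borel" "\<And>\<eta>. cmod (g \<eta>) \<le> B"
  shows "KN.hdist (\<lambda>\<omega> i x. g \<omega> * \<Phi> \<omega> i x) (\<lambda>\<omega> i x. g \<omega> * \<Psi> \<omega> i x) = 0"
  unfolding H.hdist_L2_AE_0[OF mult_carr_KN[OF c(1) g] mult_carr_KN[OF c(2) g]]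
proof (rule AE_mp[OF H.hdist_L2_AE_0[THEN iffD1, OF c d] AE_I2], intro impI)
  fix \<omega> assume "\<omega> \<in> space N" "H.hdist (\<Phi> \<omega>) (\<Psi> \<omega>) = 0"
  then show "H.hdist (\<lambda>i x. g \<omega> * \<Phi> \<omega> i x) (\<lambda>i x. g \<omega> * \<Psi> \<omega> i x) = 0"
    using H.hdist_scale[OF L2_carrD(1)[OF c(1)] L2_carrD(1)[OF c(2)], of \<omega> \<omega> "g \<omega>"]
    by (simp add: hpower_simps)
qed

text \<open>The operator to which Z carries the representation. It is defined for arbitrary
  functions because elements of \<open>ZV V\<close> are merely at distance 0 from some
  \<open>Zk f\<close>.\<close>

definition Zshift :: "'g \<Rightarrow> ('g dual \<Rightarrow> nat \<Rightarrow> 'x \<Rightarrow> complex) \<Rightarrow> 'g dual \<Rightarrow> nat \<Rightarrow> 'x \<Rightarrow> complex" where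
  "Zshift \<tau> \<Phi> = (\<lambda>\<omega> i x. char_of \<omega> \<tau> * coord_mult (\<lambda>i. char_of (\<gamma>s i) \<tau>) (\<Phi> \<omega>) i x)"

lemma Zshift_carr: "\<Phi> \<in> carr KN \<Longrightarrow> Zshift \<tau> \<Phi> \<in> carr KN"
  unfolding Zshift_def by (rule mult_carr_KN[OF coord_mult_carr, where B = 1]) auto

lemma Zshift_cong:
  assumes "\<Phi> \<in> carr KN" "\<Psi> \<in> carr KN" "KN.hdist \<Phi> \<Psi> = 0"
  shows "KN.hdist (Zshift \<tau> \<Phi>) (Zshift \<tau> \<Psi>) = 0"
  unfolding Zshift_def
  by (rule KN_mult_cong[OF coord_mult_carr coord_mult_carr KN_coord_mult_cong, where B = 1])
     (use assms in auto)

lemma Zshift_Zk: "f \<in> carr X \<Longrightarrow> KN.hdist (Zshift \<tau> (Zk f)) (Zk (\<rho> \<tau> f)) = 0"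
  using Zk_rep by (simp add: Zshift_def coord_mult_def)

lemma Zshift_mem:
  assumes V: "closed_subspace X V" and inv: "\<And>f. f \<in> V \<Longrightarrow> \<rho> \<tau> f \<in> V" and \<Phi>: "\<Phi> \<in> ZV V"
  shows "Zshift \<tau> \<Phi> \<in> ZV V"
proof -
  interpret V: csubspace X V by unfold_locales (rule V)
  interpret M: csubspace KN "ZV V" by unfold_locales (rule closed_subspace_ZV[OF V])
  obtain f where f: "f \<in> V" "KN.hdist \<Phi> (Zk f) = 0" using \<Phi> by (rule ZV_E)
  note fc = V.sub_carr[OF f(1)]
  note c = ZV_carr[OF \<Phi>] Zk_carr[OF fc] Zk_carr[OF rep_carr[OF fc]]
  have 1: "KN.hdist (Zk (\<rho> \<tau> f)) (Zshift \<tau> (Zk f)) = 0"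
    using Zshift_Zk[OF fc] KN.hdist_commute[OF Zshift_carr[OF c(2)] c(3)] by simp
  have "Zshift \<tau> (Zk f) \<in> ZV V"
    by (rule M.sub_cong[OF Zk_ZV[OF inv[OF f(1)] rep_carr[OF fc]] Zshift_carr[OF c(2)] 1])
  moreover have "KN.hdist (Zshift \<tau> (Zk f)) (Zshift \<tau> \<Phi>) = 0"
    using Zshift_cong[OF c(1,2) f(2)] KN.hdist_commute[OF Zshift_carr[OF c(2)] Zshift_carr[OF c(1)]] by simp
  ultimately show ?thesis by (rule M.sub_cong[OF _ Zshift_carr[OF c(1)]])
qed

text \<open>For \<gamma> in \<Gamma> every coordinate factor
  \<open>char_of (\<gamma>s i) \<gamma>\<close> is 1, so the shift by \<gamma> acts as
  multiplication in the base variable alone.\<close>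

lemma ZV_exponential:
  assumes V: "invariant_space \<sigma> J \<mu> \<Gamma> V" and \<gamma>: "\<gamma> \<in> \<Gamma>" and \<Phi>: "\<Phi> \<in> ZV V"
  shows "(\<lambda>\<omega> i x. char_of \<omega> \<gamma> * \<Phi> \<omega> i x) \<in> ZV V"
proof -
  have cl: "closed_subspace X V" using V by (simp add: invariant_space_def)
  interpret M: csubspace KN "ZV V" by unfold_locales (rule closed_subspace_ZV[OF cl])
  note c = ZV_carr[OF \<Phi>]
  have "Zshift \<gamma> \<Phi> \<in> ZV V"
    by (rule Zshift_mem[OF cl _ \<Phi>]) (use V \<gamma> in \<open>simp add: invariant_space_def\<close>)
  moreover have "(\<lambda>\<omega> i x. char_of \<omega> \<gamma> * \<Phi> \<omega> i x) \<in> carr KN"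
    by (rule mult_carr_KN[OF c, where B = 1]) auto
  moreover have "KN.hdist (Zshift \<gamma> \<Phi>) (\<lambda>\<omega> i x. char_of \<omega> \<gamma> * \<Phi> \<omega> i x) = 0"
    unfolding Zshift_def
  proof (rule KN_mult_cong[OF coord_mult_carr[OF c] c KN_coord_mult_1[OF c], where B = 1])
    show "char_of (\<gamma>s i) \<gamma> = 1" if "i \<le> s" for i
      using \<gamma>s_mem[OF that] \<gamma> by (simp add: annihilator_def)
  qed auto
  ultimately show ?thesis by (rule M.sub_cong)
qed

lemma ZV_mult:
  assumes V: "invariant_space \<sigma> J \<mu> \<Gamma> V" and \<Phi>: "\<Phi> \<in> ZV V"
    and g: "g \<in> borel_measurable borel" "\<And>\<eta>. cmod (g \<eta>) \<le> B"
  shows "(\<lambda>\<omega> i x. g \<omega> * \<Phi> \<omega> i x) \<in> ZV V"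
proof (rule MI_mult[OF _ _ \<Phi> g])
  show "closed_subspace KN (ZV V)"
    using V by (intro closed_subspace_ZV) (simp add: invariant_space_def)
qed (rule ZV_exponential[OF V])

lemma MI_space_ZV:
  assumes V: "invariant_space \<sigma> J \<mu> \<Gamma> V"
  shows "MI_space N H (exponentials \<Gamma>) (ZV V)"
  unfolding MI_space_def
proof (intro conjI ballI determining_exponentials)
  show "closed_subspace KN (ZV V)"
    using V by (intro closed_subspace_ZV) (simp add: invariant_space_def)
  show "(\<lambda>\<omega>. hscale H (g \<omega>) (\<Phi> \<omega>)) \<in> ZV V" if "\<Phi> \<in> ZV V" "g \<in> exponentials \<Gamma>" for \<Phi> g
    using that ZV_exponential[OF V] by (auto simp: exponentials_def hpower_simps)
qed

text \<open>Supplies an element of \<Delta> that distinguishes \<xi> from a character outside its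
  coset, which makes an interpolation denominator nonzero.\<close>

lemma mask_zero_witness:
  assumes "mask \<xi> j = 0"
  shows "\<exists>\<delta>\<in>\<Delta>. char_of \<xi> \<delta> \<noteq> char_of (\<gamma>s j) \<delta>"
proof -
  have "\<gamma>s j - \<xi> \<notin> annihilator \<Delta>"
    using assms by (simp add: mask_def coset_iff split: if_splits)
  then obtain \<delta> where \<delta>: "\<delta> \<in> \<Delta>" "char_of (\<gamma>s j - \<xi>) \<delta> \<noteq> 1"
    by (auto simp: annihilator_def)
  then have "char_of \<xi> \<delta> \<noteq> char_of (\<gamma>s j) \<delta>" by auto
  then show ?thesis using \<delta>(1) by blast
qed

lemma char_mask_eq:
  assumes "mask \<xi> i \<noteq> 0" "\<delta> \<in> \<Delta>"
  shows "char_of (\<gamma>s i) \<delta> = char_of \<xi> \<delta>"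
proof -
  have "\<gamma>s i - \<xi> \<in> annihilator \<Delta>"
    using assms by (simp add: mask_def coset_iff split: if_splits)
  then have "char_of (\<gamma>s i - \<xi>) \<delta> = 1" using assms(2) by (simp add: annihilator_def)
  moreover have "char_of (\<gamma>s i) \<delta> = char_of (\<gamma>s i - \<xi>) \<delta> * char_of \<xi> \<delta>"
    by (simp only: char_of_dual_plus[symmetric] diff_add_cancel)
  ultimately show ?thesis by (simp only: mult_1)
qed

text \<open>The coordinate multipliers preserving \<open>ZV V\<close> form an algebra that contains the functions
  \<open>i \<mapsto> (\<delta>, \<gamma>s i)\<close> with \<open>\<delta> \<in> \<Delta>\<close>; the mask of a coset is a Lagrange interpolation
  polynomial in these.\<close>

lemma mask_preserves:
  assumes V: "invariant_space \<sigma> J \<mu> \<Gamma> V" and V\<Delta>: "invariant_space \<sigma> J \<mu> \<Delta> V"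
    and \<Phi>: "\<Phi> \<in> ZV V"
  shows "(\<lambda>\<omega>. coord_mult (mask \<xi>) (\<Phi> \<omega>)) \<in> ZV V"
proof -
  have cl: "closed_subspace X V" using V by (simp add: invariant_space_def)
  interpret M: csubspace KN "ZV V" by unfold_locales (rule closed_subspace_ZV[OF cl])
  define A where "A c \<longleftrightarrow> (\<forall>\<Phi>\<in>ZV V. (\<lambda>\<omega>. coord_mult c (\<Phi> \<omega>)) \<in> ZV V)" for c
  have A_char: "A (\<lambda>i. char_of (\<gamma>s i) \<delta>)" if \<delta>: "\<delta> \<in> \<Delta>" for \<delta>
    unfolding A_def
  proof
    fix \<Phi> assume \<Phi>: "\<Phi> \<in> ZV V"
    have "Zshift \<delta> \<Phi> \<in> ZV V"
      by (rule Zshift_mem[OF cl _ \<Phi>]) (use V\<Delta> \<delta> in \<open>simp add: invariant_space_def\<close>)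
    \<comment> \<open>The base factor of the shift is unimodular, and multiplying by its conjugate,
      the character value at \<open>- \<delta>\<close>, cancels it.\<close>
    then have "(\<lambda>\<omega> i x. char_of \<omega> (- \<delta>) * Zshift \<delta> \<Phi> \<omega> i x) \<in> ZV V"
      by (rule ZV_mult[OF V, where B = 1]) (simp_all only: measurable_char_of_apply norm_char_of order_refl)
    moreover have "char_of \<omega> (- \<delta>) * Zshift \<delta> \<Phi> \<omega> i x = coord_mult (\<lambda>i. char_of (\<gamma>s i) \<delta>) (\<Phi> \<omega>) i x" for \<omega> i x
      using char_of_cnj_mult[of \<omega> \<delta>] by (simp add: Zshift_def mult.commute flip: mult.assoc)
    ultimately show "(\<lambda>\<omega>. coord_mult (\<lambda>i. char_of (\<gamma>s i) \<delta>) (\<Phi> \<omega>)) \<in> ZV V" by simp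
  qed
  \<comment> \<open>Affine closure suffices in place of general sums: each interpolation factor is
    affine in one character multiplier.\<close>
  have A_affine: "A (\<lambda>i. a * c i + b)" if "A c" for a b c
    unfolding A_def
  proof
    fix \<Phi> assume \<Phi>: "\<Phi> \<in> ZV V"
    then have "hadd KN (hscale KN a (\<lambda>\<omega>. coord_mult c (\<Phi> \<omega>))) (hscale KN b \<Phi>) \<in> ZV V"
      using that unfolding A_def by (intro M.sub_add M.sub_scale) blast
    then show "(\<lambda>\<omega>. coord_mult (\<lambda>i. a * c i + b) (\<Phi> \<omega>)) \<in> ZV V"
      by (simp add: coord_mult_def hpower_simps distrib_right mult.assoc)
  qed
  have A_prod: "A (\<lambda>i. \<Prod>j\<in>S. f j i)" if "finite S" "\<And>j. j \<in> S \<Longrightarrow> A (f j)" for S :: "nat set" and f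
    using that
  proof (induction S rule: finite_induct)
    case empty
    then show ?case by (simp add: A_def coord_mult_def)
  next
    case (insert j S)
    then have j: "A (f j)" and S: "A (\<lambda>i. \<Prod>j\<in>S. f j i)" by auto
    have "(\<lambda>\<omega>. coord_mult (f j) (coord_mult (\<lambda>i. \<Prod>j\<in>S. f j i) (\<Phi> \<omega>))) \<in> ZV V" if "\<Phi> \<in> ZV V" for \<Phi>
      using bspec[OF j[unfolded A_def] bspec[OF S[unfolded A_def] that]] .
    then show ?case using insert(1,2) by (simp add: A_def coord_mult_def mult.assoc)
  qed
  define S where "S = {j. j \<le> s \<and> mask \<xi> j = 0}"
  have "\<forall>j\<in>S. \<exists>\<delta>. \<delta> \<in> \<Delta> \<and> char_of \<xi> \<delta> \<noteq> char_of (\<gamma>s j) \<delta>"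
    using mask_zero_witness unfolding S_def by blast
  then obtain \<delta> where \<delta>: "\<And>j. j \<in> S \<Longrightarrow> \<delta> j \<in> \<Delta>" "\<And>j. j \<in> S \<Longrightarrow> char_of \<xi> (\<delta> j) \<noteq> char_of (\<gamma>s j) (\<delta> j)"
    unfolding bchoice_iff by blast
  define d where "d j = char_of \<xi> (\<delta> j) - char_of (\<gamma>s j) (\<delta> j)" for j
  \<comment> \<open>\<open>f j i\<close> equals the difference of
    \<open>char_of (\<gamma>s i) (\<delta> j)\<close> and
    \<open>char_of (\<gamma>s j) (\<delta> j)\<close>, divided by \<open>d j\<close>. It vanishes at
    \<open>i = j\<close> and is 1 on the coset of \<xi>, where all characters agree on \<Delta>; so
    the product over the indices outside the coset is the mask.\<close>
  define f where "f j i = 1 / d j * char_of (\<gamma>s i) (\<delta> j) + - char_of (\<gamma>s j) (\<delta> j) / d j" for j i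
  have d0: "d j \<noteq> 0" if "j \<in> S" for j using \<delta>(2)[OF that] by (simp add: d_def)
  have "A (\<lambda>i. \<Prod>j\<in>S. f j i)"
    unfolding f_def by (intro A_prod A_affine A_char \<delta>(1)) (simp add: S_def)
  then have mem: "(\<lambda>\<omega>. coord_mult (\<lambda>i. \<Prod>j\<in>S. f j i) (\<Phi> \<omega>)) \<in> ZV V"
    using \<Phi> unfolding A_def by blast
  have "(\<Prod>j\<in>S. f j i) = mask \<xi> i" if i: "i \<le> s" for i
  proof (cases "mask \<xi> i = 0")
    case True
    then have "i \<in> S" using i by (simp add: S_def)
    moreover have "f i i = 0" by (simp add: f_def)
    moreover have "finite S" by (simp add: S_def)
    ultimately have "(\<Prod>j\<in>S. f j i) = 0" using prod_zero_iff by blast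
    then show ?thesis using True by simp
  next
    case False
    have "f j i = 1" if j: "j \<in> S" for j
    proof -
      have "f j i = (char_of (\<gamma>s i) (\<delta> j) - char_of (\<gamma>s j) (\<delta> j)) / d j"
        by (simp add: f_def diff_divide_distrib)
      also have "\<dots> = d j / d j"
        unfolding char_mask_eq[OF False \<delta>(1)[OF j]] d_def ..
      finally show ?thesis using d0[OF j] by simp
    qed
    then have "(\<Prod>j\<in>S. f j i) = 1" by simp
    then show ?thesis using False by (simp add: mask_def split: if_splits)
  qed
  then have "KN.hdist (\<lambda>\<omega>. coord_mult (\<lambda>i. \<Prod>j\<in>S. f j i) (\<Phi> \<omega>)) (\<lambda>\<omega>. coord_mult (mask \<xi>) (\<Phi> \<omega>)) = 0"
    by (intro KN_coord_mult_cong KN.hdist_self ZV_carr[OF \<Phi>])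
  then show ?thesis by (rule M.sub_cong[OF mem coord_mult_carr[OF ZV_carr[OF \<Phi>]]])
qed

text \<open>The multiplier \<open>i \<mapsto> (\<delta>, \<gamma>s i)\<close> is constant on cosets,
  hence the combination of masks with coefficients \<open>char_of \<xi> \<delta>\<close>. With the
  base factor inserted this is the shift by \<delta>, so the transform of
  \<open>\<rho> \<delta> f\<close> lies in \<open>ZV V\<close>.\<close>

lemma invariant_of_mask:
  assumes V: "invariant_space \<sigma> J \<mu> \<Gamma> V"
    and mask: "\<And>\<xi> \<Phi>. \<xi> \<in> \<N> \<Longrightarrow> \<Phi> \<in> ZV V \<Longrightarrow> (\<lambda>\<omega>. coord_mult (mask \<xi>) (\<Phi> \<omega>)) \<in> ZV V"
  shows "invariant_space \<sigma> J \<mu> \<Delta> V"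
  unfolding invariant_space_def
proof (intro conjI ballI)
  show cl: "closed_subspace X V" using V by (simp add: invariant_space_def)
  interpret V: csubspace X V by unfold_locales (rule cl)
  interpret M: csubspace KN "ZV V" by unfold_locales (rule closed_subspace_ZV[OF cl])
  fix f \<delta> assume f: "f \<in> V" and \<delta>: "\<delta> \<in> \<Delta>"
  note fc = V.sub_carr[OF f]
  note rc = rep_carr[OF fc, of \<delta>]
  note c = Zk_carr[OF fc] Zk_carr[OF rc]
  have Zf: "Zk f \<in> ZV V" by (rule Zk_ZV[OF f fc])
  let ?c = "\<lambda>i. \<Sum>\<xi>\<in>\<N>. char_of \<xi> \<delta> * mask \<xi> i"
  have mem: "(\<lambda>\<omega>. coord_mult ?c (Zk f \<omega>)) \<in> ZV V"
  proof (rule sum_coord_mult_mem[where T = "\<lambda>c \<omega>. coord_mult c (Zk f \<omega>)", OF M.csubspace_axioms finite_\<N>])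
    show "(\<lambda>\<omega>. coord_mult (\<lambda>i. char_of \<xi> \<delta> * mask \<xi> i) (Zk f \<omega>)) \<in> ZV V" if "\<xi> \<in> \<N>" for \<xi>
      using M.sub_scale[OF mask[OF that Zf], of "char_of \<xi> \<delta>"]
      by (simp add: coord_mult_def hpower_simps mult.assoc)
    show "(\<lambda>\<omega>. coord_mult (\<lambda>_. 0) (Zk f \<omega>)) \<in> ZV V"
      using M.sub_scale[OF Zf, of 0] by (simp add: coord_mult_def hpower_simps)
  qed (simp add: coord_mult_def hpower_simps distrib_right)
  have eq: "?c i = char_of (\<gamma>s i) \<delta>" if i: "i \<le> s" for i
  proof -
    have "\<gamma>s i \<in> coset (THE \<xi>. \<xi> \<in> \<N> \<and> \<gamma>s i \<in> coset \<xi> (annihilator \<Delta>)) (annihilator \<Delta>)"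
      using theI'[OF \<N>_unique[OF i]] by blast
    then show ?thesis
      unfolding sum_mask[OF i] using \<delta> by (intro char_mask_eq[symmetric]) (simp_all add: mask_def)
  qed
  have "KN.hdist (\<lambda>\<omega>. coord_mult ?c (Zk f \<omega>)) (\<lambda>\<omega>. coord_mult (\<lambda>i. char_of (\<gamma>s i) \<delta>) (Zk f \<omega>)) = 0"
    by (intro KN_coord_mult_cong KN.hdist_self c eq)
  then have "(\<lambda>\<omega>. coord_mult (\<lambda>i. char_of (\<gamma>s i) \<delta>) (Zk f \<omega>)) \<in> ZV V"
    by (rule M.sub_cong[OF mem coord_mult_carr[OF c(1)]])
  then have "Zshift \<delta> (Zk f) \<in> ZV V"
    unfolding Zshift_def by (rule ZV_mult[OF V, where B = 1]) auto
  then have "Zk (\<rho> \<delta> f) \<in> ZV V"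
    by (rule M.sub_cong[OF _ c(2) Zshift_Zk[OF fc]])
  then obtain h where h: "h \<in> V" "KN.hdist (Zk (\<rho> \<delta> f)) (Zk h) = 0" by (rule ZV_E)
  \<comment> \<open>Injectivity of Z in the form of the isometry: transforms at distance 0 come from
    functions at distance 0, and \<open>V\<close> contains all representatives.\<close>
  have "X.hdist h (\<rho> \<delta> f) = 0"
    using h(2) Zk_dist[OF rc V.sub_carr[OF h(1)]] X.hdist_commute[OF rc V.sub_carr[OF h(1)]] by simp
  then show "\<rho> \<delta> f \<in> V" by (rule V.sub_cong[OF h(1) rc])
qed

text \<open>The invariance under \<Gamma> already gives the MI property, and the decomposition is
  orthogonal regardless of \<open>V\<close>; what remains of decomposability is stability under the
  masks.\<close>

theorem invariant_iff_decomposable: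
  assumes V: "invariant_space \<sigma> J \<mu> \<Gamma> V"
  shows "invariant_space \<sigma> J \<mu> \<Delta> V \<longleftrightarrow>
    decomposable_MI_space N H (exponentials \<Gamma>) \<N> HP (ZV V)"
proof -
  have "closed_subspace KN (ZV V)"
    using V by (intro closed_subspace_ZV) (simp add: invariant_space_def)
  then have "decomposable_MI_space N H (exponentials \<Gamma>) \<N> HP (ZV V) \<longleftrightarrow>
      (\<forall>\<xi>\<in>\<N>. \<forall>\<Phi>\<in>ZV V. (\<lambda>\<omega>. coord_mult (mask \<xi>) (\<Phi> \<omega>)) \<in> ZV V)"
    by (simp only: decomposable_MI_space_def MI_space_ZV[OF V] orthogonal_decomposition_HP
        proj_image_iff simp_thms)
  then show ?thesis
    using mask_preserves[OF V] invariant_of_mask[OF V] by blast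
qed

end

theorem theorem4p2:
  fixes \<Gamma> \<Delta> :: "'g::{ab_group_add,countable} set"
    and \<mu> :: "'x measure" and \<sigma> :: "'g \<Rightarrow> 'x \<Rightarrow> 'x" and J :: "'g \<Rightarrow> 'x \<Rightarrow> real"
    and C :: "'x set" and m :: "'g dual measure"
    and \<gamma>s :: "nat \<Rightarrow> 'g dual" and s :: nat
    and \<Omega> \<N> :: "'g dual set" and V :: "('x \<Rightarrow> complex) set"
  assumes "is_subgroup \<Gamma>" and "is_subgroup \<Delta>" and "\<Gamma> \<subseteq> \<Delta>"
    and "finite (cosets UNIV \<Gamma>)"
    and "sigma_finite_measure \<mu>" and "hseparable (L2 \<mu> scalars)"
    and "quasi_invariant \<sigma> J \<mu>" and "tiling_set \<sigma> \<mu> C"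
    and "is_haar m"
    and "bij_betw \<gamma>s {..s} (annihilator \<Gamma>)"
    and "\<Omega> \<in> sets m" and "is_section \<Omega> UNIV (annihilator \<Gamma>)"
    and "is_section \<N> (annihilator \<Gamma>) (annihilator \<Delta>)"
    and "invariant_space \<sigma> J \<mu> \<Gamma> V"
  shows "invariant_space \<sigma> J \<mu> \<Delta> V \<longleftrightarrow>
    decomposable_MI_space (restrict_space m \<Omega>) (hpower (Suc s) (L2_tile \<mu> C))
      (exponentials \<Gamma>) \<N> (H_part \<mu> C \<gamma>s s \<Delta>) (zak_image \<sigma> J \<mu> C m \<gamma>s s \<Omega> V)"
proof -
  interpret zak_refined \<mu> \<sigma> J m C \<Gamma> \<gamma>s s \<Omega> \<Delta> \<N>
    by (intro zak_refined.intro zak_section.intro zak_setting.intro quasi_action.intro haar.intro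
        quasi_action_axioms.intro zak_setting_axioms.intro zak_section_axioms.intro
        zak_refined_axioms.intro assms)
  show ?thesis by (rule invariant_iff_decomposable[OF assms(14)])
qed

end
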